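(* Let $(\phi^t)_{t\in\mathbb{R}}$ be a continuous flow on a compact topological space $X$, let $(V,|\cdot|)$ be a Banach space, let $k\ge1$ be an integer with $k\le\dim V$, and let $B\colon X\times[0,+\infty)\to L(V)$, $(x,t)\mapsto B_x^t$, be a cocycle over $(\phi^t)$ such that $B_x^t$ is injective for every $x\in X$ and $t\ge0$. Assume that $x\mapsto B_x^t$ is continuous in the operator norm topology for each fixed $t\ge0$, and that $(x,t)\mapsto B_x^t$ is continuous in the strong operator topology. Then the following are equivalent: (a) There exist $C,\gamma>0$ such that for any $x\in X$, $t\ge0$, $$\sup_{0\le\epsilon\le1}c_{k+1}(B_{\phi^\epsilon x}^t)\le Ce^{-\gamma t}c_k(B_x^{t+1}).$$ (b) There exist a continuous equivariant splitting $V=\mathcal{E}(x)\oplus\mathcal{F}(x)$ $(x\in X)$, for which $\dim\mathcal{E}(x)=k<\infty$ for all $x\in X$, and constants $C,\gamma>0$ such that for all $x\in X$ and $t\ge0$, $$\sup_{\substack{u\in\mathcal{E}(x),\,v\in\mathcal{F}(x)\\|u|=|v|=1}}\frac{|B_x^tv|}{|B_x^tu|}\le Ce^{-\gamma t}.$$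
   Context: A continuous flow on $X$ is a family $\{\phi^t:t\in\mathbb{R}\}$ of homeomorphisms of $X$ with $\phi^{t+s}=\phi^t\circ\phi^s$ for all $s,t\in\mathbb{R}$ and $t\mapsto\phi^tx$ continuous for every $x\in X$. A cocycle over $(\phi^t)$ is a map $B\colon X\times[0,\infty)\to L(V)$ with $B_x^{s+t}=B_{\phi^tx}^sB_x^t$ for all $x\in X$, $s,t\ge0$. $L(V)$ is the space of bounded linear operators on $V$ with operator norm $|\cdot|$. Gelfand numbers: for an integer $q\ge1$, $c_q(A)=\inf\{|A|_F| : F\subset V\text{ a closed subspace of codimension }q-1\}$. $\mathcal{G}(V)$ is the set of closed subspaces of $V$ with the Hausdorff metric $d_H(E,E')=\max\{\sup_{e\in S_E}d(e,S_{E'}),\ \sup_{e'\in S_{E'}}d(e',S_E)\}$, where $S_E=\{v\in E:|v|=1\}$ (and $d_H(\{0\},\{0\})=0$). A continuous equivariant splitting is a pair of continuous maps $\mathcal{E},\mathcal{F}\colon X\to\mathcal{G}(V)$ with $V=\mathcal{E}(x)\oplus\mathcal{F}(x)$, $B_x^t\mathcal{E}(x)=\mathcal{E}(\phi^tx)$ and $B_x^t\mathcal{F}(x)\subseteq\mathcal{F}(\phi^tx)$ for all $x\in X$, $t\ge0$. *)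

theory Defs
  imports "HOL-Analysis.Analysis"
begin

definition continuous_flow :: "(real \<Rightarrow> 'x::topological_space \<Rightarrow> 'x) \<Rightarrow> bool" where
  "continuous_flow \<phi> \<longleftrightarrow>
     (\<forall>t. \<exists>g. homeomorphism UNIV UNIV (\<phi> t) g) \<and>
     (\<forall>t s. \<phi> (t + s) = \<phi> t \<circ> \<phi> s) \<and>
     (\<forall>x. continuous_on UNIV (\<lambda>t. \<phi> t x))"

text \<open>Throughout, the values of a cocycle at negative times are irrelevant.\<close>

definition cocycle_over ::
    "(real \<Rightarrow> 'x \<Rightarrow> 'x) \<Rightarrow> ('x \<Rightarrow> real \<Rightarrow> 'v::real_normed_vector \<Rightarrow>\<^sub>L 'v) \<Rightarrow> bool" where
  "cocycle_over \<phi> B \<longleftrightarrow>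
     (\<forall>x. \<forall>s\<ge>0. \<forall>t\<ge>0. B x (s + t) = B (\<phi> t x) s o\<^sub>L B x t)"


text \<open>The set \<open>S\<close> below is mapped injectively onto a basis of the quotient by \<open>F\<close>.\<close>

definition has_codim :: "'v::real_vector set \<Rightarrow> nat \<Rightarrow> bool" where
  "has_codim F n \<longleftrightarrow>
     (\<exists>S. finite S \<and> card S = n \<and> independent S \<and> span S \<inter> F = {0} \<and> span (S \<union> F) = UNIV)"

text \<open>Taking the supremum over the unit ball rather than the unit sphere gives the
  value \<open>0\<close> on the trivial subspace.\<close>

definition restr_norm ::
    "('v::real_normed_vector \<Rightarrow>\<^sub>L 'v) \<Rightarrow> 'v set \<Rightarrow> real" where
  "restr_norm A F = (SUP v\<in>{v \<in> F. norm v \<le> 1}. norm (blinfun_apply A v))"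

definition gelfand_number ::
    "nat \<Rightarrow> ('v::real_normed_vector \<Rightarrow>\<^sub>L 'v) \<Rightarrow> real" where
  "gelfand_number q A = (INF F\<in>{F. subspace F \<and> closed F \<and> has_codim F (q - 1)}. restr_norm A F)"


definition grassmannian :: "'v::real_normed_vector set set" where
  "grassmannian = {E. subspace E \<and> closed E}"

definition unit_sphere :: "'v::real_normed_vector set \<Rightarrow> 'v set" where
  "unit_sphere E = {v \<in> E. norm v = 1}"

text \<open>The distance of a point to the empty set is \<open>0\<close> for \<^const>\<open>infdist\<close>, so the trivial
  subspace has to be treated separately. Its distance to every other subspace is set to \<open>2\<close>,
  an upper bound for the distance of unit vectors, which makes it an isolated point.\<close>

definition grassmann_dist :: "'v::real_normed_vector set \<Rightarrow> 'v set \<Rightarrow> real" where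
  "grassmann_dist E E' =
     (if unit_sphere E = {} \<and> unit_sphere E' = {} then 0
      else if unit_sphere E = {} \<or> unit_sphere E' = {} then 2
      else max (SUP e\<in>unit_sphere E. infdist e (unit_sphere E'))
               (SUP e'\<in>unit_sphere E'. infdist e' (unit_sphere E)))"

lemma infdist_unit_sphere_le:
  assumes "e \<in> unit_sphere E" "unit_sphere E' \<noteq> {}"
  shows "infdist e (unit_sphere E') \<le> 2"
proof -
  obtain f where f: "f \<in> unit_sphere E'" using assms by blast
  have "dist e f \<le> norm e + norm f"
    by (simp add: dist_norm norm_triangle_ineq4)
  also have "\<dots> = 2" using assms f by (simp add: unit_sphere_def)
  finally show ?thesis using infdist_le2[OF f] by blast
qed

lemma bdd_above_infdist_unit_sphere:
  assumes "unit_sphere E' \<noteq> {}"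
  shows "bdd_above ((\<lambda>e. infdist e (unit_sphere E')) ` unit_sphere E)"
  using infdist_unit_sphere_le[OF _ assms] by (meson bdd_aboveI2)

lemma excess_nonneg:
  assumes "unit_sphere E \<noteq> {}" "unit_sphere E' \<noteq> {}"
  shows "0 \<le> (SUP e\<in>unit_sphere E. infdist e (unit_sphere E'))"
  using assms bdd_above_infdist_unit_sphere[of E' E]
  by (meson cSUP_upper2 equals0I infdist_nonneg)

lemma excess_le_2:
  assumes "unit_sphere E \<noteq> {}" "unit_sphere E' \<noteq> {}"
  shows "(SUP e\<in>unit_sphere E. infdist e (unit_sphere E')) \<le> 2"
  using assms infdist_unit_sphere_le by (intro cSUP_least) auto

lemma excess_triangle:
  assumes E: "unit_sphere E \<noteq> {}" "unit_sphere E' \<noteq> {}" "unit_sphere E'' \<noteq> {}"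
  shows "(SUP e\<in>unit_sphere E. infdist e (unit_sphere E''))
    \<le> (SUP e\<in>unit_sphere E. infdist e (unit_sphere E'))
      + (SUP e\<in>unit_sphere E'. infdist e (unit_sphere E''))" (is "_ \<le> ?a + ?b")
proof (rule cSUP_least[OF E(1)])
  fix e assume e: "e \<in> unit_sphere E"
  have "infdist e (unit_sphere E'') - ?b \<le> infdist e (unit_sphere E')"
    unfolding infdist_notempty[OF E(2)]
  proof (rule cINF_greatest[OF E(2)])
    fix f assume f: "f \<in> unit_sphere E'"
    have "infdist f (unit_sphere E'') \<le> ?b"
      by (rule cSUP_upper[OF f bdd_above_infdist_unit_sphere[OF E(3)]])
    then show "infdist e (unit_sphere E'') - ?b \<le> dist e f"
      using infdist_triangle[of e "unit_sphere E''" f] by linarith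
  qed
  moreover have "infdist e (unit_sphere E') \<le> ?a"
    by (rule cSUP_upper[OF e bdd_above_infdist_unit_sphere[OF E(2)]])
  ultimately show "infdist e (unit_sphere E'') \<le> ?a + ?b" by linarith
qed

lemma closed_unit_sphere: "E \<in> grassmannian \<Longrightarrow> closed (unit_sphere E)"
proof -
  assume "E \<in> grassmannian"
  moreover have "closed (sphere (0::'a) 1)" by (simp add: sphere_def dist_norm closed_Collect_eq continuous_intros)
  moreover have "unit_sphere E = E \<inter> sphere 0 1" by (auto simp: unit_sphere_def)
  ultimately show ?thesis by (simp add: grassmannian_def closed_Int)
qed

lemma excess_zero_imp_subset:
  assumes "unit_sphere E \<noteq> {}" "unit_sphere E' \<noteq> {}" "E' \<in> grassmannian"
    and "(SUP e\<in>unit_sphere E. infdist e (unit_sphere E')) \<le> 0"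
  shows "unit_sphere E \<subseteq> unit_sphere E'"
proof
  fix e assume e: "e \<in> unit_sphere E"
  have "infdist e (unit_sphere E') \<le> 0"
    using cSUP_upper[OF e bdd_above_infdist_unit_sphere[OF assms(2)]] assms(4) by linarith
  then show "e \<in> unit_sphere E'"
    using in_closed_iff_infdist_zero[OF closed_unit_sphere[OF assms(3)] assms(2)]
      infdist_nonneg[of e "unit_sphere E'"] by auto
qed

lemma subset_of_unit_sphere_subset:
  assumes "E \<in> grassmannian" "E' \<in> grassmannian" "unit_sphere E \<subseteq> unit_sphere E'"
  shows "E \<subseteq> E'"
proof
  fix v assume v: "v \<in> E"
  show "v \<in> E'"
  proof (cases "v = 0")
    case True
    then show ?thesis using assms(2) by (simp add: grassmannian_def subspace_0)
  next
    case False
    then have "v /\<^sub>R norm v \<in> unit_sphere E"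
      using v assms(1) by (simp add: grassmannian_def unit_sphere_def subspace_scale)
    then have "v /\<^sub>R norm v \<in> E'" using assms(3) by (auto simp: unit_sphere_def)
    then have "norm v *\<^sub>R (v /\<^sub>R norm v) \<in> E'"
      using assms(2) by (simp only: grassmannian_def mem_Collect_eq subspace_scale)
    then show ?thesis using False by simp
  qed
qed

interpretation grassmann: Metric_space grassmannian grassmann_dist
proof
  fix E E' :: "'a set"
  show "0 \<le> grassmann_dist E E'"
    using excess_nonneg[of E E'] by (simp add: grassmann_dist_def le_max_iff_disj)
  show "grassmann_dist E E' = grassmann_dist E' E"
    by (simp add: grassmann_dist_def max.commute conj_commute disj_commute)
next
  fix E E' :: "'a set"
  assume E: "E \<in> grassmannian" "E' \<in> grassmannian"
  show "grassmann_dist E E' = 0 \<longleftrightarrow> E = E'"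
  proof
    assume d: "grassmann_dist E E' = 0"
    have "unit_sphere E = unit_sphere E'"
    proof (cases "unit_sphere E = {} \<or> unit_sphere E' = {}")
      case True
      then show ?thesis using d by (auto simp: grassmann_dist_def split: if_splits)
    next
      case False
      then show ?thesis
        using d excess_zero_imp_subset[of E E'] excess_zero_imp_subset[of E' E] E
        by (auto simp: grassmann_dist_def max_def split: if_splits)
    qed
    then show "E = E'"
      using subset_of_unit_sphere_subset E by (metis subset_antisym subset_refl)
  next
    assume "E = E'"
    then show "grassmann_dist E E' = 0"
      by (auto simp: grassmann_dist_def)
  qed
next
  fix E E' E'' :: "'a set"
  show "grassmann_dist E E'' \<le> grassmann_dist E E' + grassmann_dist E' E''"
  proof (cases "unit_sphere E = {} \<or> unit_sphere E' = {} \<or> unit_sphere E'' = {}")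
    case True
    then show ?thesis
      using excess_le_2[of E E''] excess_le_2[of E'' E] excess_nonneg[of E E'] excess_nonneg[of E' E'']
      by (cases "unit_sphere E = {}"; cases "unit_sphere E' = {}"; cases "unit_sphere E'' = {}")
        (simp_all add: grassmann_dist_def le_max_iff_disj)
  next
    case False
    then show ?thesis
      using excess_triangle[of E E' E''] excess_triangle[of E'' E' E]
      by (auto simp: grassmann_dist_def)
  qed
qed

definition continuous_equivariant_splitting ::
    "(real \<Rightarrow> 'x::topological_space \<Rightarrow> 'x) \<Rightarrow> ('x \<Rightarrow> real \<Rightarrow> 'v::real_normed_vector \<Rightarrow>\<^sub>L 'v)
      \<Rightarrow> ('x \<Rightarrow> 'v set) \<Rightarrow> ('x \<Rightarrow> 'v set) \<Rightarrow> bool" where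
  "continuous_equivariant_splitting \<phi> B E F \<longleftrightarrow>
     continuous_map euclidean grassmann.mtopology E \<and>
     continuous_map euclidean grassmann.mtopology F \<and>
     (\<forall>x. E x \<inter> F x = {0} \<and> {u + v | u v. u \<in> E x \<and> v \<in> F x} = UNIV) \<and>
     (\<forall>x. \<forall>t\<ge>0. blinfun_apply (B x t) ` E x = E (\<phi> t x) \<and>
                 blinfun_apply (B x t) ` F x \<subseteq> F (\<phi> t x))"

end

(*
  (a) to (b): by (a), for large n there is a projection Q n x of rank k whose kernel B x n contracts
  exponentially more than the k-th Gelfand number, while B x n expands its range at least at the rate of
  that number. The kernels converge to F(x), and the images under B x n of the ranges at the point
  \<phi> (-n) x converge to E(x), both exponentially fast and uniformly in x, which yields invariance and
  continuity. That E(x) and F(x) meet only in 0 is shown without ergodic theory: a vector in the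
  intersection would make B x n on E(x) lose k-dimensional volume in comparison with B x n on a
  complement U of F(x), but the images of U approach those of E(x) exponentially fast, so the ratio of
  the two volume growths stays bounded away from 0. Compactness makes the angle uniform, and domination
  follows.

  (b) to (a): restricting to F(x) bounds the Gelfand number of index k + 1 from above, and E(x), which
  meets every subspace of codimension k - 1, bounds the one of index k from below.
*)
theory Submission
  imports Defs "Jordan_Normal_Form.Determinant"
begin

text \<open>The cocycle is bounded above over unit times, but at first nothing bounds
  \<open>gk x (n + 1)\<close> below by \<open>gk x n\<close>. The unit of slack in (a), time t + 1
  against t with a shifted base point, makes up for this: \<epsilon> = 0 pays for one more step
  after time n and makes the kernels converge, \<epsilon> = 1 pays for one more step before time 0
  and makes the images converge. Uniform expansion of E is available only once E is known to be
  continuous.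

  A Banach space offers no singular vectors. Biorthogonal systems adapted to an operator replace
  them, at the price of constants that depend on k alone.

  E(x) is determined by the past of x and F(x) by its future, so no projection at a finite time sees
  both, and transversality cannot be read off from the approximations. In place of volumes, the
  comparison map between E and U is measured by its determinant, whose relative loss per step is
  exponentially small and therefore summable.\<close>

subsection \<open>Finite dimension and finite codimension\<close>

text \<open>A relation instead of \<open>dim W = k\<close>, because \<open>dim\<close> is 0 on
  infinite-dimensional spaces too; here a finite basis is part of the notion.\<close>

definition has_dim :: "'v::real_vector set \<Rightarrow> nat \<Rightarrow> bool" where
  "has_dim W k \<longleftrightarrow> (\<exists>S. finite S \<and> independent S \<and> card S = k \<and> span S = W)"

lemma has_dim_subspace: "has_dim W k \<Longrightarrow> subspace W"
  by (auto simp: has_dim_def)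

lemma has_dim_card_le:
  assumes "has_dim W k" "independent S" "S \<subseteq> W"
  shows "finite S \<and> card S \<le> k"
  using assms independent_span_bound[of _ S] by (auto simp: has_dim_def)

lemma has_dim_imp_dim: "has_dim W k \<Longrightarrow> dim W = k"
  unfolding has_dim_def using dim_span_eq_card_independent by metis

lemma has_dimI:
  assumes "finite b" "span b = W" "dim W = k"
  shows "has_dim W k"
proof -
  obtain B where B: "B \<subseteq> W" "independent B" "W \<subseteq> span B" "card B = dim W"
    by (rule basis_exists[of W])
  have "B \<subseteq> span b" using B(1) assms(2) by simp
  then have "finite B" using independent_span_bound[OF assms(1) B(2)] by simp
  moreover have "span B = W"
    using B(1,3) span_minimal[of B W] assms(2) subspace_span[of b] by simp
  moreover have "card B = k" using B(4) assms(3) by simp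
  ultimately show ?thesis unfolding has_dim_def using B(2) by (intro exI[of _ B] conjI)
qed

text \<open>The link to the form in which the theorem states the dimension of E(x).\<close>

lemma has_dim_iff: "(\<exists>b. finite b \<and> span b = W) \<and> dim W = k \<longleftrightarrow> has_dim W k"
  using has_dimI[of _ W k] has_dim_imp_dim[of W k] by (auto simp only: has_dim_def)

lemma has_dim_eqI:
  assumes "has_dim W k" "has_dim W' k" "W \<subseteq> W'"
  shows "W = W'"
proof (rule ccontr)
  assume "W \<noteq> W'"
  then obtain v where v: "v \<in> W'" "v \<notin> W" using assms by blast
  obtain S where S: "finite S" "independent S" "card S = k" "span S = W"
    using assms by (auto simp: has_dim_def)
  have "independent (insert v S)" using S v by (simp add: independent_insert)
  moreover have "insert v S \<subseteq> W'" using S v assms span_superset[of S] by blast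
  ultimately have "card (insert v S) \<le> k" using has_dim_card_le[OF assms(2)] by blast
  moreover have "v \<notin> S" using S v span_superset[of S] by blast
  ultimately show False using S by simp
qed

lemma inj_on_if_kernel_trivial:
  assumes "linear f" "subspace W" "\<And>v. v \<in> W \<Longrightarrow> f v = 0 \<Longrightarrow> v = 0"
  shows "inj_on f W"
proof (rule inj_onI)
  fix x y assume "x \<in> W" "y \<in> W" "f x = f y"
  then have "x - y \<in> W" "f (x - y) = 0" using assms by (auto simp: subspace_diff linear_diff)
  then show "x = y" using assms(3) by force
qed

lemma has_dim_image:
  assumes "has_dim W k" "linear f" "\<And>v. v \<in> W \<Longrightarrow> f v = 0 \<Longrightarrow> v = 0"
  shows "has_dim (f ` W) k"
proof -
  obtain S where S: "finite S" "independent S" "card S = k" "span S = W"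
    using assms by (auto simp: has_dim_def)
  have i: "inj_on f (span S)" using inj_on_if_kernel_trivial[OF assms(2) _ assms(3)] S by auto
  have "independent (f ` S)" using linear_independent_injective_image[OF assms(2) S(2) i] .
  moreover have "card (f ` S) = k" using S i by (metis card_image inj_on_subset span_superset)
  moreover have "span (f ` S) = f ` W" using linear_span_image[OF assms(2)] S by blast
  ultimately show ?thesis using S by (auto simp: has_dim_def)
qed

lemma has_dim_image_eq:
  assumes "has_dim W k" "has_dim W' k" "linear f" "f ` W \<subseteq> W'"
    and "\<And>v. v \<in> W \<Longrightarrow> f v = 0 \<Longrightarrow> v = 0"
  shows "f ` W = W'"
  using has_dim_eqI[OF has_dim_image[OF assms(1,3,5)] assms(2,4)] by blast

lemma has_dim_basis_containing:
  assumes "has_dim W k" "w \<in> W" "w \<noteq> 0"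
  obtains e j where "j < k" "e j = w" "\<And>i. i < k \<Longrightarrow> e i \<in> W"
    "\<And>c. (\<Sum>i<k. c i *\<^sub>R e i) = 0 \<Longrightarrow> \<forall>i<k. c i = (0::real)"
proof -
  obtain B where B: "{w} \<subseteq> B" "B \<subseteq> W" "independent B" "W \<subseteq> span B"
    using maximal_independent_subset_extend[of "{w}" W] assms by auto
  have fB: "finite B" using has_dim_card_le[OF assms(1) B(3,2)] by blast
  have "span B = W" using B has_dim_subspace[OF assms(1)] by (simp add: span_minimal subset_antisym)
  then have "card B = k" using B(3) has_dim_imp_dim[OF assms(1)]
    by (metis dim_span_eq_card_independent)
  then obtain e where e: "bij_betw e {..<k} B"
    using ex_bij_betw_nat_finite[OF fB] by (auto simp: atLeast0LessThan)
  obtain j where j: "j < k" "e j = w" using e B(1) by (auto simp: bij_betw_def)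
  have inj: "inj_on e {..<k}" and im: "e ` {..<k} = B" using e by (auto simp: bij_betw_def)
  have "\<forall>i<k. c i = 0" if "(\<Sum>i<k. c i *\<^sub>R e i) = 0" for c :: "nat \<Rightarrow> real"
  proof -
    have "(\<Sum>v\<in>B. c (the_inv_into {..<k} e v) *\<^sub>R v) = (\<Sum>i<k. c i *\<^sub>R e i)"
      unfolding im[symmetric] by (subst sum.reindex[OF inj]) (auto simp: the_inv_into_f_f[OF inj])
    then have "\<forall>v\<in>B. c (the_inv_into {..<k} e v) = 0"
      using independentD[OF B(3) fB subset_refl, of "\<lambda>v. c (the_inv_into {..<k} e v)"] that by auto
    then show ?thesis using im the_inv_into_f_f[OF inj] by fastforce
  qed
  then show ?thesis using that[of j e] j B(2) im by blast
qed

lemma direct_sum_projection: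
  fixes U F :: "'v::real_vector set"
  assumes "subspace U" "subspace F" "U \<inter> F = {0}" "\<And>v. \<exists>u\<in>U. \<exists>f\<in>F. v = u + f"
  obtains p where "linear p" "\<And>v. p v \<in> U" "\<And>v. v - p v \<in> F" "\<And>u. u \<in> U \<Longrightarrow> p u = u"
    "\<And>v. p v = 0 \<longleftrightarrow> v \<in> F"
proof -
  have uniq: "u = u'" if "u \<in> U" "u' \<in> U" "v - u \<in> F" "v - u' \<in> F" for u u' v
  proof -
    have "u - u' \<in> U" using that assms by (simp add: subspace_diff)
    moreover have "u - u' \<in> F" using subspace_diff[OF assms(2) that(4,3)] by simp
    ultimately have "u - u' \<in> U \<inter> F" by (rule IntI)
    then show ?thesis unfolding assms(3) by simp
  qed
  have "\<forall>v. \<exists>u. u \<in> U \<and> v - u \<in> F"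
    using assms(4) by (metis add_diff_cancel_left')
  then obtain p where p: "\<And>v. p v \<in> U" "\<And>v. v - p v \<in> F" by metis
  have pI: "p v = u" if "u \<in> U" "v - u \<in> F" for u v using uniq p that by blast
  have "linear p"
  proof (rule linearI)
    fix x y and c :: real
    have "(x + y) - (p x + p y) \<in> F"
      using subspace_add[OF assms(2) p(2)[of x] p(2)[of y]] by (simp add: algebra_simps)
    then show "p (x + y) = p x + p y" using pI p assms(1) by (simp add: subspace_add)
    have "c *\<^sub>R x - c *\<^sub>R p x \<in> F"
      using subspace_scale[OF assms(2) p(2)[of x]] by (simp add: algebra_simps)
    then show "p (c *\<^sub>R x) = c *\<^sub>R p x" using pI p assms(1) by (simp add: subspace_scale)
  qed
  moreover have "p u = u" if "u \<in> U" for u using pI that assms(2) by (simp add: subspace_0)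
  moreover have "p v = 0 \<longleftrightarrow> v \<in> F" for v
    using pI[of 0 v] p(2)[of v] assms(1) by (auto simp: subspace_0)
  ultimately show ?thesis using that p by blast
qed

lemma has_codim_iff:
  assumes "subspace F"
  shows "has_codim F n \<longleftrightarrow>
    (\<exists>U. has_dim U n \<and> U \<inter> F = {0} \<and> (\<forall>v. \<exists>u\<in>U. \<exists>f\<in>F. v = u + f))"
proof -
  have *: "span (S \<union> F) = UNIV \<longleftrightarrow> (\<forall>v. \<exists>u\<in>span S. \<exists>f\<in>F. v = u + f)" for S
    using span_Un[of S F] span_eq_iff[of F] assms by (auto simp: set_eq_iff) blast+
  show ?thesis unfolding has_codim_def has_dim_def * by auto
qed

text \<open>Otherwise the projection along F onto a complement of dimension n would be injective on
  E, and m independent vectors would fit into n dimensions.\<close>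

lemma codim_inter_nontrivial:
  assumes "subspace F" "has_codim F n" "has_dim E m" "n < m"
  obtains v where "v \<in> E" "v \<in> F" "v \<noteq> 0"
proof (rule ccontr)
  assume "\<not> thesis"
  then have triv: "v = 0" if "v \<in> E" "v \<in> F" for v
    using \<open>\<not> thesis\<close> that \<open>\<And>v. v \<in> E \<Longrightarrow> v \<in> F \<Longrightarrow> v \<noteq> 0 \<Longrightarrow> thesis\<close> by blast
  obtain U where U: "has_dim U n" "U \<inter> F = {0}" "\<And>v. \<exists>u\<in>U. \<exists>f\<in>F. v = u + f"
    using has_codim_iff[OF assms(1), THEN iffD1, OF assms(2)] by blast
  obtain p where p: "linear p" "\<And>v. p v \<in> U" "\<And>v. p v = 0 \<longleftrightarrow> v \<in> F"
    by (rule direct_sum_projection[OF has_dim_subspace[OF U(1)] assms(1) U(2,3)]) (rule that)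
  have "has_dim (p ` E) m" using has_dim_image[OF assms(3) p(1)] triv p(3) by blast
  then obtain S where "independent S" "card S = m" "span S = p ` E" by (auto simp: has_dim_def)
  then show False using has_dim_card_le[OF U(1), of S] p(2) span_superset[of S] assms(4) by fastforce
qed

text \<open>The projection p along F onto some complement has trivial kernel on E, and equal
  dimensions make it a bijection there; the vector of E with the same image as v is the E-part of
  v.\<close>

lemma codim_complement:
  assumes "subspace F" "has_codim F k" "has_dim E k" "E \<inter> F = {0}"
  shows "\<exists>u\<in>E. \<exists>f\<in>F. v = u + f"
proof -
  obtain U where U: "has_dim U k" "U \<inter> F = {0}" "\<And>v. \<exists>u\<in>U. \<exists>f\<in>F. v = u + f"
    using has_codim_iff[OF assms(1), THEN iffD1, OF assms(2)] by blast
  obtain p where p: "linear p" "\<And>v. p v \<in> U" "\<And>v. p v = 0 \<longleftrightarrow> v \<in> F"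
    by (rule direct_sum_projection[OF has_dim_subspace[OF U(1)] assms(1) U(2,3)]) (rule that)
  have "p ` E = U" using has_dim_image_eq[OF assms(3) U(1) p(1)] p assms(4) by blast
  then obtain u where u: "u \<in> E" "p u = p v" using p(2)[of v] by (metis imageE)
  then have "v - u \<in> F" using p linear_diff[OF p(1)] by (metis right_minus_eq)
  then show ?thesis using u by (metis add.commute diff_add_cancel)
qed

lemma has_codimI:
  assumes "subspace F" "has_dim E k" "E \<inter> F = {0}" "\<And>v. \<exists>u\<in>E. \<exists>f\<in>F. v = u + f"
  shows "has_codim F k"
  unfolding has_codim_iff[OF assms(1)] using assms(2-4) by blast

text \<open>A linear right inverse of f on its range carries that range to a complement of the
  kernel.\<close>

lemma has_codim_kernel:
  fixes f :: "'v::real_vector \<Rightarrow> 'w::real_vector"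
  assumes "linear f" "finite S" "range f \<subseteq> span S"
  obtains i where "i \<le> card S" "has_codim {v. f v = 0} i"
proof -
  obtain T where T: "T \<subseteq> range f" "independent T" "range f \<subseteq> span T"
    using maximal_independent_subset by blast
  have cT: "finite T" "card T \<le> card S" using independent_span_bound[OF assms(2) T(2)] T(1) assms(3) by auto
  have sT: "span T = range f" using T assms(1) linear_subspace_image[OF assms(1) subspace_UNIV]
    by (simp add: span_minimal subset_antisym)
  obtain g where g: "linear g" "\<And>v. f (g (f v)) = f v"
    using linear_exists_right_inverse_on[OF assms(1) subspace_UNIV] by auto
  have "has_dim (span T) (card T)" using T cT by (auto simp: has_dim_def)
  then have "has_dim (g ` span T) (card T)"
    by (rule has_dim_image[OF _ g(1)]) (use sT g(2) linear_0[OF assms(1)] in force)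
  then have "has_codim {v. f v = 0} (card T)"
  proof (rule has_codimI[rotated])
    show "subspace {v. f v = 0}" using assms(1) by (rule linear_subspace_kernel)
    show "g ` span T \<inter> {v. f v = 0} = {0}"
      unfolding sT using g linear_0[OF assms(1)] linear_0[OF g(1)] by force
    show "\<exists>u\<in>g ` span T. \<exists>f\<in>{v. f v = 0}. v = u + f" for v
      unfolding sT using g linear_diff[OF assms(1)]
      by (intro bexI[of _ "g (f v)"] bexI[of _ "v - g (f v)"]) auto
  qed
  then show ?thesis using that cT by blast
qed

text \<open>A vector v of F off the hyperplane h = 0 joins the complement of F: subtracting (h f / h
  v) v moves any f of F into the hyperplane.\<close>

lemma has_codim_Int_kernel:
  fixes h :: "'v::real_vector \<Rightarrow> real"
  assumes "subspace F" "has_codim F i" "linear h" "v \<in> F" "h v \<noteq> 0"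
  shows "has_codim (F \<inter> {w. h w = 0}) (Suc i)"
proof -
  obtain S where S: "finite S" "card S = i" "independent S" "span S \<inter> F = {0}" "span (S \<union> F) = UNIV"
    using assms by (auto simp: has_codim_def)
  have v0: "v \<noteq> 0" using assms linear_0 by blast
  then have vS: "v \<notin> span S" using S assms by blast
  let ?G = "F \<inter> {w. h w = 0}"
  have G: "subspace ?G" using assms linear_subspace_kernel subspace_inter by blast
  have dim: "has_dim (span (insert v S)) (Suc i)"
    unfolding has_dim_def using S vS span_superset[of S]
    by (intro exI[of _ "insert v S"]) (auto simp: independent_insert)
  have "span (insert v S) \<inter> ?G \<subseteq> {0}"
  proof clarify
    fix w assume w: "w \<in> span (insert v S)" "w \<in> F" "h w = 0"
    then obtain c where c: "w - c *\<^sub>R v \<in> span S" by (auto simp: span_insert)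
    have "w - c *\<^sub>R v \<in> F" using w assms by (simp add: subspace_diff subspace_scale)
    then have "w - c *\<^sub>R v = 0" using c S(4) by blast
    then have eq: "w = c *\<^sub>R v" by simp
    then have "c * h v = 0" using w linear_scale[OF assms(3)] by (metis real_scaleR_def)
    then show "w = 0" using eq assms by simp
  qed
  then have int: "span (insert v S) \<inter> ?G = {0}" using G subspace_0 span_zero by blast
  show ?thesis
  proof (rule has_codimI[OF G dim int])
    fix w
    have "w \<in> span (S \<union> F)" using S by simp
    then obtain s f where sf: "s \<in> span S" "f \<in> F" "w = s + f"
      using span_Un[of S F] assms(1) by (auto simp: span_eq_iff[THEN iffD2])
    let ?c = "h f / h v"
    have "s + ?c *\<^sub>R v \<in> span (insert v S)"
      using sf span_mono[of S "insert v S"] by (intro span_add span_scale) (auto intro: span_base)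
    moreover have "f - ?c *\<^sub>R v \<in> ?G"
      using sf assms linear_diff[OF assms(3)] linear_scale[OF assms(3)]
      by (simp add: subspace_diff subspace_scale)
    moreover have "w = (s + ?c *\<^sub>R v) + (f - ?c *\<^sub>R v)" using sf by simp
    ultimately show "\<exists>u\<in>span (insert v S). \<exists>f\<in>?G. w = u + f" by blast
  qed
qed

section \<open>Compactness and closedness of finite-dimensional subspaces\<close>

text \<open>Induction on S for all radii at once, since the larger span needs a larger ball of span
  S. Compact balls make span S closed, so v has positive distance from it, and this distance bounds
  the coefficient of v.\<close>

lemma compact_span_Int_cball:
  fixes S :: "'v::real_normed_vector set"
  assumes "finite S"
  shows "compact (span S \<inter> cball 0 r)"
  using assms
proof (induction S arbitrary: r)
  case empty
  then show ?case by (auto intro: finite_imp_compact)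
next
  case (insert v S)
  have closed: "closed (span S)"
  unfolding closed_sequential_limits
  proof (intro allI impI, elim conjE)
    fix x l assume x: "\<forall>n. x n \<in> span S" "x \<longlonglongrightarrow> l"
    then obtain R where R: "\<And>n. norm (x n) \<le> R" using convergent_imp_Bseq by (metis Bseq_def convergentI)
    have "closed (span S \<inter> cball 0 R)" using insert.IH compact_imp_closed by blast
    moreover have "\<forall>n. x n \<in> span S \<inter> cball 0 R" using x R by auto
    ultimately show "l \<in> span S" using x(2) closed_sequentially by blast
  qed
  show ?case
  proof (cases "v \<in> span S")
    case True
    then show ?thesis using insert.IH by (simp add: span_redundant)
  next
    case False
    then have d: "infdist v (span S) > 0"
      using in_closed_iff_infdist_zero[OF closed] span_zero infdist_nonneg
      by (metis empty_iff order_le_less)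
    let ?d = "infdist v (span S)"
    \<comment> \<open>If norm (a v + s) <= r, then |a| <= r / ?d and hence norm s <= r + |a| norm v;
      \<open>?R\<close> is this bound, with absolute values to cover negative r.\<close>
    let ?R = "\<bar>r\<bar> + \<bar>r\<bar> / ?d * norm v"
    let ?I = "(\<lambda>(a, s). a *\<^sub>R v + s) ` ({- \<bar>r\<bar> / ?d .. \<bar>r\<bar> / ?d} \<times> (span S \<inter> cball 0 ?R))"
    have "compact ({- \<bar>r\<bar> / ?d .. \<bar>r\<bar> / ?d} \<times> (span S \<inter> cball 0 ?R))"
      using insert.IH by (intro compact_Times) auto
    then have "compact ?I"
      by (rule compact_continuous_image[rotated]) (auto intro!: continuous_intros simp: case_prod_unfold)
    moreover have "span (insert v S) \<inter> cball 0 r = ?I \<inter> cball 0 r"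
    proof (intro equalityI subsetI)
      fix w assume w: "w \<in> span (insert v S) \<inter> cball 0 r"
      then obtain a where a: "w - a *\<^sub>R v \<in> span S" by (auto simp: span_insert)
      have wr: "norm w \<le> \<bar>r\<bar>" using w by auto
      have "\<bar>a\<bar> * ?d \<le> norm w"
      proof (cases "a = 0")
        case False
        have "(- 1 / a) *\<^sub>R (w - a *\<^sub>R v) \<in> span S" using a span_scale by blast
        then have "?d \<le> dist v ((- 1 / a) *\<^sub>R (w - a *\<^sub>R v))" by (rule infdist_le)
        also have "\<dots> = norm ((1 / a) *\<^sub>R w)" using False
          by (simp add: dist_norm scaleR_diff_right)
        finally show ?thesis using False by (simp add: field_simps)
      qed auto
      then have ab: "\<bar>a\<bar> \<le> \<bar>r\<bar> / ?d" using d wr by (simp add: field_simps)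
      have "norm (w - a *\<^sub>R v) \<le> norm w + \<bar>a\<bar> * norm v" by (metis norm_scaleR norm_triangle_ineq4)
      also have "\<dots> \<le> ?R" using ab wr by (intro add_mono mult_right_mono) auto
      finally have "w - a *\<^sub>R v \<in> span S \<inter> cball 0 ?R" using a by simp
      moreover have "a \<in> {- \<bar>r\<bar> / ?d .. \<bar>r\<bar> / ?d}" using ab by auto
      ultimately have "w \<in> ?I" by (intro image_eqI[of _ _ "(a, w - a *\<^sub>R v)"]) auto
      then show "w \<in> ?I \<inter> cball 0 r" using w by blast
    next
      fix w assume w: "w \<in> ?I \<inter> cball 0 r"
      then obtain a s where "w = a *\<^sub>R v + s" "s \<in> span S" by auto
      then have "w \<in> span (insert v S)"
        by (simp add: span_add span_scale span_base span_mono[THEN subsetD, of S] subset_insertI)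
      then show "w \<in> span (insert v S) \<inter> cball 0 r" using w by blast
    qed
    ultimately show ?thesis by (simp add: compact_Int_closed)
  qed
qed

lemma has_dim_closed:
  fixes W :: "'v::real_normed_vector set"
  assumes "has_dim W k"
  shows "closed W"
unfolding closed_sequential_limits
  proof (intro allI impI, elim conjE)
  fix x l assume x: "\<forall>n. x n \<in> W" "x \<longlonglongrightarrow> l"
  then obtain R where R: "\<And>n. norm (x n) \<le> R" using convergent_imp_Bseq by (metis Bseq_def convergentI)
  have "closed (W \<inter> cball 0 R)"
    using assms compact_span_Int_cball compact_imp_closed unfolding has_dim_def by blast
  moreover have "\<forall>n. x n \<in> W \<inter> cball 0 R" using x R by auto
  ultimately show "l \<in> W" using x(2) closed_sequentially by blast
qed

lemma compact_unit_sphere: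
  assumes "has_dim W k"
  shows "compact (unit_sphere W)"
proof -
  have "unit_sphere W = (W \<inter> cball 0 1) \<inter> sphere 0 1" by (auto simp: unit_sphere_def)
  moreover have "compact (W \<inter> cball 0 1)"
    using assms compact_span_Int_cball unfolding has_dim_def by blast
  moreover have "closed (sphere (0::'a) 1)"
    by (simp add: sphere_def dist_norm closed_Collect_eq continuous_intros)
  ultimately show ?thesis by (simp add: compact_Int_closed)
qed

lemma bounded_below_on_has_dim:
  fixes f :: "'v::real_normed_vector \<Rightarrow> real"
  assumes "has_dim W k" "continuous_on (unit_sphere W) f" "\<And>v. v \<in> unit_sphere W \<Longrightarrow> f v > 0"
  obtains c where "c > 0" "\<And>v. v \<in> unit_sphere W \<Longrightarrow> c \<le> f v"
proof (cases "unit_sphere W = {}")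
  case False
  then obtain x where "x \<in> unit_sphere W" "\<And>v. v \<in> unit_sphere W \<Longrightarrow> f x \<le> f v"
    using continuous_attains_inf[OF compact_unit_sphere[OF assms(1)] False assms(2)] by blast
  then show ?thesis using that[of "f x"] assms(3) by blast
qed (use that[of 1] in auto)

lemma injective_bounded_below:
  assumes "has_dim W k" "inj (blinfun_apply A)"
  obtains c where "c > 0" "\<And>v. v \<in> W \<Longrightarrow> c * norm v \<le> norm (blinfun_apply A v)"
proof -
  have "continuous_on (unit_sphere W) (\<lambda>v. norm (A v))" by (intro continuous_intros)
  moreover have "norm (A v) > 0" if "v \<in> unit_sphere W" for v
  proof -
    have "v \<noteq> 0" using that by (auto simp: unit_sphere_def)
    then have "A v \<noteq> A 0" using assms(2) by (metis injD)
    then show ?thesis by simp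
  qed
  ultimately obtain c where c: "c > 0" "\<And>v. v \<in> unit_sphere W \<Longrightarrow> c \<le> norm (A v)"
    using bounded_below_on_has_dim[OF assms(1), of "\<lambda>v. norm (A v)"] by blast
  have "c * norm v \<le> norm (A v)" if "v \<in> W" for v
  proof (cases "v = 0")
    case False
    then have "v /\<^sub>R norm v \<in> unit_sphere W"
      using that has_dim_subspace[OF assms(1)] by (simp add: unit_sphere_def subspace_scale)
    then have "c \<le> norm (A (v /\<^sub>R norm v))" using c by blast
    then show ?thesis using False by (simp add: blinfun.scaleR_right field_simps)
  qed simp
  then show ?thesis using that c by blast
qed

section \<open>Existence of norming functionals\<close>

text \<open>Hahn--Banach for one vector. Zorn's lemma is applied to linear subspaces M of the
  product with the reals that lie below the graph of the norm. Such an M stands for a partial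
  functional; unions of chains are immediate, and M is automatically single-valued.\<close>

lemma norming_functional:
  fixes w :: "'v::real_normed_vector"
  obtains h :: "'v \<Rightarrow>\<^sub>L real" where "norm h \<le> 1" "h w = norm w"
proof -
  define G where "G = {M :: ('v \<times> real) set. subspace M \<and> (w, norm w) \<in> M \<and> (\<forall>(v, a)\<in>M. a \<le> norm v)}"
  have "\<exists>M\<in>G. \<forall>X\<in>G. M \<subseteq> X \<longrightarrow> X = M"
  proof (rule subset_Zorn)
    fix C assume C: "subset.chain G C"
    show "\<exists>U\<in>G. \<forall>X\<in>C. X \<subseteq> U"
    proof (cases "C = {}")
      case True
      \<comment> \<open>The empty chain needs an upper bound as well: the line through (w, norm
        w).\<close>
      have "a \<le> norm v" if "(v, a) \<in> span {(w, norm w)}" for v a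
      proof -
        from that have "(v, a) \<in> range (\<lambda>t. t *\<^sub>R (w, norm w))" by (simp only: span_singleton)
        then obtain t where "(v, a) = t *\<^sub>R (w, norm w)" by (rule rangeE)
        then have "v = t *\<^sub>R w" "a = t * norm w" by auto
        then show ?thesis by (simp add: mult_right_mono)
      qed
      then have "span {(w, norm w)} \<in> G" by (auto simp: G_def span_base)
      then show ?thesis using True by blast
    next
      case False
      have CG: "C \<subseteq> G" and tot: "\<And>X Y. X \<in> C \<Longrightarrow> Y \<in> C \<Longrightarrow> X \<subseteq> Y \<or> Y \<subseteq> X"
        using C by (auto simp: subset.chain_def)
      have "subspace (\<Union>C)"
      proof (rule subspaceI)
        show "0 \<in> \<Union>C" using False CG by (auto simp: G_def subspace_0 subset_iff)
        show "x + y \<in> \<Union>C" if "x \<in> \<Union>C" "y \<in> \<Union>C" for x y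
        proof -
          from that obtain X Y where XY: "X \<in> C" "Y \<in> C" "x \<in> X" "y \<in> Y" by blast
          then obtain Z where "Z \<in> C" "x \<in> Z" "y \<in> Z" using tot by blast
          then show ?thesis using CG by (auto simp: G_def intro: subspace_add)
        qed
        show "c *\<^sub>R x \<in> \<Union>C" if "x \<in> \<Union>C" for x c
          using that CG by (auto simp: G_def intro: subspace_scale)
      qed
      moreover have "(w, norm w) \<in> \<Union>C" using False CG by (auto simp: G_def)
      moreover have "\<forall>(v, a)\<in>\<Union>C. a \<le> norm v" using CG by (auto simp: G_def)
      ultimately have "\<Union>C \<in> G" unfolding G_def by blast
      then show ?thesis by blast
    qed
  qed
  then obtain M where M: "M \<in> G" "\<And>X. X \<in> G \<Longrightarrow> M \<subseteq> X \<Longrightarrow> X = M" by blast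
  have sub: "subspace M" and wM: "(w, norm w) \<in> M" and le: "\<And>v a. (v, a) \<in> M \<Longrightarrow> a \<le> norm v"
    using M(1) by (auto simp: G_def)
  \<comment> \<open>Both (0, a - a') and its negative lie in M, hence below the norm, which vanishes
    at 0.\<close>
  have uniq: "a = a'" if "(v, a) \<in> M" "(v, a') \<in> M" for v a a'
  proof -
    have "(0, a - a') \<in> M" using subspace_diff[OF sub that] by simp
    moreover have "(0, a' - a) \<in> M" using subspace_diff[OF sub that(2,1)] by simp
    ultimately show ?thesis using le[of 0 "a - a'"] le[of 0 "a' - a"] by auto
  qed
  have total: "\<exists>a. (v0, a) \<in> M" for v0
  proof (rule ccontr)
    assume no: "\<nexists>a. (v0, a) \<in> M"
    \<comment> \<open>Each left-hand value is at most each right-hand value, so some c separates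
      them. Giving v0 the value c keeps the extension below the norm for either sign of its
      coefficient t.\<close>
    have sep: "a - norm (v - v0) \<le> norm (v' + v0) - a'" if "(v, a) \<in> M" "(v', a') \<in> M" for v a v' a'
    proof -
      have "a + a' \<le> norm (v + v')" using le[of "v + v'" "a + a'"] subspace_add[OF sub that] by simp
      also have "\<dots> = norm ((v - v0) + (v' + v0))" by simp
      also have "\<dots> \<le> norm (v - v0) + norm (v' + v0)" by (rule norm_triangle_ineq)
      finally show ?thesis by simp
    qed
    define L where "L = (\<lambda>(v, a). a - norm (v - v0)) ` M"
    define c where "c = Sup L"
    have "M \<noteq> {}" using wM by blast
    then have L: "L \<noteq> {}" by (simp add: L_def)
    have "bdd_above L"
      unfolding L_def using sep[OF _ wM] by (intro bdd_aboveI[of _ "norm (w + v0) - norm w"]) auto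
    then have c1: "a - norm (v - v0) \<le> c" if "(v, a) \<in> M" for v a
      unfolding c_def using that by (intro cSup_upper) (force simp: L_def)+
    have c2: "c \<le> norm (v' + v0) - a'" if "(v', a') \<in> M" for v' a'
      unfolding c_def using sep[OF _ that] by (intro cSup_least[OF L]) (auto simp: L_def)
    define X where "X = {x + y | x y. x \<in> M \<and> y \<in> span {(v0, c)}}"
    have sX: "subspace X" unfolding X_def using subspace_sums[OF sub subspace_span] .
    have MX: "M \<subseteq> X"
    proof
      fix x assume "x \<in> M"
      then have "x + 0 \<in> X" unfolding X_def using span_zero by blast
      then show "x \<in> X" by simp
    qed
    have bound: "a \<le> norm v" if "(v, a) \<in> X" for v a
    proof -
      from \<open>(v, a) \<in> X\<close> obtain x y where xy: "(v, a) = x + y" "x \<in> M" "y \<in> span {(v0, c)}"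
        unfolding X_def mem_Collect_eq by (elim exE conjE)
      from xy(3) have "y \<in> range (\<lambda>t. t *\<^sub>R (v0, c))" by (simp only: span_singleton)
      then obtain t where "y = t *\<^sub>R (v0, c)" by (elim rangeE)
      then have u: "(fst x, snd x) \<in> M" "v = fst x + t *\<^sub>R v0" "a = snd x + t * c"
        using xy by (auto simp: prod_eq_iff)
      define u where "u = fst x"
      define b where "b = snd x"
      note u = u[folded u_def b_def]
      consider "t = 0" | "t > 0" | "t < 0" by linarith
      then show ?thesis
      proof cases
        case 1
        then show ?thesis using u le by simp
      next
        case 2
        have "((1 / t) *\<^sub>R u, (1 / t) * b) \<in> M" using subspace_scale[OF sub u(1), of "1 / t"] by simp
        from c2[OF this] have "t * c \<le> t * (norm ((1 / t) *\<^sub>R u + v0) - (1 / t) * b)" using 2 by simp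
        also have "\<dots> = norm (t *\<^sub>R ((1 / t) *\<^sub>R u + v0)) - b"
          unfolding norm_scaleR right_diff_distrib using 2 by simp
        also have "t *\<^sub>R ((1 / t) *\<^sub>R u + v0) = v" using u 2 by (simp add: scaleR_add_right)
        finally show ?thesis using u by simp
      next
        case 3
        define s where "s = - t"
        have s: "s > 0" using 3 by (simp add: s_def)
        have "((1 / s) *\<^sub>R u, (1 / s) * b) \<in> M" using subspace_scale[OF sub u(1), of "1 / s"] by simp
        from c1[OF this] have "s * ((1 / s) * b - norm ((1 / s) *\<^sub>R u - v0)) \<le> s * c" using s by simp
        moreover have "s * ((1 / s) * b - norm ((1 / s) *\<^sub>R u - v0)) = b - norm (s *\<^sub>R ((1 / s) *\<^sub>R u - v0))"
          unfolding norm_scaleR right_diff_distrib using s by simp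
        moreover have "s *\<^sub>R ((1 / s) *\<^sub>R u - v0) = u - s *\<^sub>R v0" using s by (simp add: scaleR_diff_right)
        ultimately have "b - norm (u - s *\<^sub>R v0) \<le> s * c" by simp
        then show ?thesis using u by (simp add: s_def)
      qed
    qed
    have "(w, norm w) \<in> X" using MX wM by blast
    then have "X \<in> G" unfolding G_def using sX bound by auto
    then have "X = M" using M(2) MX by blast
    moreover have "0 + (v0, c) \<in> X" unfolding X_def using sub span_base[of "(v0, c)"] subspace_0 by blast
    ultimately show False using no by auto
  qed
  define h where "h = (\<lambda>v. THE a. (v, a) \<in> M)"
  have hM: "(v, h v) \<in> M" for v unfolding h_def using total[of v] uniq theI[of "\<lambda>a. (v, a) \<in> M"] by blast
  have hI: "(v, a) \<in> M \<Longrightarrow> h v = a" for v a using hM uniq by blast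
  have hn: "norm (h x) \<le> norm x" for x
    using le[OF hM[of x]] le[of "- x" "- h x"] subspace_neg[OF sub hM[of x]] by simp
  have bl: "bounded_linear h"
  proof (rule bounded_linear_intro[of _ 1])
    show "h (x + y) = h x + h y" for x y using subspace_add[OF sub hM[of x] hM[of y]] by (intro hI) simp
    show "h (r *\<^sub>R x) = r *\<^sub>R h x" for r x using subspace_scale[OF sub hM[of x], of r] by (intro hI) simp
    show "norm (h x) \<le> norm x * 1" for x using hn by simp
  qed
  show ?thesis
  proof (rule that[of "Blinfun h"])
    show "norm (Blinfun h) \<le> 1"
      by (rule norm_blinfun_bound) (use bl hn in \<open>auto simp: bounded_linear_Blinfun_apply\<close>)
    show "blinfun_apply (Blinfun h) w = norm w" using bl hI[OF wM] by (simp add: bounded_linear_Blinfun_apply)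
  qed
qed

subsection \<open>Biorthogonal systems and Gelfand numbers\<close>

definition biorthogonal ::
    "nat \<Rightarrow> (nat \<Rightarrow> 'v::real_normed_vector) \<Rightarrow> (nat \<Rightarrow> 'v \<Rightarrow>\<^sub>L real) \<Rightarrow> bool" where
  "biorthogonal k b l \<longleftrightarrow> (\<forall>i<k. \<forall>j<k. blinfun_apply (l i) (b j) = (if i = j then 1 else 0))"

definition biorth_proj ::
    "nat \<Rightarrow> (nat \<Rightarrow> 'v::real_normed_vector) \<Rightarrow> (nat \<Rightarrow> 'v \<Rightarrow>\<^sub>L real) \<Rightarrow> 'v \<Rightarrow> 'v" where
  "biorth_proj k b l v = (\<Sum>i<k. blinfun_apply (l i) v *\<^sub>R b i)"

lemma biorth_proj_bounded_linear: "bounded_linear (biorth_proj k b l)"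
  unfolding biorth_proj_def
  by (intro bounded_linear_sum bounded_linear_scaleR_const blinfun.bounded_linear_right)

lemma biorthogonal_coeff:
  assumes "biorthogonal k b l" "i < k"
  shows "blinfun_apply (l i) (\<Sum>j<k. c j *\<^sub>R b j) = c i"
proof -
  have "blinfun_apply (l i) (\<Sum>j<k. c j *\<^sub>R b j) = (\<Sum>j<k. if i = j then c j else 0)"
    unfolding blinfun.sum_right using assms
    by (intro sum.cong) (auto simp: biorthogonal_def blinfun.scaleR_right)
  then show ?thesis using assms(2) by simp
qed

lemma biorth_proj_coeff:
  assumes "biorthogonal k b l" "i < k"
  shows "blinfun_apply (l i) (biorth_proj k b l v) = blinfun_apply (l i) v"
  unfolding biorth_proj_def using biorthogonal_coeff[OF assms] .

lemma biorth_proj_idem: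
  assumes "biorthogonal k b l"
  shows "biorth_proj k b l (biorth_proj k b l v) = biorth_proj k b l v"
  using biorth_proj_coeff[OF assms] by (simp add: biorth_proj_def[of k b l "biorth_proj k b l v"])
    (simp add: biorth_proj_def)

lemma biorth_proj_base:
  assumes "biorthogonal k b l" "j < k"
  shows "biorth_proj k b l (b j) = b j"
proof -
  have "biorth_proj k b l (b j) = (\<Sum>i<k. if i = j then b i else 0)"
    unfolding biorth_proj_def using assms by (intro sum.cong) (auto simp: biorthogonal_def)
  then show ?thesis using assms(2) by simp
qed

lemma has_dim_range_biorth_proj:
  assumes "biorthogonal k b l"
  shows "has_dim (range (biorth_proj k b l)) k"
proof -
  have inj: "inj_on b {..<k}"
  proof (rule inj_onI)
    fix i j assume "i \<in> {..<k}" "j \<in> {..<k}" "b i = b j"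
    then show "i = j" using assms unfolding biorthogonal_def
      by (metis lessThan_iff zero_neq_one)
  qed
  have "independent (b ` {..<k})"
  proof (rule independent_if_scalars_zero)
    fix f x assume f: "(\<Sum>x\<in>b ` {..<k}. f x *\<^sub>R x) = 0" and x: "x \<in> b ` {..<k}"
    then obtain i where i: "i < k" "x = b i" by blast
    have "(\<Sum>j<k. f (b j) *\<^sub>R b j) = 0" using f by (simp add: sum.reindex[OF inj])
    then show "f x = 0" using biorthogonal_coeff[OF assms i(1), of "\<lambda>j. f (b j)"] i by simp
  qed auto
  moreover have "card (b ` {..<k}) = k" using card_image[OF inj] by simp
  moreover have "span (b ` {..<k}) = range (biorth_proj k b l)"
  proof
    have "b ` {..<k} \<subseteq> range (biorth_proj k b l)"
      using biorth_proj_base[OF assms] by (metis image_subsetI lessThan_iff rangeI)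
    moreover have "linear (biorth_proj k b l)"
      using biorth_proj_bounded_linear bounded_linear.linear by blast
    then have "subspace (range (biorth_proj k b l))" using linear_subspace_image subspace_UNIV by blast
    ultimately show "span (b ` {..<k}) \<subseteq> range (biorth_proj k b l)" by (rule span_minimal)
    show "range (biorth_proj k b l) \<subseteq> span (b ` {..<k})"
      unfolding biorth_proj_def by (intro image_subsetI span_sum span_scale span_base) simp
  qed
  ultimately show ?thesis by (auto simp: has_dim_def)
qed

text \<open>\<open>K\<close> is merely an upper bound of the norm, so that one constant can serve
  all points and all times.\<close>

definition rank_proj :: "nat \<Rightarrow> real \<Rightarrow> ('v::real_normed_vector \<Rightarrow> 'v) \<Rightarrow> bool" where
  "rank_proj k K Q \<longleftrightarrow> bounded_linear Q \<and> (\<forall>v. Q (Q v) = Q v) \<and> has_dim (range Q) k \<and>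
     (\<forall>v. norm (Q v) \<le> K * norm v)"

lemma
  assumes "rank_proj k K Q"
  shows rank_proj_linear: "linear Q"
    and rank_proj_idem: "Q (Q v) = Q v"
    and rank_proj_range: "has_dim (range Q) k"
    and rank_proj_norm: "norm (Q v) \<le> K * norm v"
    and rank_proj_0: "Q 0 = 0"
    and rank_proj_add: "Q (v + w) = Q v + Q w"
    and rank_proj_diff: "Q (v - w) = Q v - Q w"
    and rank_proj_scale: "Q (c *\<^sub>R v) = c *\<^sub>R Q v"
    and rank_proj_ker: "Q (v - Q v) = 0"
    and rank_proj_range_iff: "v \<in> range Q \<longleftrightarrow> Q v = v"
    and rank_proj_subspace_ker: "subspace {v. Q v = 0}"
    and rank_proj_closed_ker: "closed {v. Q v = 0}"
proof -
  have bl: "bounded_linear Q" using assms by (simp add: rank_proj_def)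
  show idem: "Q (Q v) = Q v" and "has_dim (range Q) k" "norm (Q v) \<le> K * norm v" for v
    using assms by (auto simp: rank_proj_def)
  show lin: "linear Q" using bl by (simp add: bounded_linear.linear)
  show "Q 0 = 0" "Q (v + w) = Q v + Q w" "Q (v - w) = Q v - Q w" "Q (c *\<^sub>R v) = c *\<^sub>R Q v"
    using lin by (simp_all add: linear_0 linear_add linear_diff linear_scale)
  show "Q (v - Q v) = 0" using lin idem by (simp add: linear_diff)
  show "v \<in> range Q \<longleftrightarrow> Q v = v" using idem by (metis rangeE rangeI)
  show "subspace {v. Q v = 0}" using lin by (rule linear_subspace_kernel)
  show "closed {v. Q v = 0}"
    using bl linear_continuous_on[OF bl, of UNIV] by (simp add: closed_Collect_eq)
qed

lemma rank_proj_ker_codim: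
  assumes "rank_proj k K Q"
  shows "has_codim {v. Q v = 0} k"
proof (rule has_codimI[OF rank_proj_subspace_ker[OF assms] rank_proj_range[OF assms]])
  show "range Q \<inter> {v. Q v = 0} = {0}"
    using rank_proj_idem[OF assms] rank_proj_0[OF assms] by force
  show "\<exists>u\<in>range Q. \<exists>f\<in>{v. Q v = 0}. v = u + f" for v
    using rank_proj_ker[OF assms] by (intro bexI[of _ "Q v"] bexI[of _ "v - Q v"]) auto
qed

lemma rank_proj_biorth_proj:
  assumes "biorthogonal k b l" "\<And>v. norm (biorth_proj k b l v) \<le> K * norm v"
  shows "rank_proj k K (biorth_proj k b l)"
  using assms biorth_proj_bounded_linear has_dim_range_biorth_proj biorth_proj_idem
  by (auto simp: rank_proj_def)

lemma biorth_proj_zero_iff: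
  assumes "biorthogonal k b l"
  shows "biorth_proj k b l v = 0 \<longleftrightarrow> (\<forall>i<k. blinfun_apply (l i) v = 0)"
  using biorth_proj_coeff[OF assms, of _ v] by (auto simp: biorth_proj_def blinfun.zero_right)

lemma sum_powers_three: "(\<Sum>i<k. 2 * 3 ^ i) = (3 ^ k - 1 :: real)"
  by (induction k) auto

lemma sum_powers_two: "(\<Sum>i<k. 2 ^ i) = (2 ^ k - 1 :: real)"
  by (induction k) auto

text \<open>The bound on the common kernel of the earlier functionals says that \<open>b i\<close>
  is almost maximally expanded there; its factor 2 allows for a supremum that is not attained. The
  other constants reproduce themselves in the induction: if P projects onto the span of the earlier
  vectors, then, with sums over j < i, norm (v - P v) is at most (1 + sum of 2 * 3^j) norm v = 3^i
  norm v, and norm (A (v - P v)) is at most (1 + sum of 2^j) norm (A v) = 2^i norm (A v).\<close>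

definition adapted_at ::
    "('v::real_normed_vector \<Rightarrow>\<^sub>L 'v) \<Rightarrow> 'v set \<Rightarrow> (nat \<Rightarrow> 'v) \<Rightarrow> (nat \<Rightarrow> 'v \<Rightarrow>\<^sub>L real) \<Rightarrow> nat \<Rightarrow> bool" where
  "adapted_at A W b l i \<longleftrightarrow> b i \<in> W \<and> norm (b i) = 1 \<and>
    (\<forall>v. (\<forall>j<i. blinfun_apply (l j) v = 0) \<longrightarrow> norm (A v) \<le> 2 * norm (A (b i)) * norm v) \<and>
    (\<forall>v. \<bar>blinfun_apply (l i) v\<bar> \<le> 2 * 3 ^ i * norm v) \<and>
    (\<forall>v. \<bar>blinfun_apply (l i) v\<bar> * norm (A (b i)) \<le> 2 ^ i * norm (A v))"

lemma
  assumes "adapted_at A W b l i"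
  shows adapted_in: "b i \<in> W" and adapted_norm: "norm (b i) = 1"
    and adapted_max: "(\<forall>j<i. blinfun_apply (l j) v = 0) \<Longrightarrow> norm (A v) \<le> 2 * norm (A (b i)) * norm v"
    and adapted_coeff: "\<bar>blinfun_apply (l i) v\<bar> \<le> 2 * 3 ^ i * norm v"
    and adapted_image: "\<bar>blinfun_apply (l i) v\<bar> * norm (A (b i)) \<le> 2 ^ i * norm (A v)"
  using assms unfolding adapted_at_def by simp_all

text \<open>Gram--Schmidt in a normed space: the functional dual to \<open>b i\<close> is obtained from one norming
  \<open>A (b i)\<close>, composed with the projection along the earlier vectors. Choosing \<open>b i\<close> to be almost
  maximally expanded by \<open>A\<close> bounds these functionals independently of \<open>A\<close>.\<close>

lemma biorthogonal_exists:
  fixes A :: "'v::real_normed_vector \<Rightarrow>\<^sub>L 'v" and W :: "'v set"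
  assumes select: "\<And>j b l. j < k \<Longrightarrow> biorthogonal j b l \<Longrightarrow> (\<And>i. i < j \<Longrightarrow> b i \<in> W) \<Longrightarrow>
    \<exists>x\<in>W. norm x = 1 \<and> (\<forall>i<j. blinfun_apply (l i) x = 0) \<and> A x \<noteq> 0 \<and>
      (\<forall>v. (\<forall>i<j. blinfun_apply (l i) v = 0) \<longrightarrow> norm (A v) \<le> 2 * norm (A x) * norm v)"
  shows "\<exists>b l. biorthogonal k b l \<and> (\<forall>i<k. adapted_at A W b l i)"
  using select
proof (induction k)
  case 0
  show ?case by (simp add: biorthogonal_def)
next
  case (Suc k)
  have "\<exists>b l. biorthogonal k b l \<and> (\<forall>i<k. adapted_at A W b l i)"
    by (rule Suc.IH) (rule Suc.prems, simp_all)
  then obtain b l where bl: "biorthogonal k b l" and ad: "\<And>i. i < k \<Longrightarrow> adapted_at A W b l i"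
    by blast
  note bW = adapted_in[OF ad] and b1 = adapted_norm[OF ad] and l1 = adapted_coeff[OF ad]
    and l2 = adapted_image[OF ad]
  obtain x where x: "x \<in> W" "norm x = 1" "\<And>i. i < k \<Longrightarrow> blinfun_apply (l i) x = 0" "A x \<noteq> 0"
    "\<And>v. (\<forall>i<k. blinfun_apply (l i) v = 0) \<Longrightarrow> norm (A v) \<le> 2 * norm (A x) * norm v"
    using Suc.prems[OF lessI bl bW] by blast
  obtain h :: "'v \<Rightarrow>\<^sub>L real" where h: "norm h \<le> 1" "h (A x) = norm (A x)"
    by (rule norming_functional)
  have hle: "\<bar>h v\<bar> \<le> norm v" for v
    using norm_blinfun[of h v] mult_right_mono[OF h(1), of "norm v"] by simp
  let ?P = "biorth_proj k b l"
  define f where "f = (\<lambda>v. h (A (v - ?P v)) / norm (A x))"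
  have blf: "bounded_linear f"
    unfolding f_def
    by (intro bounded_linear_divide[THEN bounded_linear_compose]
        bounded_linear_compose[OF blinfun.bounded_linear_right] bounded_linear_sub
        bounded_linear_ident biorth_proj_bounded_linear)
  have ax: "norm (A x) > 0" using x by simp
  have Pker: "\<forall>i<k. blinfun_apply (l i) (v - ?P v) = 0" for v
    using biorth_proj_coeff[OF bl] by (simp add: blinfun.diff_right)
  have nP: "norm (?P v) \<le> (3 ^ k - 1) * norm v" for v
  proof -
    have "norm (?P v) \<le> (\<Sum>i<k. \<bar>blinfun_apply (l i) v\<bar> * norm (b i))"
      unfolding biorth_proj_def by (rule norm_sum[THEN order_trans]) simp
    also have "\<dots> \<le> (\<Sum>i<k. 2 * 3 ^ i * norm v)" using l1 b1 by (intro sum_mono) auto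
    finally show ?thesis by (simp add: sum_distrib_right[symmetric] sum_powers_three)
  qed
  have f1: "\<bar>f v\<bar> \<le> 2 * 3 ^ k * norm v" for v
  proof -
    have "\<bar>h (A (v - ?P v))\<bar> \<le> norm (A (v - ?P v))" by (rule hle)
    also have "\<dots> \<le> 2 * norm (A x) * norm (v - ?P v)" using x(5) Pker by blast
    also have "\<dots> \<le> 2 * norm (A x) * (3 ^ k * norm v)"
      using norm_triangle_ineq4[of v "?P v"] nP[of v] by (intro mult_left_mono) (auto simp: algebra_simps)
    finally show ?thesis using ax by (simp add: f_def field_simps)
  qed
  have f2: "\<bar>f v\<bar> * norm (A x) \<le> 2 ^ k * norm (A v)" for v
  proof -
    have "norm (A (?P v)) \<le> (\<Sum>i<k. \<bar>blinfun_apply (l i) v\<bar> * norm (A (b i)))"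
      unfolding biorth_proj_def blinfun.sum_right blinfun.scaleR_right
      by (rule norm_sum[THEN order_trans]) simp
    also have "\<dots> \<le> (\<Sum>i<k. 2 ^ i * norm (A v))" using l2 by (intro sum_mono) auto
    finally have "norm (A (?P v)) \<le> (2 ^ k - 1) * norm (A v)"
      by (simp add: sum_distrib_right[symmetric] sum_powers_two)
    moreover have "norm (A (v - ?P v)) \<le> norm (A v) + norm (A (?P v))"
      by (simp add: blinfun.diff_right norm_triangle_ineq4)
    ultimately have "norm (A (v - ?P v)) \<le> 2 ^ k * norm (A v)" by (simp add: algebra_simps)
    then show ?thesis using hle[of "A (v - ?P v)"] ax by (simp add: f_def)
  qed
  define b' where "b' = b(k := x)"
  define l' where "l' = l(k := Blinfun f)"
  have old: "b' i = b i" "l' i = l i" if "i < k" for i using that by (auto simp: b'_def l'_def)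
  have new: "b' k = x" "blinfun_apply (l' k) = f"
    by (auto simp: b'_def l'_def bounded_linear_Blinfun_apply[OF blf])
  have "f (b j) = 0" if "j < k" for j using biorth_proj_base[OF bl that] by (simp add: f_def blinfun.zero_right)
  moreover have "f x = 1"
  proof -
    have "?P x = 0" using biorth_proj_zero_iff[OF bl] x(3) by blast
    then show ?thesis using h ax by (simp add: f_def)
  qed
  ultimately have "biorthogonal (Suc k) b' l'"
    unfolding biorthogonal_def
  proof (intro allI impI)
    fix i j assume ij: "i < Suc k" "j < Suc k"
    assume *: "\<And>j. j < k \<Longrightarrow> f (b j) = 0" "f x = 1"
    show "blinfun_apply (l' i) (b' j) = (if i = j then 1 else 0)"
      using ij * bl x(3) old new unfolding biorthogonal_def
      by (cases "i = k"; cases "j = k") (auto simp: less_Suc_eq)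
  qed
  moreover have "\<forall>i<Suc k. adapted_at A W b' l' i"
  proof (intro allI impI)
    fix i assume "i < Suc k"
    then consider "i < k" | "i = k" by linarith
    then show "adapted_at A W b' l' i"
    proof cases
      case 1
      then show ?thesis using ad[OF 1] old by (simp add: adapted_at_def)
    next
      case 2
      then show ?thesis using x f1 f2 ax new old by (simp add: adapted_at_def)
    qed
  qed
  ultimately show ?case by blast
qed

lemma norm_biorth_proj_le:
  assumes "\<And>i. i < k \<Longrightarrow> norm (b i) = 1"
    and "\<And>i v. i < k \<Longrightarrow> \<bar>blinfun_apply (l i) v\<bar> \<le> 2 * 3 ^ i * norm v"
  shows "norm (biorth_proj k b l v) \<le> 3 ^ k * norm v"
proof -
  have "norm (biorth_proj k b l v) \<le> (\<Sum>i<k. \<bar>blinfun_apply (l i) v\<bar> * norm (b i))"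
    unfolding biorth_proj_def by (rule norm_sum[THEN order_trans]) simp
  also have "\<dots> \<le> (\<Sum>i<k. 2 * 3 ^ i * norm v)" using assms by (intro sum_mono) auto
  also have "\<dots> \<le> 3 ^ k * norm v"
    by (simp add: sum_distrib_right[symmetric] sum_powers_three mult_right_mono)
  finally show ?thesis .
qed

text \<open>An Auerbach basis up to constants: the general construction with the identity as A. The
  unit vector required at stage j exists in W because the common kernel of the first j functionals
  has codimension j < k.\<close>

lemma biorthogonal_on:
  fixes W :: "'v::real_normed_vector set"
  assumes W: "has_dim W k"
  obtains b l where "biorthogonal k b l" "\<And>i. i < k \<Longrightarrow> b i \<in> W" "\<And>i. i < k \<Longrightarrow> norm (b i) = 1"
    "\<And>i v. i < k \<Longrightarrow> \<bar>blinfun_apply (l i) v\<bar> \<le> 3 ^ k * norm v"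
    "rank_proj k (3 ^ k) (biorth_proj k b l)" "range (biorth_proj k b l) = W"
proof -
  have select: "\<exists>x\<in>W. norm x = 1 \<and> (\<forall>i<j. blinfun_apply (l i) x = 0) \<and> id_blinfun x \<noteq> 0 \<and>
      (\<forall>v. (\<forall>i<j. blinfun_apply (l i) v = 0) \<longrightarrow> norm (id_blinfun v) \<le> 2 * norm (id_blinfun x) * norm v)"
    if j: "j < k" and bl: "biorthogonal j b l" for j b and l :: "nat \<Rightarrow> 'v \<Rightarrow>\<^sub>L real"
  proof -
    have lin: "linear (biorth_proj j b l)" using biorth_proj_bounded_linear bounded_linear.linear by blast
    have "has_codim {v. biorth_proj j b l v = 0} j"
    proof (rule has_codimI[OF linear_subspace_kernel[OF lin] has_dim_range_biorth_proj[OF bl]])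
      show "range (biorth_proj j b l) \<inter> {v. biorth_proj j b l v = 0} = {0}"
        using biorth_proj_idem[OF bl] linear_0[OF lin] by force
      show "\<exists>u\<in>range (biorth_proj j b l). \<exists>f\<in>{v. biorth_proj j b l v = 0}. v = u + f" for v
        using biorth_proj_idem[OF bl] linear_diff[OF lin]
        by (intro bexI[of _ "biorth_proj j b l v"] bexI[of _ "v - biorth_proj j b l v"]) auto
    qed
    then obtain v where v: "v \<in> W" "biorth_proj j b l v = 0" "v \<noteq> 0"
      by (rule codim_inter_nontrivial[OF linear_subspace_kernel[OF lin] _ W j]) auto
    let ?x = "v /\<^sub>R norm v"
    have "?x \<in> W" using v(1) has_dim_subspace[OF W] by (simp add: subspace_scale)
    moreover have "\<forall>i<j. blinfun_apply (l i) ?x = 0"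
      using v(2) biorth_proj_zero_iff[OF bl] by (simp add: blinfun.scaleR_right)
    moreover have n1: "norm ?x = 1" using v(3) by simp
    moreover have "id_blinfun ?x \<noteq> 0" using v(3) by simp
    moreover have "norm (id_blinfun w) \<le> 2 * norm (id_blinfun ?x) * norm w" for w :: 'v
    proof -
      have "norm (id_blinfun w) \<le> 2 * 1 * norm w" by simp
      then show ?thesis unfolding n1[symmetric] by simp
    qed
    ultimately show ?thesis by blast
  qed
  have "\<exists>b l. biorthogonal k b l \<and> (\<forall>i<k. adapted_at id_blinfun W b l i)"
    by (rule biorthogonal_exists) (rule select)
  then obtain b l where bl: "biorthogonal k b l"
    and ad: "\<And>i. i < k \<Longrightarrow> adapted_at id_blinfun W b l i"
    by blast
  note b = adapted_in[OF ad] and b1 = adapted_norm[OF ad] and l = adapted_coeff[OF ad]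
  have P: "rank_proj k (3 ^ k) (biorth_proj k b l)"
    by (intro rank_proj_biorth_proj[OF bl] norm_biorth_proj_le b1 l)
  have "range (biorth_proj k b l) \<subseteq> W"
    using b has_dim_subspace[OF W]
    by (auto simp: biorth_proj_def intro!: subspace_sum subspace_scale)
  then have "range (biorth_proj k b l) = W" using has_dim_eqI rank_proj_range[OF P] W by blast
  moreover have "\<bar>blinfun_apply (l i) v\<bar> \<le> 3 ^ k * norm v" if "i < k" for i v
  proof -
    have "2 * 3 ^ i \<le> (\<Sum>i<k. 2 * 3 ^ i :: real)" using that by (intro member_le_sum) auto
    then have "2 * 3 ^ i * norm v \<le> 3 ^ k * norm v"
      unfolding sum_powers_three by (intro mult_right_mono) auto
    then show ?thesis using l[OF that, of v] by linarith
  qed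
  ultimately show ?thesis using that[OF bl b b1 _ P] by blast
qed

lemma rank_proj_onto:
  fixes W :: "'v::real_normed_vector set"
  assumes "has_dim W k"
  obtains P where "rank_proj k (3 ^ k) P" "range P = W"
  by (rule biorthogonal_on[OF assms]) (rule that)


section \<open>Gelfand numbers\<close>

lemma bdd_above_restr_norm: "bdd_above ((\<lambda>v. norm (blinfun_apply A v)) ` {v \<in> F. norm v \<le> 1})"
proof (rule bdd_aboveI2)
  fix v assume "v \<in> {v \<in> F. norm v \<le> 1}"
  then show "norm (A v) \<le> norm A" using norm_blinfun[of A v] mult_left_le[of "norm v" "norm A"] by auto
qed

lemma restr_norm_bound:
  assumes "subspace F" "v \<in> F"
  shows "norm (blinfun_apply A v) \<le> restr_norm A F * norm v"
proof (cases "v = 0")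
  case False
  have "v /\<^sub>R norm v \<in> {v \<in> F. norm v \<le> 1}" using assms False by (simp add: subspace_scale)
  then have "norm (A (v /\<^sub>R norm v)) \<le> restr_norm A F"
    unfolding restr_norm_def by (rule cSUP_upper[OF _ bdd_above_restr_norm])
  then show ?thesis using False by (simp add: blinfun.scaleR_right field_simps)
qed simp

lemma restr_norm_nonneg:
  assumes "subspace F"
  shows "0 \<le> restr_norm A F"
proof -
  have "0 \<in> {v \<in> F. norm v \<le> 1}" using assms by (simp add: subspace_0)
  then have "norm (A 0) \<le> restr_norm A F"
    unfolding restr_norm_def by (rule cSUP_upper[OF _ bdd_above_restr_norm])
  then show ?thesis by simp
qed

lemma restr_norm_le:
  assumes "subspace F" "0 \<le> c" "\<And>v. v \<in> F \<Longrightarrow> norm (blinfun_apply A v) \<le> c * norm v"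
  shows "restr_norm A F \<le> c"
  unfolding restr_norm_def
proof (rule cSUP_least)
  show "{v \<in> F. norm v \<le> 1} \<noteq> {}" using subspace_0[OF assms(1)] by force
  fix v assume "v \<in> {v \<in> F. norm v \<le> 1}"
  then have "norm (A v) \<le> c * norm v" "c * norm v \<le> c" using assms by (auto intro: mult_left_le)
  then show "norm (A v) \<le> c" by linarith
qed

definition closed_codim :: "nat \<Rightarrow> 'v::real_normed_vector set \<Rightarrow> bool" where
  "closed_codim i F \<longleftrightarrow> subspace F \<and> closed F \<and> has_codim F i"

lemma closed_codim_ker: "rank_proj k K Q \<Longrightarrow> closed_codim k {v. Q v = 0}"
  by (simp add: closed_codim_def rank_proj_subspace_ker rank_proj_closed_ker rank_proj_ker_codim)

lemma gelfand_number_le: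
  assumes "closed_codim (q - 1) F"
  shows "gelfand_number q A \<le> restr_norm A F"
  unfolding gelfand_number_def using assms
  by (intro cINF_lower bdd_belowI2[of _ 0]) (auto simp: closed_codim_def restr_norm_nonneg)

lemma gelfand_number_ge:
  fixes A :: "'v::real_normed_vector \<Rightarrow>\<^sub>L 'v" and G :: "'v set"
  assumes "closed_codim (q - 1) G" "\<And>F. closed_codim (q - 1) F \<Longrightarrow> c \<le> restr_norm A F"
  shows "c \<le> gelfand_number q A"
  unfolding gelfand_number_def
proof (rule cINF_greatest)
  show "{F :: 'v set. subspace F \<and> closed F \<and> has_codim F (q - 1)} \<noteq> {}"
    using assms(1) by (auto simp: closed_codim_def)
  fix F :: "'v set" assume "F \<in> {F. subspace F \<and> closed F \<and> has_codim F (q - 1)}"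
  then show "c \<le> restr_norm A F" using assms(2) by (simp add: closed_codim_def)
qed

lemma gelfand_number_approx:
  fixes A :: "'v::real_normed_vector \<Rightarrow>\<^sub>L 'v" and G :: "'v set"
  assumes "closed_codim (q - 1) G" "gelfand_number q A < c"
  obtains F where "closed_codim (q - 1) F" "restr_norm A F < c"
  using gelfand_number_ge[OF assms(1), of c A] assms(2) by (meson not_le)

lemma closed_codim_exists:
  fixes E :: "'v::real_normed_vector set"
  assumes "has_dim E k"
  obtains F :: "'v set" where "closed_codim k F"
  by (rule rank_proj_onto[OF assms]) (rule that, rule closed_codim_ker)

text \<open>The kernel of a functional norming a nonzero vector of G cuts G down by one dimension.
  As long as j < k, the space E of dimension k meets G and supplies such a vector.\<close>

lemma closed_codim_refine:
  fixes E F :: "'v::real_normed_vector set"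
  assumes "closed_codim i F" "has_dim E k" "i \<le> j" "j \<le> k"
  obtains G where "closed_codim j G" "G \<subseteq> F"
proof -
  have "\<exists>G. closed_codim j G \<and> G \<subseteq> F"
    using assms(3,4)
  proof (induction j rule: dec_induct)
    case base
    then show ?case using assms(1) by blast
  next
    case (step j)
    then obtain G where G: "closed_codim j G" "G \<subseteq> F" by auto
    have sG: "subspace G" and cG: "has_codim G j" using G(1) by (auto simp: closed_codim_def)
    obtain v where v: "v \<in> G" "v \<noteq> 0"
      by (rule codim_inter_nontrivial[OF sG cG assms(2)]) (use step in auto)
    obtain h :: "'v \<Rightarrow>\<^sub>L real" where h: "h v = norm v" by (rule norming_functional)
    have lin: "linear (blinfun_apply h)" using blinfun.bounded_linear_right bounded_linear.linear by blast
    have "has_codim (G \<inter> {w. h w = 0}) (Suc j)"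
      using has_codim_Int_kernel[OF _ _ lin v(1)] G h v by (auto simp: closed_codim_def)
    moreover have "subspace (G \<inter> {w. h w = 0})"
      using G linear_subspace_kernel[OF lin] by (simp add: closed_codim_def subspace_inter)
    moreover have "closed {w. h w = 0}" by (intro closed_Collect_eq continuous_intros)
    ultimately have "closed_codim (Suc j) (G \<inter> {w. h w = 0})"
      using G by (auto simp: closed_codim_def)
    then show ?case using G by blast
  qed
  then show ?thesis using that by blast
qed

text \<open>The definition admits only codimension exactly k - 1, so F is first shrunk to that
  codimension; the restricted norm does not grow.\<close>

lemma gelfand_number_le':
  fixes E :: "'v::real_normed_vector set" and A :: "'v \<Rightarrow>\<^sub>L 'v"
  assumes "closed_codim i F" "has_dim E k" "i < k"
  shows "gelfand_number k A \<le> restr_norm A F"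
proof -
  obtain G where G: "closed_codim (k - 1) G" "G \<subseteq> F"
    by (rule closed_codim_refine[OF assms(1,2), of "k - 1"]) (use assms(3) in auto)
  have sF: "subspace F" and sG: "subspace G" using G(1) assms(1) by (auto simp: closed_codim_def)
  have "gelfand_number k A \<le> restr_norm A G" by (rule gelfand_number_le[OF G(1)])
  also have "\<dots> \<le> restr_norm A F"
    using restr_norm_bound[OF sF] G(2) by (intro restr_norm_le[OF sG restr_norm_nonneg[OF sF]]) auto
  finally show ?thesis .
qed

lemma has_dim_smaller:
  assumes "has_dim W k" "j \<le> k"
  obtains W' where "has_dim W' j" "W' \<subseteq> W"
proof -
  obtain S where S: "finite S" "independent S" "card S = k" "span S = W" using assms by (auto simp: has_dim_def)
  obtain T where T: "T \<subseteq> S" "card T = j" using obtain_subset_with_card_n assms(2) S(3) by metis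
  have "has_dim (span T) j"
    unfolding has_dim_def
    using finite_subset[OF T(1) S(1)] independent_mono[OF S(2) T(1)] T(2) by (intro exI[of _ T] conjI refl)
  moreover have "span T \<subseteq> W" using span_mono[OF T(1)] S(4) by simp
  ultimately show ?thesis using that by blast
qed

text \<open>E meets every subspace of codimension k - 1 in a nonzero vector. The smaller space E'
  only provides a closed subspace of that codimension, so that the infimum is not over the empty
  set.\<close>

lemma gelfand_number_ge_bounded_below:
  fixes E :: "'v::real_normed_vector set"
  assumes "has_dim E k" "k \<ge> 1" "0 \<le> c" "\<And>v. v \<in> E \<Longrightarrow> c * norm v \<le> norm (blinfun_apply A v)"
  shows "c \<le> gelfand_number k A"
proof -
  obtain E' where "has_dim E' (k - 1)" "E' \<subseteq> E" by (rule has_dim_smaller[OF assms(1), of "k - 1"]) simp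
  from this(1) obtain G :: "'v set" where "closed_codim (k - 1) G" by (rule closed_codim_exists)
  then show ?thesis
  proof (rule gelfand_number_ge)
    fix F :: "'v set" assume F: "closed_codim (k - 1) F"
    then have sF: "subspace F" and cF: "has_codim F (k - 1)" by (auto simp: closed_codim_def)
    obtain v where v: "v \<in> E" "v \<in> F" "v \<noteq> 0"
      by (rule codim_inter_nontrivial[OF sF cF assms(1)]) (use assms(2) in auto)
    have "c * norm v \<le> restr_norm A F * norm v"
      using assms(4)[OF v(1)] restr_norm_bound[OF sF v(2), of A] by linarith
    then show "c \<le> restr_norm A F" using v(3) by simp
  qed
qed

lemma gelfand_number_pos:
  fixes E :: "'v::real_normed_vector set" and A :: "'v \<Rightarrow>\<^sub>L 'v"
  assumes "has_dim E k" "k \<ge> 1" "inj (blinfun_apply A)"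
  shows "0 < gelfand_number k A"
proof -
  obtain c where c: "c > 0" "\<And>v. v \<in> E \<Longrightarrow> c * norm v \<le> norm (A v)"
    by (rule injective_bounded_below[OF assms(1,3)]) (rule that)
  then have "c \<le> gelfand_number k A" using gelfand_number_ge_bounded_below[OF assms(1,2)] by simp
  then show ?thesis using c by linarith
qed

lemma gelfand_number_lipschitz:
  fixes E :: "'v::real_normed_vector set" and A A' :: "'v \<Rightarrow>\<^sub>L 'v"
  assumes "has_dim E (q - 1)"
  shows "gelfand_number q A \<le> gelfand_number q A' + norm (A - A')"
proof -
  obtain G :: "'v set" where "closed_codim (q - 1) G" by (rule closed_codim_exists[OF assms])
  then have "gelfand_number q A - norm (A - A') \<le> gelfand_number q A'"
  proof (rule gelfand_number_ge)
    fix F :: "'v set" assume F: "closed_codim (q - 1) F"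
    then have sF: "subspace F" by (auto simp: closed_codim_def)
    have "restr_norm A F \<le> restr_norm A' F + norm (A - A')"
    proof (rule restr_norm_le[OF sF])
      fix v assume v: "v \<in> F"
      have "norm (A v) \<le> norm (A' v) + norm ((A - A') v)"
        by (simp add: blinfun.diff_left norm_triangle_sub)
      then show "norm (A v) \<le> (restr_norm A' F + norm (A - A')) * norm v"
        using restr_norm_bound[OF sF v, of A'] norm_blinfun[of "A - A'" v] by (simp add: algebra_simps)
    qed (simp add: restr_norm_nonneg[OF sF])
    then show "gelfand_number q A - norm (A - A') \<le> restr_norm A' F"
      using gelfand_number_le[OF F, of A] by linarith
  qed
  then show ?thesis by simp
qed

lemma gelfand_number_comp_left:
  fixes E :: "'v::real_normed_vector set" and A A' :: "'v \<Rightarrow>\<^sub>L 'v"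
  assumes "has_dim E (q - 1)"
  shows "gelfand_number q (A o\<^sub>L A') \<le> norm A * gelfand_number q A'"
proof (cases "norm A = 0")
  case True
  obtain G :: "'v set" where G: "closed_codim (q - 1) G" by (rule closed_codim_exists[OF assms])
  have "restr_norm (A o\<^sub>L A') G \<le> 0"
    using G True by (intro restr_norm_le) (auto simp: closed_codim_def)
  then show ?thesis using gelfand_number_le[OF G, of "A o\<^sub>L A'"] True by simp
next
  case False
  then have nA: "norm A > 0" by simp
  obtain G :: "'v set" where "closed_codim (q - 1) G" by (rule closed_codim_exists[OF assms])
  then have "gelfand_number q (A o\<^sub>L A') / norm A \<le> gelfand_number q A'"
  proof (rule gelfand_number_ge)
    fix F :: "'v set" assume F: "closed_codim (q - 1) F"
    then have sF: "subspace F" by (auto simp: closed_codim_def)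
    have "restr_norm (A o\<^sub>L A') F \<le> norm A * restr_norm A' F"
    proof (rule restr_norm_le[OF sF])
      fix v assume v: "v \<in> F"
      have "norm ((A o\<^sub>L A') v) \<le> norm A * norm (A' v)" using norm_blinfun[of A "A' v"] by simp
      also have "\<dots> \<le> norm A * (restr_norm A' F * norm v)"
        using restr_norm_bound[OF sF v] by (intro mult_left_mono) auto
      finally show "norm ((A o\<^sub>L A') v) \<le> norm A * restr_norm A' F * norm v" by (simp add: algebra_simps)
    qed (simp add: restr_norm_nonneg[OF sF])
    then show "gelfand_number q (A o\<^sub>L A') / norm A \<le> restr_norm A' F"
      using gelfand_number_le[OF F, of "A o\<^sub>L A'"] nA by (simp add: field_simps)
  qed
  then show ?thesis using nA by (simp add: field_simps)
qed

text \<open>The preimage is the kernel of A followed by the projection along F onto a complement.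
  The codimension may drop, hence the i.\<close>

lemma closed_codim_preimage:
  fixes A :: "'v::real_normed_vector \<Rightarrow>\<^sub>L 'v"
  assumes "closed_codim n F"
  obtains i where "i \<le> n" "closed_codim i {v. A v \<in> F}"
proof -
  have F: "subspace F" "closed F" "has_codim F n" using assms by (auto simp: closed_codim_def)
  obtain U where U: "has_dim U n" "U \<inter> F = {0}" "\<And>v. \<exists>u\<in>U. \<exists>f\<in>F. v = u + f"
    using has_codim_iff[OF F(1), THEN iffD1, OF F(3)] by blast
  obtain p where p: "linear p" "\<And>v. p v \<in> U" "\<And>v. p v = 0 \<longleftrightarrow> v \<in> F"
    by (rule direct_sum_projection[OF has_dim_subspace[OF U(1)] F(1) U(2,3)]) (rule that)
  have lA: "linear (blinfun_apply A)" using blinfun.bounded_linear_right bounded_linear.linear by blast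
  obtain S where S: "finite S" "card S = n" "span S = U" using U(1) by (auto simp: has_dim_def)
  have "range (p \<circ> A) \<subseteq> span S" using S p(2) by auto
  then obtain i where i: "i \<le> card S" "has_codim {v. (p \<circ> A) v = 0} i"
    by (rule has_codim_kernel[OF linear_compose[OF lA p(1)] S(1)])
  have eq: "{v. (p \<circ> A) v = 0} = {v. A v \<in> F}" using p(3) by simp
  have "closed (blinfun_apply A -` F)"
    by (rule continuous_closed_vimage[OF F(2)]) (intro continuous_intros)
  then have "closed {v. A v \<in> F}" by (simp add: vimage_def)
  moreover have "subspace {v. A v \<in> F}" using linear_subspace_vimage[OF lA F(1)] by (simp add: vimage_def)
  ultimately show ?thesis using that[of i] i S(2) eq by (simp add: closed_codim_def)
qed

lemma gelfand_number_comp_right: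
  fixes E :: "'v::real_normed_vector set" and A A' :: "'v \<Rightarrow>\<^sub>L 'v"
  assumes E: "has_dim E k" and k: "k \<ge> 1" and m: "norm A' \<le> m" "0 < m"
  shows "gelfand_number k (A o\<^sub>L A') \<le> m * gelfand_number k A"
proof -
  obtain E' where "has_dim E' (k - 1)" "E' \<subseteq> E" by (rule has_dim_smaller[OF E, of "k - 1"]) simp
  from this(1) obtain G :: "'v set" where "closed_codim (k - 1) G" by (rule closed_codim_exists)
  then have "gelfand_number k (A o\<^sub>L A') / m \<le> gelfand_number k A"
  proof (rule gelfand_number_ge)
    fix F :: "'v set" assume F: "closed_codim (k - 1) F"
    then have sF: "subspace F" by (auto simp: closed_codim_def)
    obtain i where i: "i \<le> k - 1" "closed_codim i {v. A' v \<in> F}"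
      by (rule closed_codim_preimage[OF F])
    then have sP: "subspace {v. A' v \<in> F}" by (auto simp: closed_codim_def)
    have "gelfand_number k (A o\<^sub>L A') \<le> restr_norm (A o\<^sub>L A') {v. A' v \<in> F}"
      using gelfand_number_le'[OF i(2) E] i(1) k by simp
    also have "\<dots> \<le> m * restr_norm A F"
    proof (rule restr_norm_le[OF sP])
      fix v assume v: "v \<in> {v. A' v \<in> F}"
      have "norm ((A o\<^sub>L A') v) \<le> restr_norm A F * norm (A' v)"
        using restr_norm_bound[OF sF, of "A' v" A] v by simp
      also have "\<dots> \<le> restr_norm A F * (m * norm v)"
        using norm_blinfun[of A' v] m(1) restr_norm_nonneg[OF sF]
        mult_right_mono[OF m(1), of "norm v"]
        by (intro mult_left_mono) auto
      finally show "norm ((A o\<^sub>L A') v) \<le> m * restr_norm A F * norm v" by (simp add: algebra_simps)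
    qed (use m restr_norm_nonneg[OF sF] in auto)
    finally show "gelfand_number k (A o\<^sub>L A') / m \<le> restr_norm A F" using m by (simp add: field_simps)
  qed
  then show ?thesis using m by (simp add: field_simps)
qed

text \<open>A substitute for the spectral projection onto the \<open>k\<close> largest singular values.\<close>

lemma gelfand_projection:
  fixes E :: "'v::real_normed_vector set" and A :: "'v \<Rightarrow>\<^sub>L 'v"
  assumes E: "has_dim E k" and pos: "0 < gelfand_number k A"
  obtains P where "rank_proj k (3 ^ k) P"
    "\<And>v. gelfand_number k A * norm (P v) \<le> 2 ^ (k + 1) * norm (A v)"
proof -
  let ?c = "gelfand_number k A"
  have select: "\<exists>x\<in>UNIV. norm x = 1 \<and> (\<forall>i<j. blinfun_apply (l i) x = 0) \<and> A x \<noteq> 0 \<and>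
      (\<forall>v. (\<forall>i<j. blinfun_apply (l i) v = 0) \<longrightarrow> norm (A v) \<le> 2 * norm (A x) * norm v)"
    if j: "j < k" and bl: "biorthogonal j b l" for j b and l :: "nat \<Rightarrow> 'v \<Rightarrow>\<^sub>L real"
  proof -
    let ?F = "{v. biorth_proj j b l v = 0}"
    obtain K where "\<And>v. norm (biorth_proj j b l v) \<le> K * norm v"
      using bounded_linear.bounded[OF biorth_proj_bounded_linear] by (metis mult.commute)
    then have cc: "closed_codim j ?F" using closed_codim_ker[OF rank_proj_biorth_proj[OF bl]] by blast
    then have sF: "subspace ?F" by (auto simp: closed_codim_def)
    let ?m = "restr_norm A ?F"
    \<comment> \<open>The common kernel at stage j has codimension j < k, so \<open>?m\<close> is at
      least the positive k-th Gelfand number. Some w then exceeds half of the supremum and,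
      normalised, is the vector required.\<close>
    have m: "0 < ?m" using gelfand_number_le'[OF cc E j, of A] pos by linarith
    then have "\<not> ?m \<le> ?m / 2" by simp
    then obtain w where w: "w \<in> ?F" "?m / 2 * norm w < norm (A w)"
      using restr_norm_le[OF sF, of "?m / 2" A] m by (metis half_gt_zero less_le not_le)
    then have w0: "w \<noteq> 0" by auto
    let ?x = "w /\<^sub>R norm w"
    have "norm (A ?x) > ?m / 2" using w w0 by (simp add: blinfun.scaleR_right field_simps)
    moreover have "norm (A v) \<le> 2 * norm (A ?x) * norm v" if "\<forall>i<j. blinfun_apply (l i) v = 0" for v
    proof -
      have "norm (A v) \<le> ?m * norm v"
        using that biorth_proj_zero_iff[OF bl] by (intro restr_norm_bound[OF sF]) auto
      also have "\<dots> \<le> 2 * norm (A ?x) * norm v"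
        using \<open>norm (A ?x) > ?m / 2\<close> by (intro mult_right_mono) (linarith, simp)
      finally show ?thesis .
    qed
    moreover have "A ?x \<noteq> 0" using calculation(1) m by auto
    moreover have "\<forall>i<j. blinfun_apply (l i) ?x = 0"
      using w(1) biorth_proj_zero_iff[OF bl] by (simp add: blinfun.scaleR_right)
    moreover have "norm ?x = 1" using w0 by simp
    ultimately show ?thesis by blast
  qed
  have "\<exists>b l. biorthogonal k b l \<and> (\<forall>i<k. adapted_at A UNIV b l i)"
    by (rule biorthogonal_exists) (rule select)
  then obtain b l where bl: "biorthogonal k b l"
    and ad: "\<And>i. i < k \<Longrightarrow> adapted_at A UNIV b l i"
    by blast
  note b = adapted_norm[OF ad] and mx = adapted_max[OF ad] and l1 = adapted_coeff[OF ad]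
    and l2 = adapted_image[OF ad]
  have P: "rank_proj k (3 ^ k) (biorth_proj k b l)"
    by (intro rank_proj_biorth_proj[OF bl] norm_biorth_proj_le b l1)
  \<comment> \<open>The common kernel of the first i functionals has codimension i < k, and A
    stretches it by at most 2 norm (A (b i)); so this number dominates the k-th Gelfand
    number.\<close>
  have Ab: "?c \<le> 2 * norm (A (b i))" if i: "i < k" for i
  proof -
    have bi: "biorthogonal i b l" using bl i by (auto simp: biorthogonal_def)
    let ?F = "{v. biorth_proj i b l v = 0}"
    obtain K where "\<And>v. norm (biorth_proj i b l v) \<le> K * norm v"
      using bounded_linear.bounded[OF biorth_proj_bounded_linear] by (metis mult.commute)
    then have cc: "closed_codim i ?F" using closed_codim_ker[OF rank_proj_biorth_proj[OF bi]] by blast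
    then have sF: "subspace ?F" by (auto simp: closed_codim_def)
    have "restr_norm A ?F \<le> 2 * norm (A (b i))"
      using mx[OF i] biorth_proj_zero_iff[OF bi] by (intro restr_norm_le[OF sF]) auto
    then show ?thesis using gelfand_number_le'[OF cc E i, of A] by linarith
  qed
  have "?c * norm (biorth_proj k b l v) \<le> 2 ^ (k + 1) * norm (A v)" for v
  proof -
    have "norm (biorth_proj k b l v) \<le> (\<Sum>i<k. \<bar>blinfun_apply (l i) v\<bar>)"
      unfolding biorth_proj_def using b by (intro norm_sum[THEN order_trans] sum_mono) auto
    then have "?c * norm (biorth_proj k b l v) \<le> (\<Sum>i<k. ?c * \<bar>blinfun_apply (l i) v\<bar>)"
      unfolding sum_distrib_left[symmetric] using pos by simp
    also have "\<dots> \<le> (\<Sum>i<k. 2 * 2 ^ i * norm (A v))"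
    proof (rule sum_mono)
      fix i assume "i \<in> {..<k}"
      then have i: "i < k" by simp
      have "?c * \<bar>blinfun_apply (l i) v\<bar> \<le> 2 * norm (A (b i)) * \<bar>blinfun_apply (l i) v\<bar>"
        using Ab[OF i] by (intro mult_right_mono) auto
      then show "?c * \<bar>blinfun_apply (l i) v\<bar> \<le> 2 * 2 ^ i * norm (A v)"
        using l2[OF i, of v] by (simp add: algebra_simps)
    qed
    also have "\<dots> = 2 * (2 ^ k - 1) * norm (A v)"
      by (simp add: sum_distrib_right[symmetric] sum_distrib_left[symmetric] sum_powers_two)
    also have "\<dots> \<le> 2 ^ (k + 1) * norm (A v)" by (intro mult_right_mono) auto
    finally show ?thesis .
  qed
  then show ?thesis using that P by blast
qed

subsection \<open>Nearness and limits of subspaces\<close>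

text \<open>A homogeneous one-sided gap. It avoids unit vectors and composes well; for d < 1 it
  controls one half of the Hausdorff distance up to a factor 2.\<close>

definition near :: "real \<Rightarrow> 'v::real_normed_vector set \<Rightarrow> 'v set \<Rightarrow> bool" where
  "near d W W' \<longleftrightarrow> (\<forall>v\<in>W. \<exists>w\<in>W'. norm (v - w) \<le> d * norm v)"

lemma nearE:
  assumes "near d W W'" "v \<in> W"
  obtains w where "w \<in> W'" "norm (v - w) \<le> d * norm v"
  using assms unfolding near_def by blast

lemma near_mono: "near d W W' \<Longrightarrow> d \<le> d' \<Longrightarrow> near d' W W'"
  unfolding near_def by (meson mult_right_mono norm_ge_zero order_trans)

lemma near_refl: "0 \<le> d \<Longrightarrow> near d W W"
  unfolding near_def by (intro ballI) (auto intro!: bexI)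

text \<open>The constant is (1 + a) (1 + b) - 1, so chains of nearness turn into products.\<close>

lemma near_trans:
  assumes "near a U V" "near b V W" "0 \<le> b"
  shows "near (a + b + a * b) U W"
  unfolding near_def
proof
  fix u assume "u \<in> U"
  then obtain v where v: "v \<in> V" "norm (u - v) \<le> a * norm u" by (rule nearE[OF assms(1)])
  obtain w where w: "w \<in> W" "norm (v - w) \<le> b * norm v" by (rule nearE[OF assms(2) v(1)])
  have "norm v \<le> norm u + norm (u - v)" by (metis norm_minus_commute norm_triangle_sub)
  then have "norm v \<le> (1 + a) * norm u" using v(2) by (simp add: algebra_simps)
  then have "b * norm v \<le> b * ((1 + a) * norm u)" using assms(3) by (rule mult_left_mono)
  moreover have "norm (u - w) \<le> norm (u - v) + norm (v - w)"
    using norm_triangle_ineq[of "u - v" "v - w"] by simp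
  ultimately have "norm (u - w) \<le> (a + b + a * b) * norm u" using v w by (simp add: algebra_simps)
  then show "\<exists>w\<in>W. norm (u - w) \<le> (a + b + a * b) * norm u" using w by blast
qed

lemma near_trans3:
  assumes "near a U V" "near a V W" "0 \<le> a" "a \<le> 1"
  shows "near (3 * a) U W"
  using near_mono[OF near_trans[OF assms(1-3)], of "3 * a"] mult_left_le[OF assms(4,3)] by simp

lemma norm_normalize_diff:
  fixes v w :: "'v::real_normed_vector"
  assumes "norm v = 1" "w \<noteq> 0"
  shows "norm (v - w /\<^sub>R norm w) \<le> 2 * norm (v - w)"
proof -
  have "w - w /\<^sub>R norm w = (norm w - 1) *\<^sub>R (w /\<^sub>R norm w)" using assms(2) by (simp add: algebra_simps)
  then have "norm (w - w /\<^sub>R norm w) = \<bar>norm w - 1\<bar> * norm (w /\<^sub>R norm w)" by (metis norm_scaleR)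
  then have "norm (w - w /\<^sub>R norm w) = \<bar>norm w - 1\<bar>" using assms(2) by simp
  moreover have "\<bar>norm w - 1\<bar> \<le> norm (v - w)"
    using norm_triangle_ineq3[of w v] assms(1) by (simp add: norm_minus_commute)
  moreover have "norm (v - w /\<^sub>R norm w) \<le> norm (v - w) + norm (w - w /\<^sub>R norm w)"
    using norm_triangle_ineq[of "v - w" "w - w /\<^sub>R norm w"] by simp
  ultimately show ?thesis by linarith
qed

lemma excess_le_near:
  assumes "near d W W'" "subspace W'" "d < 1" "unit_sphere W \<noteq> {}"
  shows "unit_sphere W' \<noteq> {} \<and> (SUP e\<in>unit_sphere W. infdist e (unit_sphere W')) \<le> 2 * d"
proof -
  have *: "\<exists>f\<in>unit_sphere W'. dist e f \<le> 2 * d" if e: "e \<in> unit_sphere W" for e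
  proof -
    have e1: "norm e = 1" "e \<in> W" using e by (auto simp: unit_sphere_def)
    obtain w where w: "w \<in> W'" "norm (e - w) \<le> d" by (rule nearE[OF assms(1) e1(2)]) (use e1 in simp)
    have "w \<noteq> 0" using w assms(3) e1 by auto
    then have "w /\<^sub>R norm w \<in> unit_sphere W'"
      using w(1) assms(2) by (simp add: unit_sphere_def subspace_scale)
    moreover have "dist e (w /\<^sub>R norm w) \<le> 2 * d"
      using norm_normalize_diff[OF e1(1) \<open>w \<noteq> 0\<close>] w(2) by (simp add: dist_norm)
    ultimately show ?thesis by blast
  qed
  then have "unit_sphere W' \<noteq> {}" using assms(4) by blast
  moreover have "(SUP e\<in>unit_sphere W. infdist e (unit_sphere W')) \<le> 2 * d"
    using * infdist_le2 by (intro cSUP_least[OF assms(4)]) blast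
  ultimately show ?thesis by blast
qed

lemma grassmann_dist_le_near:
  assumes "near d W W'" "near d W' W" "subspace W" "subspace W'" "0 \<le> d" "d < 1"
  shows "grassmann_dist W W' \<le> 2 * d"
proof (cases "unit_sphere W = {} \<and> unit_sphere W' = {}")
  case False
  then have "unit_sphere W \<noteq> {}" "unit_sphere W' \<noteq> {}"
    using excess_le_near[OF assms(1,4,6)] excess_le_near[OF assms(2,3,6)] by blast+
  then show ?thesis using excess_le_near[OF assms(1,4,6)] excess_le_near[OF assms(2,3,6)]
    by (simp add: grassmann_dist_def)
qed (use assms(5) in \<open>simp add: grassmann_dist_def\<close>)

lemma near_if_grassmann_dist:
  assumes "grassmann_dist W W' < d" "d \<le> 1" "subspace W" "subspace W'"
  shows "near d W W'"
  unfolding near_def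
proof
  fix v assume v: "v \<in> W"
  show "\<exists>w\<in>W'. norm (v - w) \<le> d * norm v"
  proof (cases "v = 0")
    case True
    then show ?thesis using subspace_0[OF assms(4)] by (intro bexI[of _ 0]) auto
  next
    case False
    let ?e = "v /\<^sub>R norm v"
    have e: "?e \<in> unit_sphere W" using v assms(3) False by (simp add: unit_sphere_def subspace_scale)
    then have ne: "unit_sphere W \<noteq> {}" by blast
    \<comment> \<open>If W' were trivial, the distance would be 2.\<close>
    then have ne': "unit_sphere W' \<noteq> {}" using assms(1,2) by (auto simp: grassmann_dist_def)
    have "infdist ?e (unit_sphere W') \<le> (SUP e\<in>unit_sphere W. infdist e (unit_sphere W'))"
      by (rule cSUP_upper[OF e bdd_above_infdist_unit_sphere[OF ne']])
    then have "infdist ?e (unit_sphere W') < d" using assms(1) ne ne' by (simp add: grassmann_dist_def)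
    then obtain f where f: "f \<in> unit_sphere W'" "dist ?e f < d"
      using infdist_notempty[OF ne'] cINF_less_iff[OF ne', of "dist ?e" d] by (metis bdd_below_image_dist)
    have "v - norm v *\<^sub>R f = norm v *\<^sub>R (?e - f)" using False by (simp add: algebra_simps)
    then have "norm (v - norm v *\<^sub>R f) = norm v * norm (?e - f)" by simp
    also have "\<dots> \<le> norm v * d" using f(2) by (intro mult_left_mono) (auto simp: dist_norm)
    finally have "norm (v - norm v *\<^sub>R f) \<le> d * norm v" by (simp add: mult.commute)
    moreover have "norm v *\<^sub>R f \<in> W'" using f(1) assms(4) by (simp add: unit_sphere_def subspace_scale)
    ultimately show ?thesis by blast
  qed
qed

text \<open>Mutual nearness is needed for convergence of subspaces; when the dimensions or codimensions
  agree, it follows from nearness in one direction.\<close>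

lemma near_sym_has_dim:
  fixes W W' :: "'v::real_normed_vector set"
  assumes "near s W' W" "has_dim W k" "has_dim W' k" "0 \<le> s" "(1 + 3 ^ k) * s \<le> 1 / 2"
  shows "near (2 * (1 + 3 ^ k) * s) W W'"
    and "\<And>P. rank_proj k (3 ^ k) P \<Longrightarrow> range P = W \<Longrightarrow> P ` W' = W \<and>
      (\<forall>w\<in>W'. norm (w - P w) \<le> (1 + 3 ^ k) * s * norm w \<and> norm w \<le> 2 * norm (P w))"
proof -
  have *: "P ` W' = W \<and> (\<forall>w\<in>W'. norm (w - P w) \<le> (1 + 3 ^ k) * s * norm w \<and> norm w \<le> 2 * norm (P w))"
    if P: "rank_proj k (3 ^ k) P" "range P = W" for P
  proof -
    \<comment> \<open>As P fixes W, the vector w - P w equals (1 - P) (w - u), and 1 - P has norm at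
      most 1 + 3^k.\<close>
    have close: "norm (w - P w) \<le> (1 + 3 ^ k) * s * norm w" if w: "w \<in> W'" for w
    proof -
      obtain u where u: "u \<in> W" "norm (w - u) \<le> s * norm w" by (rule nearE[OF assms(1) w])
      have Pu: "P u = u" using u P rank_proj_range_iff by blast
      have "w - P w = (w - u) - P (w - u)" using Pu rank_proj_diff[OF P(1)] by simp
      then have "norm (w - P w) \<le> norm (w - u) + norm (P (w - u))" by (metis norm_triangle_ineq4)
      also have "\<dots> \<le> (1 + 3 ^ k) * norm (w - u)"
        using rank_proj_norm[OF P(1), of "w - u"] by (simp add: algebra_simps)
      also have "\<dots> \<le> (1 + 3 ^ k) * (s * norm w)" using u(2) by (intro mult_left_mono) auto
      finally show ?thesis by (simp add: mult.assoc)
    qed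
    moreover have half: "norm w \<le> 2 * norm (P w)" if w: "w \<in> W'" for w
    proof -
      have "norm (w - P w) \<le> 1 / 2 * norm w"
        using close[OF w] mult_right_mono[OF assms(5), of "norm w"] by simp
      then show ?thesis using norm_triangle_sub[of w "P w"] by simp
    qed
    moreover have "P ` W' = W"
    proof (rule has_dim_image_eq[OF assms(3,2) rank_proj_linear[OF P(1)]])
      show "P ` W' \<subseteq> W" using P(2) by blast
      show "v = 0" if "v \<in> W'" "P v = 0" for v using half[OF that(1)] that(2) by simp
    qed
    ultimately show ?thesis by blast
  qed
  then show "\<And>P. rank_proj k (3 ^ k) P \<Longrightarrow> range P = W \<Longrightarrow> P ` W' = W \<and>
      (\<forall>w\<in>W'. norm (w - P w) \<le> (1 + 3 ^ k) * s * norm w \<and> norm w \<le> 2 * norm (P w))" .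
  obtain P where P: "rank_proj k (3 ^ k) P" "range P = W" by (rule rank_proj_onto[OF assms(2)])
  show "near (2 * (1 + 3 ^ k) * s) W W'"
    unfolding near_def
  proof
    fix v assume "v \<in> W"
    then obtain w where w: "w \<in> W'" "v = P w" using *[OF P] by blast
    have "norm (v - w) \<le> (1 + 3 ^ k) * s * norm w" using *[OF P] w by (simp add: norm_minus_commute)
    also have "\<dots> \<le> (1 + 3 ^ k) * s * (2 * norm v)"
      using *[OF P] w assms(4) by (intro mult_left_mono) auto
    also have "\<dots> = 2 * (1 + 3 ^ k) * s * norm v" by simp
    finally show "\<exists>w\<in>W'. norm (v - w) \<le> 2 * (1 + 3 ^ k) * s * norm v" using w(1) by blast
  qed
qed

text \<open>One direction subtracts Q' v. For the other, Q is injective on the range of Q', since u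
  = Q' u with Q u = 0 satisfies norm u <= s norm u; equal ranks make it onto. Then v in the kernel
  of Q' is corrected by the u in the range of Q' with Q u = Q v.\<close>

lemma near_sym_kernel:
  fixes Q Q' :: "'v::real_normed_vector \<Rightarrow> 'v"
  assumes Q: "rank_proj k K Q" and Q': "rank_proj k K' Q'"
    and small: "\<And>v. Q v = 0 \<Longrightarrow> norm (Q' v) \<le> s * norm v" and s: "0 \<le> s" "s \<le> 1 / 2"
  shows "near s {v. Q v = 0} {v. Q' v = 0}" "near (2 * s) {v. Q' v = 0} {v. Q v = 0}"
proof -
  show "near s {v. Q v = 0} {v. Q' v = 0}"
    unfolding near_def
  proof
    fix v assume "v \<in> {v. Q v = 0}"
    then have "norm (v - (v - Q' v)) \<le> s * norm v" using small by simp
    then show "\<exists>w\<in>{v. Q' v = 0}. norm (v - w) \<le> s * norm v"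
      using rank_proj_ker[OF Q'] by (intro bexI[of _ "v - Q' v"]) auto
  qed
  have "Q ` range Q' = range Q"
  proof (rule has_dim_image_eq[OF rank_proj_range[OF Q'] rank_proj_range[OF Q] rank_proj_linear[OF Q]])
    fix u assume u: "u \<in> range Q'" "Q u = 0"
    then have "Q' u = u" using rank_proj_range_iff[OF Q'] by blast
    then have "norm u \<le> s * norm u" using small[OF u(2)] by simp
    also have "s * norm u \<le> 1 / 2 * norm u" using s(2) by (intro mult_right_mono) auto
    finally show "u = 0" by simp
  qed auto
  then have surj: "\<exists>u. Q' u = u \<and> Q u = Q v" for v
    using rank_proj_range_iff[OF Q'] by (metis imageE rangeI)
  show "near (2 * s) {v. Q' v = 0} {v. Q v = 0}"
    unfolding near_def
  proof
    fix v assume "v \<in> {v. Q' v = 0}"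
    then have v: "Q' v = 0" by simp
    obtain u where u: "Q' u = u" "Q u = Q v" using surj by blast
    have k: "Q (v - u) = 0" using u rank_proj_diff[OF Q] by simp
    have "Q' (v - u) = - u" using u v rank_proj_diff[OF Q'] by simp
    then have "norm u \<le> s * norm (v - u)" using small[OF k] by simp
    also have "\<dots> \<le> s * (norm v + norm u)" using s norm_triangle_ineq4 by (intro mult_left_mono) auto
    finally have "norm u \<le> 2 * s * norm v"
      using mult_right_mono[OF s(2), of "norm u"] by (simp add: algebra_simps)
    then show "\<exists>w\<in>{v. Q v = 0}. norm (v - w) \<le> 2 * s * norm v"
      using k by (intro bexI[of _ "v - u"]) auto
  qed
qed

section \<open>Limits of exponentially convergent sequences of subspaces\<close>

text \<open>The lower limit in the sense of Kuratowski.\<close>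

definition limit_space :: "(nat \<Rightarrow> 'v::real_normed_vector set) \<Rightarrow> 'v set" where
  "limit_space W = {v. \<exists>w. (\<forall>n. w n \<in> W n) \<and> w \<longlonglongrightarrow> v}"

lemma subspace_limit_space:
  assumes "\<And>n. subspace (W n)"
  shows "subspace (limit_space W)"
proof (rule subspaceI)
  show "0 \<in> limit_space W"
    unfolding limit_space_def using subspace_0[OF assms] by (auto intro!: exI[of _ "\<lambda>_. 0"])
  fix x y :: 'a and c :: real
  assume x: "x \<in> limit_space W"
  then obtain u where u: "\<And>n. u n \<in> W n" "u \<longlonglongrightarrow> x" by (auto simp: limit_space_def)
  show "c *\<^sub>R x \<in> limit_space W"
    unfolding limit_space_def using subspace_scale[OF assms u(1)] tendsto_scaleR[OF tendsto_const u(2)]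
    by (intro CollectI exI[of _ "\<lambda>n. c *\<^sub>R u n"]) auto
  assume "y \<in> limit_space W"
  then obtain v where v: "\<And>n. v n \<in> W n" "v \<longlonglongrightarrow> y" by (auto simp: limit_space_def)
  show "x + y \<in> limit_space W"
    unfolding limit_space_def using subspace_add[OF assms u(1) v(1)] tendsto_add[OF u(2) v(2)]
    by (intro CollectI exI[of _ "\<lambda>n. u n + v n"]) auto
qed

lemma limit_spaceI:
  assumes "\<And>n. subspace (W n)" "\<And>n. n \<ge> N \<Longrightarrow> w n \<in> W n" "\<And>n. n \<ge> N \<Longrightarrow> norm (v - w n) \<le> r n" "r \<longlonglongrightarrow> 0"
  shows "v \<in> limit_space W"
proof -
  define w' where "w' = (\<lambda>n. if n \<ge> N then w n else 0)"
  have "\<forall>n. w' n \<in> W n" using assms(1,2) by (simp add: w'_def subspace_0)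
  moreover have "(\<lambda>n. w' n - v) \<longlonglongrightarrow> 0"
  proof (rule Lim_null_comparison[OF _ assms(4)])
    show "\<forall>\<^sub>F n in sequentially. norm (w' n - v) \<le> r n"
      unfolding eventually_sequentially w'_def using assms(3)
      by (intro exI[of _ N]) (auto simp: norm_minus_commute)
  qed
  then have "w' \<longlonglongrightarrow> v" using LIM_zero_cancel by blast
  ultimately show ?thesis unfolding limit_space_def by blast
qed

lemma prod_one_plus_geometric_le:
  fixes c \<tau> :: real
  assumes "0 \<le> c" "0 < \<tau>" "\<tau> < 1"
  shows "(\<Prod>j<i. 1 + c * \<tau> ^ (n + j)) \<le> exp (c * \<tau> ^ n / (1 - \<tau>))"
proof -
  have "(\<Prod>j<i. 1 + c * \<tau> ^ (n + j)) \<le> (\<Prod>j<i. exp (c * \<tau> ^ (n + j)))"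
    using assms by (intro prod_mono) (auto intro: add_nonneg_nonneg)
  also have "\<dots> = exp (\<Sum>j<i. c * \<tau> ^ (n + j))" by (simp add: exp_sum)
  also have "(\<Sum>j<i. c * \<tau> ^ (n + j)) = c * \<tau> ^ n * (\<Sum>j<i. \<tau> ^ j)"
    by (simp add: sum_distrib_left power_add mult_ac)
  also have "(\<Sum>j<i. \<tau> ^ j) \<le> 1 / (1 - \<tau>)"
    using sum_le_suminf[OF summable_geometric, of \<tau> "{..<i}"] suminf_geometric[of \<tau>] assms by simp
  then have "exp (c * \<tau> ^ n * (\<Sum>j<i. \<tau> ^ j)) \<le> exp (c * \<tau> ^ n * (1 / (1 - \<tau>)))"
    using assms by (simp only: exp_le_cancel_iff) (intro mult_left_mono, auto)
  finally show ?thesis by simp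
qed

lemma exp_minus_one_le:
  fixes y :: real
  assumes "0 \<le> y"
  shows "exp y - 1 \<le> y * exp y"
proof -
  have "1 - y \<le> exp (- y)" using exp_ge_add_one_self[of "- y"] by simp
  then have "(1 - y) * exp y \<le> exp (- y) * exp y" by (intro mult_right_mono) auto
  then show ?thesis by (simp add: algebra_simps exp_minus)
qed

text \<open>A Cauchy condition with exponential rate. Both directions occur: \<open>down\<close>
  shows that limit vectors are near each W n, \<open>up\<close> that each W n is near the
  limit.\<close>

locale near_cauchy =
  fixes W :: "nat \<Rightarrow> 'v::banach set" and N :: nat and c \<tau> :: real
  assumes W: "\<And>n. subspace (W n)"
    and up: "\<And>n. n \<ge> N \<Longrightarrow> near (c * \<tau> ^ n) (W n) (W (Suc n))"
    and down: "\<And>n. n \<ge> N \<Longrightarrow> near (c * \<tau> ^ n) (W (Suc n)) (W n)"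
    and c: "0 < c" and \<tau>: "0 < \<tau>" "\<tau> < 1"
begin

text \<open>Half of this, times \<tau>^n, bounds the product of all the factors 1 + c \<tau>^(n + j)
  minus 1, by way of exp y - 1 <= y exp y. The factor 2 leaves room for passing to the
  limit.\<close>

definition rate :: real where
  "rate = 2 * (c / (1 - \<tau>) * exp (c / (1 - \<tau>)))"

lemma rate_pos: "rate > 0"
  using c \<tau> by (simp add: rate_def)

lemma exp_bound: "exp (c * \<tau> ^ n / (1 - \<tau>)) \<le> exp (c / (1 - \<tau>))"
proof -
  have "c * \<tau> ^ n \<le> c" using c \<tau> by (intro mult_left_le power_le_one) auto
  then have "c * \<tau> ^ n / (1 - \<tau>) \<le> c / (1 - \<tau>)" using \<tau> by (intro divide_right_mono) auto
  then show ?thesis by (simp only: exp_le_cancel_iff)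
qed

lemma exp_bound_minus_one: "exp (c * \<tau> ^ n / (1 - \<tau>)) - 1 \<le> rate / 2 * \<tau> ^ n"
proof -
  have "exp (c * \<tau> ^ n / (1 - \<tau>)) - 1 \<le> c * \<tau> ^ n / (1 - \<tau>) * exp (c * \<tau> ^ n / (1 - \<tau>))"
    using c \<tau> by (intro exp_minus_one_le) simp
  also have "\<dots> \<le> c * \<tau> ^ n / (1 - \<tau>) * exp (c / (1 - \<tau>))"
    using c \<tau> by (intro mult_left_mono exp_bound) simp
  also have "\<dots> = rate / 2 * \<tau> ^ n" using \<tau> by (simp add: rate_def field_simps)
  finally show ?thesis .
qed

lemma near_down:
  assumes "n \<ge> N" "m \<ge> n"
  shows "near (rate / 2 * \<tau> ^ n) (W m) (W n)"
proof -
  have "near ((\<Prod>j<i. 1 + c * \<tau> ^ (n + j)) - 1) (W (n + i)) (W n)" for i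
  proof (induction i)
    case 0
    then show ?case by (simp add: near_refl)
  next
    case (Suc i)
    let ?p = "(\<Prod>j<i. 1 + c * \<tau> ^ (n + j))"
    have "1 \<le> ?p" using c \<tau> by (intro prod_ge_1) simp
    then have "near (c * \<tau> ^ (n + i) + (?p - 1) + c * \<tau> ^ (n + i) * (?p - 1)) (W (Suc (n + i))) (W n)"
      using near_trans[OF down[of "n + i"] Suc] assms(1) by simp
    then show ?case by (simp add: algebra_simps)
  qed
  from this[of "m - n"] have "near ((\<Prod>j<m - n. 1 + c * \<tau> ^ (n + j)) - 1) (W m) (W n)" using assms(2) by simp
  then show ?thesis
    by (rule near_mono) (use prod_one_plus_geometric_le[OF less_imp_le[OF c] \<tau>, of n "m - n"] exp_bound_minus_one[of n] in linarith)
qed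

lemma limit_near:
  assumes n: "n \<ge> N"
  shows "near (rate * \<tau> ^ n) (limit_space W) (W n)"
  unfolding near_def
proof
  fix v assume v: "v \<in> limit_space W"
  show "\<exists>w\<in>W n. norm (v - w) \<le> rate * \<tau> ^ n * norm v"
  proof (cases "v = 0")
    case True
    then show ?thesis using subspace_0[OF W] by (intro bexI[of _ 0]) auto
  next
    case False
    obtain w where w: "\<And>m. w m \<in> W m" "w \<longlonglongrightarrow> v" using v by (auto simp: limit_space_def)
    let ?d = "rate / 2 * \<tau> ^ n"
    have d: "?d > 0" using rate_pos \<tau> by simp
    have "(\<lambda>m. norm (v - w m) + ?d * norm (w m)) \<longlonglongrightarrow> norm (v - v) + ?d * norm v"
      by (intro tendsto_intros w(2))
    moreover have "norm (v - v) + a * b < 2 * a * b" if "0 < a * b" for a b :: real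
      using that unfolding diff_self norm_zero mult.assoc by linarith
    then have "norm (v - v) + ?d * norm v < 2 * ?d * norm v"
      using mult_pos_pos[OF d, of "norm v"] False by (metis zero_less_norm_iff)
    ultimately have "\<forall>\<^sub>F m in sequentially. norm (v - w m) + ?d * norm (w m) < 2 * ?d * norm v"
      by (rule order_tendstoD(2))
    then obtain m where m: "m \<ge> n" "norm (v - w m) + ?d * norm (w m) < 2 * ?d * norm v"
      unfolding eventually_sequentially by (metis nle_le)
    obtain g where g: "g \<in> W n" "norm (w m - g) \<le> ?d * norm (w m)"
      by (rule nearE[OF near_down[OF n m(1)] w(1)])
    have "norm (v - g) \<le> norm (v - w m) + norm (w m - g)"
      using norm_triangle_ineq[of "v - w m" "w m - g"] by simp
    then have "norm (v - g) \<le> rate * \<tau> ^ n * norm v" using g m by simp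
    then show ?thesis using g by blast
  qed
qed

text \<open>Starting from v, each next subspace supplies a vector near the previous one. The
  increments decay geometrically, so completeness gives a limit, which lies in the limit
  space.\<close>

lemma near_limit:
  assumes n: "n \<ge> N"
  shows "near (rate * \<tau> ^ n) (W n) (limit_space W)"
  unfolding near_def
proof
  fix v assume v: "v \<in> W n"
  have "\<exists>w. \<forall>i. (w i \<in> W (n + i) \<and> (i = 0 \<longrightarrow> w i = v)) \<and>
      norm (w (Suc i) - w i) \<le> c * \<tau> ^ (n + i) * norm (w i)"
  proof (rule dependent_nat_choice)
    show "\<exists>x. x \<in> W (n + 0) \<and> (0 = 0 \<longrightarrow> x = v)" using v by auto
    fix x i assume "x \<in> W (n + i) \<and> (i = 0 \<longrightarrow> x = v)"
    then have "x \<in> W (n + i)" by blast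
    then obtain y where "y \<in> W (Suc (n + i))" "norm (x - y) \<le> c * \<tau> ^ (n + i) * norm x"
      by (rule nearE[OF up[of "n + i"], rotated]) (use n in auto)
    then show "\<exists>y. (y \<in> W (n + Suc i) \<and> (Suc i = 0 \<longrightarrow> y = v)) \<and> norm (y - x) \<le> c * \<tau> ^ (n + i) * norm x"
      by (intro exI[of _ y]) (auto simp: norm_minus_commute)
  qed
  then obtain w where w: "\<And>i. w i \<in> W (n + i)" "w 0 = v"
    "\<And>i. norm (w (Suc i) - w i) \<le> c * \<tau> ^ (n + i) * norm (w i)" by metis
  have wb: "norm (w i) \<le> (\<Prod>j<i. 1 + c * \<tau> ^ (n + j)) * norm v" for i
  proof (induction i)
    case (Suc i)
    have "norm (w (Suc i)) \<le> norm (w i) + norm (w (Suc i) - w i)" by (rule norm_triangle_sub)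
    also have "\<dots> \<le> (1 + c * \<tau> ^ (n + i)) * norm (w i)" using w(3)[of i] by (simp add: algebra_simps)
    also have "\<dots> \<le> (1 + c * \<tau> ^ (n + i)) * ((\<Prod>j<i. 1 + c * \<tau> ^ (n + j)) * norm v)"
      using Suc c \<tau> by (intro mult_left_mono) auto
    finally show ?case by (simp add: mult_ac)
  qed (simp add: w)
  let ?e = "exp (c / (1 - \<tau>))"
  have wb': "norm (w i) \<le> ?e * norm v" for i
    using wb[of i] prod_one_plus_geometric_le[of c \<tau> n i] exp_bound[of n] c \<tau>
    by (meson less_imp_le mult_right_mono norm_ge_zero order_trans)
  have step: "norm (w (Suc i) - w i) \<le> c * \<tau> ^ n * ?e * norm v * \<tau> ^ i" for i
  proof -
    have "c * \<tau> ^ (n + i) * norm (w i) \<le> c * \<tau> ^ (n + i) * (?e * norm v)"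
      using wb' c \<tau> by (intro mult_left_mono) auto
    then show ?thesis using w(3)[of i] by (simp add: power_add mult_ac)
  qed
  have sm: "summable (\<lambda>i. c * \<tau> ^ n * ?e * norm v * \<tau> ^ i)" using \<tau> by (intro summable_mult summable_geometric) auto
  have sw: "summable (\<lambda>i. w (Suc i) - w i)" by (rule summable_comparison_test'[OF sm]) (rule step)
  define l where "l = v + (\<Sum>i. w (Suc i) - w i)"
  have "(\<lambda>i. v + (\<Sum>j<i. w (Suc j) - w j)) \<longlonglongrightarrow> l"
    unfolding l_def by (intro tendsto_add tendsto_const summable_LIMSEQ sw)
  then have lim: "w \<longlonglongrightarrow> l" by (simp add: sum_lessThan_telescope w(2))
  define w' where "w' = (\<lambda>m. if m < n then 0 else w (m - n))"
  have "\<forall>m. w' m \<in> W m"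
  proof
    fix m show "w' m \<in> W m"
      using w(1)[of "m - n"] subspace_0[OF W] by (cases "m < n") (auto simp: w'_def)
  qed
  moreover have "w' \<longlonglongrightarrow> l"
    using lim by (intro LIMSEQ_offset[of w' n]) (simp add: w'_def)
  ultimately have "l \<in> limit_space W" unfolding limit_space_def by blast
  moreover have "norm (v - l) \<le> rate * \<tau> ^ n * norm v"
  proof -
    have "norm (v - l) = norm (\<Sum>i. w (Suc i) - w i)" by (simp add: l_def)
    also have "\<dots> \<le> (\<Sum>i. c * \<tau> ^ n * ?e * norm v * \<tau> ^ i)"
      by (rule norm_suminf_le[OF step sm])
    also have "\<dots> = c * \<tau> ^ n * ?e * norm v * (1 / (1 - \<tau>))"
      using \<tau> by (subst suminf_mult) (auto simp: suminf_geometric intro: summable_geometric)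
    also have "\<dots> = rate / 2 * \<tau> ^ n * norm v"
      using \<tau> by (simp add: rate_def field_simps)
    also have "\<dots> \<le> rate * \<tau> ^ n * norm v"
      using rate_pos \<tau> by (intro mult_right_mono) auto
    finally show ?thesis .
  qed
  ultimately show "\<exists>w\<in>limit_space W. norm (v - w) \<le> rate * \<tau> ^ n * norm v" by blast
qed

lemma rate_tendsto_0: "(\<lambda>n. rate * \<tau> ^ n * x) \<longlonglongrightarrow> 0"
  using \<tau> by (intro tendsto_mult_left_zero tendsto_mult_right_zero LIMSEQ_power_zero) auto

lemma limit_closed: "closed (limit_space W)"
  unfolding closed_sequential_limits
proof (intro allI impI, elim conjE)
  fix x l assume x: "\<forall>i. x i \<in> limit_space W" "x \<longlonglongrightarrow> l"
  have "\<exists>w\<in>W n. norm (l - w) \<le> rate * \<tau> ^ n * (norm l + 1) + \<tau> ^ n" if n: "n \<ge> N" for n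
  proof -
    have t: "\<tau> ^ n > 0" using \<tau> by simp
    have "(\<lambda>i. norm (l - x i)) \<longlonglongrightarrow> norm (l - l)" by (intro tendsto_intros x(2))
    then have "\<forall>\<^sub>F i in sequentially. norm (l - x i) < min 1 (\<tau> ^ n)"
      using t by (intro order_tendstoD(2)) auto
    then obtain i where i: "norm (l - x i) < min 1 (\<tau> ^ n)" by (auto simp: eventually_sequentially)
    obtain w where w: "w \<in> W n" "norm (x i - w) \<le> rate * \<tau> ^ n * norm (x i)"
      by (rule nearE[OF limit_near[OF n]]) (use x in auto)
    have "norm (x i) \<le> norm l + 1"
      using norm_triangle_sub[of "x i" l] i by (simp add: norm_minus_commute)
    then have "rate * \<tau> ^ n * norm (x i) \<le> rate * \<tau> ^ n * (norm l + 1)"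
      using rate_pos t by (intro mult_left_mono) auto
    moreover have "norm (l - w) \<le> norm (l - x i) + norm (x i - w)"
      using norm_triangle_ineq[of "l - x i" "x i - w"] by simp
    ultimately have "norm (l - w) \<le> rate * \<tau> ^ n * (norm l + 1) + \<tau> ^ n" using w i by linarith
    then show ?thesis using w by blast
  qed
  then obtain w where w: "\<And>n. n \<ge> N \<Longrightarrow> w n \<in> W n \<and> norm (l - w n) \<le> rate * \<tau> ^ n * (norm l + 1) + \<tau> ^ n"
    by metis
  have "(\<lambda>n. rate * \<tau> ^ n * (norm l + 1) + \<tau> ^ n) \<longlonglongrightarrow> 0 + 0"
    using \<tau> by (intro tendsto_add rate_tendsto_0 LIMSEQ_power_zero) auto
  then show "l \<in> limit_space W" using w by (intro limit_spaceI[OF W, of N w]) auto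
qed

end

text \<open>Successive approximation: the residue v - s stays in T because S is contained in T, so
  it can be approximated again, and it halves each time.\<close>

lemma closed_subspace_eq_if_near:
  fixes S T :: "'v::real_normed_vector set"
  assumes "subspace S" "closed S" "subspace T" "S \<subseteq> T" "near (1 / 2) T S"
  shows "S = T"
proof
  show "T \<subseteq> S"
  proof
    fix v assume v: "v \<in> T"
    have "\<exists>s\<in>S. norm (v - s) \<le> norm v * (1 / 2) ^ n" for n
    proof (induction n)
      case 0
      then show ?case using subspace_0[OF assms(1)] by (intro bexI[of _ 0]) auto
    next
      case (Suc n)
      then obtain s where s: "s \<in> S" "norm (v - s) \<le> norm v * (1 / 2) ^ n" by blast
      then have "v - s \<in> T" using v assms(3,4) by (meson subsetD subspace_diff)
      then obtain t where t: "t \<in> S" "norm ((v - s) - t) \<le> 1 / 2 * norm (v - s)"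
        by (rule nearE[OF assms(5)])
      then have "norm (v - (s + t)) \<le> norm v * (1 / 2) ^ Suc n" using s by (simp add: algebra_simps)
      then show ?case using s t subspace_add[OF assms(1)] by blast
    qed
    then obtain s where s: "\<And>n. s n \<in> S" "\<And>n. norm (v - s n) \<le> norm v * (1 / 2) ^ n" by metis
    have "(\<lambda>n. norm v * (1 / 2) ^ n) \<longlonglongrightarrow> 0"
      by (intro tendsto_mult_right_zero LIMSEQ_power_zero) simp
    then have "v \<in> limit_space (\<lambda>_. S)"
      using s by (intro limit_spaceI[OF assms(1), of 0 s]) auto
    then show "v \<in> S" using assms(2) by (auto simp: limit_space_def closed_sequential_limits)
  qed
qed (rule assms(4))

text \<open>The range of Q remains a complement when the kernel of Q is replaced by F. Q contracts
  F, so the two meet only in 0 and the summand e depends boundedly on e + f. Hence the sum is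
  closed; it comes within half of every vector, so it is the whole space.\<close>

lemma has_codim_near_kernel:
  fixes F :: "'v::banach set"
  assumes Q: "rank_proj k K Q" and F: "subspace F" "closed F" and K: "0 \<le> K"
    and near: "near d F {v. Q v = 0}" "near d {v. Q v = 0} F" and d: "0 \<le> d" "(1 + K) * d \<le> 1 / 2"
  shows "has_codim F k"
proof (rule has_codimI[OF F(1) rank_proj_range[OF Q]])
  have QF: "norm (Q f) \<le> 1 / 2 * norm f" if f: "f \<in> F" for f
  proof -
    obtain g where g: "Q g = 0" "norm (f - g) \<le> d * norm f" by (rule nearE[OF near(1) f]) simp
    have "norm (Q f) = norm (Q (f - g))" using g rank_proj_diff[OF Q] by simp
    also have "\<dots> \<le> K * (d * norm f)"
      using rank_proj_norm[OF Q, of "f - g"] g(2) K by (meson mult_left_mono order_trans)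
    also have "\<dots> \<le> 1 / 2 * norm f"
      using mult_right_mono[OF d(2), of "norm f"] d(1) by (simp add: algebra_simps)
        (smt (verit) mult_nonneg_nonneg norm_ge_zero)
    finally show ?thesis .
  qed
  have "e = 0" if "e \<in> range Q" "e \<in> F" for e
    using QF[OF that(2)] that(1) rank_proj_range_iff[OF Q, of e] by simp
  moreover have "0 \<in> range Q \<inter> F" using subspace_0[OF F(1)] rank_proj_0[OF Q] by (metis IntI rangeI)
  ultimately show "range Q \<inter> F = {0}" by blast
  let ?S = "{e + f | e f. e \<in> range Q \<and> f \<in> F}"
  have sR: "subspace (range Q)" using rank_proj_range[OF Q] by (rule has_dim_subspace)
  have sS: "subspace ?S" by (rule subspace_sums[OF sR F(1)])
  have est: "norm e \<le> (2 * K + 1) * norm (e + f)" if e: "e \<in> range Q" and f: "f \<in> F" for e f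
  proof -
    have "e = Q (e + f) - Q f" using e rank_proj_range_iff[OF Q, of e] rank_proj_add[OF Q] by simp
    then have "norm e \<le> norm (Q (e + f)) + norm (Q f)" by (metis norm_triangle_ineq4)
    also have "\<dots> \<le> K * norm (e + f) + 1 / 2 * norm f"
      using rank_proj_norm[OF Q] QF[OF f] by (intro add_mono)
    also have "norm f \<le> norm (e + f) + norm e" using norm_triangle_ineq4[of "e + f" e] by simp
    finally show ?thesis by (simp add: algebra_simps)
  qed
  have "closed ?S"
    unfolding closed_sequential_limits
  proof (intro allI impI, elim conjE)
    fix x l assume x: "\<forall>i. x i \<in> ?S" "x \<longlonglongrightarrow> l"
    then obtain e f where ef: "\<And>i. e i \<in> range Q" "\<And>i. f i \<in> F" "\<And>i. x i = e i + f i"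
      by (auto simp: choice_iff)
    have cx: "Cauchy x" using x(2) LIMSEQ_imp_Cauchy by blast
    have "Cauchy e"
    proof (rule metric_CauchyI)
      fix r :: real assume r: "0 < r"
      have k: "2 * K + 1 > 0" using K by simp
      then obtain M where M: "\<And>m n. m \<ge> M \<Longrightarrow> n \<ge> M \<Longrightarrow> dist (x m) (x n) < r / (2 * K + 1)"
        using metric_CauchyD[OF cx, of "r / (2 * K + 1)"] r by auto
      have "dist (e m) (e n) < r" if "m \<ge> M" "n \<ge> M" for m n
      proof -
        have "norm (e m - e n) \<le> (2 * K + 1) * norm ((e m - e n) + (f m - f n))"
          using ef by (intro est subspace_diff[OF sR] subspace_diff[OF F(1)])
        also have "(e m - e n) + (f m - f n) = x m - x n" using ef(3) by simp
        also have "(2 * K + 1) * norm (x m - x n) < r"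
          using M[OF that] k by (simp add: dist_norm field_simps)
        finally show ?thesis by (simp add: dist_norm)
      qed
      then show "\<exists>M. \<forall>m\<ge>M. \<forall>n\<ge>M. dist (e m) (e n) < r" by blast
    qed
    then obtain e0 where e0: "e \<longlonglongrightarrow> e0" using Cauchy_convergent convergent_def by blast
    have "e0 \<in> range Q"
      using closed_sequentially[OF has_dim_closed[OF rank_proj_range[OF Q]] _ e0] ef(1) by blast
    moreover have "(\<lambda>i. x i - e i) \<longlonglongrightarrow> l - e0" by (intro tendsto_diff x(2) e0)
    then have "f \<longlonglongrightarrow> l - e0" using ef(3) by simp
    then have "l - e0 \<in> F" using closed_sequentially[OF F(2)] ef(2) by blast
    ultimately show "l \<in> ?S" by (intro CollectI exI[of _ e0] exI[of _ "l - e0"]) auto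
  qed
  moreover have "near (1 / 2) UNIV ?S"
    unfolding near_def
  proof
    fix v
    obtain f where f: "f \<in> F" "norm ((v - Q v) - f) \<le> d * norm (v - Q v)"
      by (rule nearE[OF near(2)]) (use rank_proj_ker[OF Q] in auto)
    have "norm (v - Q v) \<le> (1 + K) * norm v"
      using norm_triangle_ineq4[of v "Q v"] rank_proj_norm[OF Q, of v] by (simp add: algebra_simps)
    then have "d * norm (v - Q v) \<le> d * ((1 + K) * norm v)" using d(1) by (rule mult_left_mono)
    also have "\<dots> \<le> 1 / 2 * norm v"
      using mult_right_mono[OF d(2), of "norm v"] by (simp add: mult_ac)
    finally have "norm (v - (Q v + f)) \<le> 1 / 2 * norm v" using f by (simp add: algebra_simps)
    then show "\<exists>w\<in>?S. norm (v - w) \<le> 1 / 2 * norm v" using f by blast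
  qed
  ultimately have "?S = UNIV" by (intro closed_subspace_eq_if_near[OF sS]) simp_all
  then have "v \<in> ?S" for v by simp
  then show "\<exists>u\<in>range Q. \<exists>f\<in>F. v = u + f" for v by blast
qed

text \<open>Finite dimension of W' is part of the claim, so dimensions cannot be counted in advance.
  P is injective on W', its image is closed as a subspace of the finite-dimensional W, and it comes
  within half of each vector of W, so it equals W.\<close>

lemma has_dim_near:
  fixes W W' :: "'v::real_normed_vector set"
  assumes W: "has_dim W k" and W': "subspace W'"
    and near: "near d W' W" "near d W W'" and d: "0 \<le> d" "(1 + 3 ^ k) * d \<le> 1 / 2"
  shows "has_dim W' k"
proof -
  obtain P where P: "rank_proj k (3 ^ k) P" "range P = W" by (rule rank_proj_onto[OF W])
  have close: "norm (w - P w) \<le> 1 / 2 * norm w" if w: "w \<in> W'" for w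
  proof -
    obtain u where u: "u \<in> W" "norm (w - u) \<le> d * norm w" by (rule nearE[OF near(1) w])
    have Pu: "P u = u" using u P rank_proj_range_iff by blast
    have "w - P w = (w - u) - P (w - u)" using Pu rank_proj_diff[OF P(1)] by simp
    then have "norm (w - P w) \<le> norm (w - u) + norm (P (w - u))" by (metis norm_triangle_ineq4)
    also have "\<dots> \<le> (1 + 3 ^ k) * norm (w - u)"
      using rank_proj_norm[OF P(1), of "w - u"] by (simp add: algebra_simps)
    also have "\<dots> \<le> (1 + 3 ^ k) * (d * norm w)" using u(2) by (intro mult_left_mono) auto
    also have "\<dots> \<le> 1 / 2 * norm w" using mult_right_mono[OF d(2), of "norm w"] by (simp add: mult_ac)
    finally show ?thesis .
  qed
  then have half: "norm w \<le> 2 * norm (P w)" if "w \<in> W'" for w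
    using norm_triangle_sub[of w "P w"] that by fastforce
  have inj: "inj_on P W'"
    using half by (intro inj_on_if_kernel_trivial[OF rank_proj_linear[OF P(1)] W']) force
  have sP: "subspace (P ` W')" using linear_subspace_image[OF rank_proj_linear[OF P(1)] W'] .
  have "P ` W' = W"
  proof (rule closed_subspace_eq_if_near[OF sP _ has_dim_subspace[OF W]])
    show sub: "P ` W' \<subseteq> W" using P(2) by blast
    obtain B where B: "B \<subseteq> P ` W'" "independent B" "P ` W' \<subseteq> span B"
      by (rule maximal_independent_subset)
    have "finite B" using has_dim_card_le[OF W B(2)] B(1) sub by auto
    moreover have "span B = P ` W'" using B sP by (intro subset_antisym span_minimal)
    ultimately have "has_dim (P ` W') (card B)"
      unfolding has_dim_def using B(2) by (intro exI[of _ B] conjI refl)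
    then show "closed (P ` W')" by (rule has_dim_closed)
    show "near (1 / 2) W (P ` W')"
      unfolding near_def
    proof
      fix v assume v: "v \<in> W"
      obtain w where w: "w \<in> W'" "norm (v - w) \<le> d * norm v" by (rule nearE[OF near(2) v])
      have "v - P w = P (v - w)" using v P rank_proj_range_iff[OF P(1), of v] rank_proj_diff[OF P(1)] by simp
      then have "norm (v - P w) \<le> 3 ^ k * norm (v - w)" using rank_proj_norm[OF P(1)] by simp
      also have "\<dots> \<le> 3 ^ k * (d * norm v)" using w by (intro mult_left_mono) auto
      also have "\<dots> \<le> (1 + 3 ^ k) * d * norm v"
        using d(1) by (simp add: algebra_simps)
      also have "\<dots> \<le> 1 / 2 * norm v" using d(2) by (intro mult_right_mono) auto
      finally show "\<exists>w\<in>P ` W'. norm (v - w) \<le> 1 / 2 * norm v" using w by blast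
    qed
  qed
  then have "has_dim (P ` W') k" using W by simp
  obtain g where g: "linear g" "\<And>v. v \<in> W' \<Longrightarrow> g (P v) = v"
    using linear_exists_left_inverse_on[OF rank_proj_linear[OF P(1)] W' inj] by blast
  have "has_dim (g ` (P ` W')) k"
    by (rule has_dim_image[OF \<open>has_dim (P ` W') k\<close> g(1)]) (use g linear_0[OF rank_proj_linear[OF P(1)]] in force)
  moreover have "g ` (P ` W') = W'" using g(2) by (force simp: image_image)
  ultimately show ?thesis by simp
qed

subsection \<open>The limit splitting\<close>

text \<open>Baire category: some closed set \<open>T n\<close> contains a ball around a point a.
  Differences with a give the bound 2n on the ball of radius r around 0, and scaling to radius r / 2
  yields 4n / r.\<close>

lemma uniform_boundedness:
  fixes A :: "'i \<Rightarrow> 'v::banach \<Rightarrow>\<^sub>L 'w::real_normed_vector"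
  assumes "\<And>v. \<exists>r. \<forall>i\<in>I. norm (A i v) \<le> r"
  obtains M where "\<And>i v. i \<in> I \<Longrightarrow> norm (A i v) \<le> M * norm v"
proof -
  define T where "T n = {v. \<forall>i\<in>I. norm (A i v) \<le> real n}" for n
  have closed: "closed (T n)" for n
  proof -
    have "T n = (\<Inter>i\<in>I. {v. norm (A i v) \<le> real n})" by (auto simp: T_def)
    moreover have "closed {v. norm (A i v) \<le> real n}" for i by (intro closed_Collect_le continuous_intros)
    ultimately show ?thesis by auto
  qed
  have "\<exists>n. interior (T n) \<noteq> {}"
  proof (rule ccontr)
    assume "\<nexists>n. interior (T n) \<noteq> {}"
    then have "euclidean interior_of \<Union>(range T) = {}"
      using closed completely_metrizable_space_euclidean
      by (intro Baire_category_alt) (auto simp: interior_of_eq_empty_alt)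
    moreover have "\<Union>(range T) = UNIV"
    proof -
      have "\<exists>n. v \<in> T n" for v
      proof -
        obtain r where "\<forall>i\<in>I. norm (A i v) \<le> r" using assms by blast
        moreover obtain n where "r \<le> real n" using real_arch_simple by blast
        ultimately show ?thesis unfolding T_def using order_trans by blast
      qed
      then show ?thesis by blast
    qed
    ultimately show False by simp
  qed
  then obtain n a where "a \<in> interior (T n)" by blast
  then obtain r where r: "r > 0" "ball a r \<subseteq> T n" by (auto simp: mem_interior)
  have small: "norm (A i v) \<le> 2 * real n" if i: "i \<in> I" and v: "norm v < r" for i v
  proof -
    have "a + v \<in> T n" "a \<in> T n" using r v by (auto simp: dist_norm subset_iff)
    then have "norm (A i (a + v)) \<le> real n" "norm (A i a) \<le> real n" using i by (auto simp: T_def)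
    moreover have "A i v = A i (a + v) - A i a" by (simp add: blinfun.add_right)
    ultimately show ?thesis using norm_triangle_ineq4[of "A i (a + v)" "A i a"] by simp
  qed
  have "norm (A i v) \<le> (4 * real n / r) * norm v" if i: "i \<in> I" for i v
  proof (cases "v = 0")
    case False
    have "norm (A i ((r / (2 * norm v)) *\<^sub>R v)) \<le> 2 * real n" using False r by (intro small[OF i]) simp
    then show ?thesis using False r by (simp add: blinfun.scaleR_right field_simps)
  qed simp
  then show ?thesis using that by blast
qed

text \<open>The minimum over a finite subcover. All lower bounds uniform in x arise this way: for
  Gelfand numbers, for angles and for the expansion of E.\<close>

lemma compact_uniform_constant:
  fixes P :: "'x::topological_space \<Rightarrow> real \<Rightarrow> bool"
  assumes "compact (UNIV :: 'x set)"
    and local: "\<And>x0. \<exists>U c. open U \<and> x0 \<in> U \<and> 0 < c \<and> (\<forall>x\<in>U. P x c)"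
    and mono: "\<And>x c c'. P x c \<Longrightarrow> 0 < c' \<Longrightarrow> c' \<le> c \<Longrightarrow> P x c'"
  obtains c where "0 < c" "\<And>x. P x c"
proof -
  obtain U c where U: "\<And>x. open (U x)" "\<And>x. x \<in> U x" "\<And>x. 0 < (c x :: real)" "\<And>x y. y \<in> U x \<Longrightarrow> P y (c x)"
    using local by metis
  obtain D where D: "finite D" "UNIV \<subseteq> (\<Union>x\<in>D. U x)"
    by (rule compactE_image[OF assms(1), of UNIV U]) (use U in auto)
  then have ne: "D \<noteq> {}" by auto
  show ?thesis
  proof (rule that[of "Min (c ` D)"])
    show "0 < Min (c ` D)" using D ne U(3) by simp
    fix y
    obtain x where x: "x \<in> D" "y \<in> U x" using D(2) by blast
    then show "P y (Min (c ` D))"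
      using mono[OF U(4)[OF x(2)], of "Min (c ` D)"] D ne U(3) by simp
  qed
qed

section \<open>Cocycles over a compact base\<close>

locale continuous_cocycle =
  fixes \<phi> :: "real \<Rightarrow> 'x::topological_space \<Rightarrow> 'x"
    and B :: "'x \<Rightarrow> real \<Rightarrow> 'v::banach \<Rightarrow>\<^sub>L 'v"
    and k :: nat
  assumes compact_base: "compact (UNIV :: 'x set)"
    and flow: "continuous_flow \<phi>"
    and k: "k \<ge> 1"
    and dim: "\<exists>S :: 'v set. finite S \<and> independent S \<and> card S = k"
    and cocycle: "cocycle_over \<phi> B"
    and injB: "\<And>x t. t \<ge> 0 \<Longrightarrow> inj (blinfun_apply (B x t))"
    and contB: "\<And>t. t \<ge> 0 \<Longrightarrow> continuous_on UNIV (\<lambda>x. B x t)"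
    and strongB: "continuous_map (top_of_set (UNIV \<times> {0..})) strong_operator_topology (\<lambda>(x, t). B x t)"
begin

definition gk :: "'x \<Rightarrow> real \<Rightarrow> real" where
  "gk x t = gelfand_number k (B x t)"

lemma dim_space: obtains E0 :: "'v set" where "has_dim E0 k"
  using dim by (auto simp: has_dim_def)

lemma flow_add: "\<phi> (s + t) x = \<phi> s (\<phi> t x)"
proof -
  have "\<phi> (s + t) = \<phi> s \<circ> \<phi> t" using flow by (simp add: continuous_flow_def)
  then show ?thesis by simp
qed

text \<open>An idempotent injective map is the identity; \<open>B_0\<close> rests on the same
  remark.\<close>

lemma flow_0: "\<phi> 0 x = x"
proof -
  obtain g where g: "homeomorphism UNIV UNIV (\<phi> 0) g" using flow unfolding continuous_flow_def by blast
  have "\<phi> 0 (\<phi> 0 x) = \<phi> 0 x" using flow_add[of 0 0 x] by simp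
  then have "g (\<phi> 0 (\<phi> 0 x)) = g (\<phi> 0 x)" by simp
  then show ?thesis using g by (simp add: homeomorphism_def)
qed

lemma flow_inverse: "\<phi> t (\<phi> (- t) x) = x" "\<phi> (- t) (\<phi> t x) = x"
  using flow_add[of t "- t" x] flow_add[of "- t" t x] by (simp_all add: flow_0)

lemma continuous_flow_map: "continuous_on UNIV (\<phi> t)"
  using flow by (metis continuous_flow_def homeomorphism_def)

lemma B_add: "0 \<le> s \<Longrightarrow> 0 \<le> t \<Longrightarrow> B x (s + t) = B (\<phi> t x) s o\<^sub>L B x t"
  using cocycle by (simp add: cocycle_over_def)

lemma B_add_apply: "0 \<le> s \<Longrightarrow> 0 \<le> t \<Longrightarrow> B x (s + t) v = B (\<phi> t x) s (B x t v)"
  by (simp add: B_add)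

lemma B_0: "B x 0 v = v"
proof -
  have "B x 0 (B x 0 v) = B x 0 v" using B_add_apply[of 0 0 x v] by (simp add: flow_0)
  then show ?thesis using injD[OF injB[of 0 x]] by simp
qed

lemma B_nonzero: "t \<ge> 0 \<Longrightarrow> v \<noteq> 0 \<Longrightarrow> B x t v \<noteq> 0"
  using injD[OF injB[of t x], of v 0] by auto

lemma linear_B: "linear (blinfun_apply (B x t))"
  using blinfun.bounded_linear_right bounded_linear.linear by blast

lemma gk_pos: "t \<ge> 0 \<Longrightarrow> 0 < gk x t"
  unfolding gk_def by (rule dim_space) (rule gelfand_number_pos[OF _ k injB])

lemma gk_lipschitz: "gk x t \<le> gk y t + norm (B x t - B y t)"
proof -
  obtain E0 :: "'v set" where E0: "has_dim E0 k" by (rule dim_space)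
  obtain E1 where E1: "has_dim E1 (k - 1)" "E1 \<subseteq> E0" by (rule has_dim_smaller[OF E0, of "k - 1"]) simp
  show ?thesis unfolding gk_def by (rule gelfand_number_lipschitz[OF E1(1)])
qed

lemma close_B:
  assumes "t \<ge> 0" "0 < (e :: real)"
  obtains U where "open U" "x0 \<in> U" "\<And>x. x \<in> U \<Longrightarrow> norm (B x t - B x0 t) < e"
proof -
  have "open ((\<lambda>x. B x t) -` ball (B x0 t) e)"
    using contB[OF assms(1)] by (intro open_vimage) auto
  then show ?thesis
    using that[of "(\<lambda>x. B x t) -` ball (B x0 t) e"] assms by (auto simp: dist_norm norm_minus_commute)
qed

lemma gk_lower:
  assumes t: "t \<ge> 0"
  obtains c where "0 < c" "\<And>x. c \<le> gk x t"
proof (rule compact_uniform_constant[OF compact_base, of "\<lambda>x c. c \<le> gk x t"])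
  fix x0
  obtain U where U: "open U" "x0 \<in> U" "\<And>x. x \<in> U \<Longrightarrow> norm (B x t - B x0 t) < gk x0 t / 2"
    by (rule close_B[OF t, of "gk x0 t / 2" x0]) (use gk_pos[OF t, of x0] in auto)
  have "gk x0 t / 2 \<le> gk x t" if "x \<in> U" for x
    using gk_lipschitz[of x0 t x] U(3)[OF that] by (simp add: norm_minus_commute)
  then show "\<exists>U c. open U \<and> x0 \<in> U \<and> 0 < c \<and> (\<forall>x\<in>U. c \<le> gk x t)"
    using U gk_pos[OF t, of x0] by (intro exI[of _ U] exI[of _ "gk x0 t / 2"]) auto
qed (auto intro: that)

text \<open>Strong continuity bounds (x, t) to B x t v on the compact set of all x and all t in
  [0, 1], for each v; the uniform boundedness principle makes this uniform in v.\<close>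

lemma uniform_bound:
  obtains M where "1 \<le> M" "\<And>x t v. 0 \<le> t \<Longrightarrow> t \<le> 1 \<Longrightarrow> norm (B x t v) \<le> M * norm v"
proof -
  have "\<exists>r. \<forall>p\<in>UNIV \<times> {0..1}. norm ((\<lambda>(x, t). B x t) p v) \<le> r" for v
  proof -
    have "continuous_map (top_of_set (UNIV \<times> {0..})) euclidean (\<lambda>p. (\<lambda>(x, t). B x t) p v)"
      using strongB continuous_on_strong_operator_topo_iff_coordinatewise by blast
    then have "continuous_on (UNIV \<times> {0..}) (\<lambda>p. (\<lambda>(x, t). B x t) p v)" by simp
    then have "continuous_on (UNIV \<times> {0..1}) (\<lambda>p. (\<lambda>(x, t). B x t) p v)"
      by (rule continuous_on_subset) auto
    moreover have "compact (UNIV \<times> {0..1} :: ('x \<times> real) set)"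
      using compact_base by (intro compact_Times) auto
    ultimately have "bounded ((\<lambda>p. (\<lambda>(x, t). B x t) p v) ` (UNIV \<times> {0..1}))"
      by (intro compact_imp_bounded compact_continuous_image)
    then show ?thesis unfolding bounded_iff by blast
  qed
  then obtain M where M: "\<And>p v. p \<in> UNIV \<times> {0..1} \<Longrightarrow> norm ((\<lambda>(x, t). B x t) p v) \<le> M * norm v"
    by (rule uniform_boundedness[of "UNIV \<times> {0..1}" "\<lambda>(x, t). B x t"]) (rule that)
  have "norm (B x t v) \<le> max 1 M * norm v" if "0 \<le> t" "t \<le> 1" for x t v
    using M[of "(x, t)" v] that mult_right_mono[of M "max 1 M" "norm v"] by auto
  then show ?thesis using that[of "max 1 M"] by simp
qed

end

locale bounded_cocycle = continuous_cocycle \<phi> B k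
  for \<phi> :: "real \<Rightarrow> 'x::topological_space \<Rightarrow> 'x" and B :: "'x \<Rightarrow> real \<Rightarrow> 'v::banach \<Rightarrow>\<^sub>L 'v" and k +
  fixes M :: real
  assumes M1: "1 \<le> M" and MB: "\<And>x t v. 0 \<le> t \<Longrightarrow> t \<le> 1 \<Longrightarrow> norm (B x t v) \<le> M * norm v"
begin

lemma norm_B_le: "0 \<le> t \<Longrightarrow> t \<le> 1 \<Longrightarrow> norm (B x t) \<le> M"
  using MB M1 by (intro norm_blinfun_bound) auto

lemma norm_B_power: "norm (B x (real n) v) \<le> M ^ n * norm v"
proof (induction n)
  case (Suc n)
  have "B x (real (Suc n)) v = B (\<phi> (real n) x) 1 (B x (real n) v)"
    using B_add_apply[of 1 "real n" x v] by (simp add: add.commute)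
  then have "norm (B x (real (Suc n)) v) \<le> M * norm (B x (real n) v)" using MB by simp
  also have "\<dots> \<le> M * (M ^ n * norm v)" using Suc M1 by (intro mult_left_mono) auto
  finally show ?case by simp
qed (simp add: B_0)

lemma gk_left:
  assumes "0 \<le> t" "0 \<le> s" "s \<le> 1"
  shows "gk x (t + s) \<le> M * gk x t"
proof -
  obtain E0 :: "'v set" where E0: "has_dim E0 k" by (rule dim_space)
  obtain E1 where E1: "has_dim E1 (k - 1)" "E1 \<subseteq> E0" by (rule has_dim_smaller[OF E0, of "k - 1"]) simp
  have "gk x (t + s) \<le> norm (B (\<phi> t x) s) * gk x t"
    unfolding gk_def using B_add[of s t x] assms gelfand_number_comp_left[OF E1(1)] by (simp add: add.commute)
  also have "\<dots> \<le> M * gk x t"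
    using norm_B_le assms gk_pos[of t x] by (intro mult_right_mono) auto
  finally show ?thesis .
qed

lemma gk_right:
  assumes "0 \<le> t" "0 \<le> s" "s \<le> 1"
  shows "gk x (t + s) \<le> M * gk (\<phi> s x) t"
proof -
  obtain E0 :: "'v set" where E0: "has_dim E0 k" by (rule dim_space)
  show ?thesis
    unfolding gk_def B_add[OF assms(1,2)]
    using norm_B_le assms M1 by (intro gelfand_number_comp_right[OF E0 k]) auto
qed

text \<open>Along one orbit, the time interval from t to t + r lies inside the one from 0 to r + 1.
  Dropping the initial piece of length t and the final one of length 1 - t costs a factor M each.
  Thus the unit of slack absorbs every shift t in [0, 1].\<close>

lemma gk_compare:
  assumes "0 \<le> r" "0 \<le> t" "t \<le> 1"
  shows "gk x (r + 1) \<le> M * M * gk (\<phi> t x) r"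
proof -
  have "gk x (r + 1) \<le> M * gk (\<phi> t x) (r + (1 - t))"
    using gk_right[of "r + (1 - t)" t x] assms by (simp add: algebra_simps)
  also have "\<dots> \<le> M * (M * gk (\<phi> t x) r)"
    using gk_left[of r "1 - t"] assms M1 by (intro mult_left_mono) auto
  finally show ?thesis by simp
qed

text \<open>Reduces invariance to times in [0, 1], where M bounds the cocycle.\<close>

lemma extend_to_all_times:
  assumes step: "\<And>x t v. 0 \<le> t \<Longrightarrow> t \<le> 1 \<Longrightarrow> v \<in> S x \<Longrightarrow> B x t v \<in> S (\<phi> t x)"
    and t: "0 \<le> t" and v: "v \<in> S x"
  shows "B x t v \<in> S (\<phi> t x)"
proof -
  have nat: "B x (real n) v \<in> S (\<phi> (real n) x)" for n
  proof (induction n)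
    case (Suc n)
    have "B (\<phi> (real n) x) 1 (B x (real n) v) \<in> S (\<phi> 1 (\<phi> (real n) x))" by (rule step) (use Suc in auto)
    moreover have "B x (real (Suc n)) v = B (\<phi> (real n) x) 1 (B x (real n) v)"
      using B_add_apply[of 1 "real n" x v] by (simp add: add.commute)
    moreover have "\<phi> (real (Suc n)) x = \<phi> 1 (\<phi> (real n) x)"
      using flow_add[of 1 "real n" x] by (simp add: add.commute)
    ultimately show ?case by simp
  qed (use v in \<open>simp add: B_0 flow_0\<close>)
  let ?n = "nat \<lfloor>t\<rfloor>"
  let ?r = "t - real ?n"
  have r: "0 \<le> ?r" "?r \<le> 1" using t by linarith+
  have "B (\<phi> (real ?n) x) ?r (B x (real ?n) v) \<in> S (\<phi> ?r (\<phi> (real ?n) x))"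
    by (rule step[OF r nat])
  then show ?thesis
    using B_add_apply[of ?r "real ?n" x v] flow_add[of ?r "real ?n" x] r by simp
qed

end

section \<open>Approximating projections and the limit of their kernels\<close>

text \<open>\<open>remainder\<close> and \<open>remainder'\<close> come from the cases \<epsilon> =
  0 and \<epsilon> = 1 of the gap, the latter read at \<phi> (- 1) x. The first allows one further
  step at the end of the time interval, the second one further step at its beginning. Q is total in
  n, but carries estimates only from N on.\<close>

locale approx_splitting = bounded_cocycle \<phi> B k M
  for \<phi> :: "real \<Rightarrow> 'x::topological_space \<Rightarrow> 'x" and B :: "'x \<Rightarrow> real \<Rightarrow> 'v::banach \<Rightarrow>\<^sub>L 'v" and k M +
  fixes Q :: "nat \<Rightarrow> 'x \<Rightarrow> 'v \<Rightarrow> 'v" and N :: nat and K C \<tau> :: real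
  assumes Q: "\<And>n x. rank_proj k K (Q n x)" and K1: "1 \<le> K" and C: "0 < C" and \<tau>: "0 < \<tau>" "\<tau> < 1"
    and remainder: "\<And>n x v. n \<ge> N \<Longrightarrow>
      norm (B x (real n) (v - Q n x v)) \<le> C * \<tau> ^ n * gk x (real n + 1) * norm v"
    and remainder': "\<And>n x v. n \<ge> N \<Longrightarrow>
      norm (B x (real n) (v - Q n x v)) \<le> C * \<tau> ^ n * gk (\<phi> (- 1) x) (real n + 1) * norm v"
    and growth: "\<And>n x v. n \<ge> N \<Longrightarrow> gk x (real n) * norm (Q n x v) \<le> K * norm (B x (real n) (Q n x v))"
begin

lemma tau_power: "0 < \<tau> ^ n" "\<tau> ^ n \<le> 1" "\<tau> ^ Suc n \<le> \<tau> ^ n"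
  using \<tau> by (auto simp: power_le_one mult_left_le_one_le)

lemma eventually_small:
  fixes a b :: real
  assumes "0 < b"
  shows "\<exists>n0\<ge>m. \<forall>n\<ge>n0. a * \<tau> ^ n \<le> b"
proof -
  have "(\<lambda>n. a * \<tau> ^ n) \<longlonglongrightarrow> 0" using \<tau> by (intro tendsto_mult_right_zero LIMSEQ_power_zero) auto
  then have "\<forall>\<^sub>F n in sequentially. a * \<tau> ^ n < b" using assms by (rule order_tendstoD(2))
  then obtain n1 where "\<forall>n\<ge>n1. a * \<tau> ^ n < b" unfolding eventually_sequentially by blast
  then show ?thesis by (intro exI[of _ "max m n1"]) (auto intro: less_imp_le)
qed

lemma remainder_le:
  assumes "n \<ge> N"
  shows "norm (B x (real n) (v - Q n x v)) \<le> C * M * \<tau> ^ n * gk x (real n) * norm v"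
proof -
  have "C * \<tau> ^ n * gk x (real n + 1) * norm v \<le> C * \<tau> ^ n * (M * gk x (real n)) * norm v"
    using gk_left[of "real n" 1 x] C tau_power[of n] by (intro mult_right_mono mult_left_mono) auto
  then show ?thesis using remainder[OF assms, of x v] by (simp add: mult_ac)
qed

text \<open>B (Q v) is B v minus the remainder, and on the range of Q the map B stretches by at
  least \<open>gk\<close> / K; so a vector that B hardly stretches has a small projection.\<close>

lemma Q_small:
  assumes n: "n \<ge> N" and v: "norm (B x (real n) v) \<le> a * gk x (real n)"
  shows "norm (Q n x v) \<le> K * (a + C * M * \<tau> ^ n * norm v)"
proof -
  have g: "0 < gk x (real n)" by (simp add: gk_pos)
  have "norm (B x (real n) (Q n x v)) \<le> norm (B x (real n) v) + norm (B x (real n) (v - Q n x v))"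
    unfolding blinfun.diff_right by (metis norm_minus_commute norm_triangle_sub)
  also have "\<dots> \<le> gk x (real n) * (a + C * M * \<tau> ^ n * norm v)"
    using v remainder_le[OF n, of x v] by (simp add: algebra_simps)
  finally have "K * norm (B x (real n) (Q n x v)) \<le> K * (gk x (real n) * (a + C * M * \<tau> ^ n * norm v))"
    using K1 by (intro mult_left_mono) auto
  then have "gk x (real n) * norm (Q n x v) \<le> gk x (real n) * (K * (a + C * M * \<tau> ^ n * norm v))"
    using growth[OF n, of x v] by (simp add: mult_ac)
  then show ?thesis using g by simp
qed

lemma range_bound:
  assumes "n \<ge> N" "Q n x u = u"
  shows "gk x (real n) * norm u \<le> K * norm (B x (real n) u)"
  using growth[OF assms(1), of x u] assms(2) by simp

abbreviation kerQ :: "'x \<Rightarrow> nat \<Rightarrow> 'v set" where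
  "kerQ x n \<equiv> {v. Q n x v = 0}"

lemma ker_small:
  assumes "n \<ge> N" "Q n x v = 0"
  shows "norm (B x (real n) v) \<le> C * M * \<tau> ^ n * norm v * gk x (real n)"
  using remainder_le[OF assms(1), of x v] assms(2) by (simp add: mult_ac)

text \<open>It matters that the remainder is measured against \<open>gk x (n + 1)\<close>: no lower
  bound for its quotient by \<open>gk x n\<close> is at hand here.\<close>

lemma ker_next:
  assumes n: "n \<ge> N" and v: "Q n x v = 0"
  shows "norm (Q (Suc n) x v) \<le> 2 * K * M * C * \<tau> ^ n * norm v"
proof -
  have eq: "real (Suc n) = real n + 1" by simp
  have "norm (B x (real (Suc n)) v) \<le> M * norm (B x (real n) v)"
    using B_add_apply[of 1 "real n" x v] MB[of 1 "\<phi> (real n) x" "B x (real n) v"] by (simp add: add.commute)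
  also have "\<dots> \<le> M * (C * \<tau> ^ n * gk x (real n + 1) * norm v)"
    using remainder[OF n, of x v] v M1 by (intro mult_left_mono) auto
  finally have "norm (B x (real (Suc n)) v) \<le> (M * C * \<tau> ^ n * norm v) * gk x (real (Suc n))"
    unfolding eq by (simp add: mult_ac)
  from Q_small[OF _ this] have "norm (Q (Suc n) x v)
      \<le> K * (M * C * \<tau> ^ n * norm v + C * M * \<tau> ^ Suc n * norm v)" using n by simp
  also have "\<dots> \<le> K * (M * C * \<tau> ^ n * norm v + C * M * \<tau> ^ n * norm v)"
    using tau_power(3)[of n] K1 C M1
    by (intro mult_left_mono add_left_mono mult_right_mono) auto
  finally show ?thesis by (simp add: algebra_simps)
qed

definition slow :: "'x \<Rightarrow> 'v set" where
  "slow x = limit_space (kerQ x)"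

lemma subspace_ker: "subspace (kerQ x n)"
  by (rule rank_proj_subspace_ker[OF Q])

lemma near_slow:
  obtains D N1 where "0 < D" "N \<le> N1" "\<And>n x. n \<ge> N1 \<Longrightarrow> near (D * \<tau> ^ n) (slow x) (kerQ x n)"
    "\<And>n x. n \<ge> N1 \<Longrightarrow> near (D * \<tau> ^ n) (kerQ x n) (slow x)" "\<And>x. closed (slow x)"
proof -
  define s where "s = 2 * K * M * C"
  have s: "0 < s" using K1 M1 C by (simp add: s_def)
  obtain N1 where N1: "N1 \<ge> N" "\<And>n. n \<ge> N1 \<Longrightarrow> s * \<tau> ^ n \<le> 1 / 2"
    using eventually_small[of "1 / 2" N s] by auto
  \<comment> \<open>The factor 2 is that of the reverse estimate in
    \<open>near_sym_kernel\<close>.\<close>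
  have cauchy: "near_cauchy (kerQ x) N1 (2 * s) \<tau>" for x
  proof
    fix n
    show "subspace (kerQ x n)" by (rule subspace_ker)
    assume n: "n \<ge> N1"
    have s0: "0 \<le> s * \<tau> ^ n" using s tau_power[of n] by simp
    have *: "\<And>v. Q n x v = 0 \<Longrightarrow> norm (Q (Suc n) x v) \<le> s * \<tau> ^ n * norm v"
      using ker_next[of n x] n N1(1) by (simp add: s_def)
    show "near (2 * s * \<tau> ^ n) (kerQ x n) (kerQ x (Suc n))"
      by (rule near_mono[OF near_sym_kernel(1)[OF Q Q * s0 N1(2)[OF n]]]) (use s0 in auto)
    show "near (2 * s * \<tau> ^ n) (kerQ x (Suc n)) (kerQ x n)"
      by (rule near_mono[OF near_sym_kernel(2)[OF Q Q * s0 N1(2)[OF n]]]) auto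
  qed (use s \<tau> in auto)
  show ?thesis
  proof (rule that[of "near_cauchy.rate (2 * s) \<tau>" N1])
    show "0 < near_cauchy.rate (2 * s) \<tau>" by (rule near_cauchy.rate_pos[OF cauchy])
    show "near (near_cauchy.rate (2 * s) \<tau> * \<tau> ^ n) (slow x) (kerQ x n)" if "n \<ge> N1" for n x
      unfolding slow_def using near_cauchy.limit_near[OF cauchy that] .
    show "near (near_cauchy.rate (2 * s) \<tau> * \<tau> ^ n) (kerQ x n) (slow x)" if "n \<ge> N1" for n x
      unfolding slow_def using near_cauchy.near_limit[OF cauchy that] .
    show "closed (slow x)" for x unfolding slow_def by (rule near_cauchy.limit_closed[OF cauchy])
  qed (rule N1(1))
qed

lemma subspace_slow: "subspace (slow x)"
  unfolding slow_def by (rule subspace_limit_space) (rule subspace_ker)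

lemma closed_slow: "closed (slow x)"
  by (rule near_slow)

lemma codim_slow: "has_codim (slow x) k"
proof -
  obtain D N1 where D: "0 < D" "N \<le> N1" "\<And>n x. n \<ge> N1 \<Longrightarrow> near (D * \<tau> ^ n) (slow x) (kerQ x n)"
    "\<And>n x. n \<ge> N1 \<Longrightarrow> near (D * \<tau> ^ n) (kerQ x n) (slow x)" by (rule near_slow) (rule that)
  obtain n where n: "n \<ge> N1" "(1 + K) * D * \<tau> ^ n \<le> 1 / 2"
    using eventually_small[of "1 / 2" N1 "(1 + K) * D"] by auto
  show ?thesis
    using has_codim_near_kernel[OF Q subspace_slow closed_slow _ D(3,4)[OF n(1)]] n K1 D(1) tau_power[of n]
    by (simp add: mult.assoc)
qed

text \<open>The image z of an approximating kernel vector is moved into the kernel at \<phi> t x by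
  subtracting its projection. This projection is small because \<open>gk_compare\<close> bounds
  \<open>gk x (n + 1)\<close> by M^2 times the Gelfand number at \<phi> t x and time n.\<close>

lemma slow_invariant:
  assumes "0 \<le> t" "v \<in> slow x"
  shows "B x t v \<in> slow (\<phi> t x)"
proof (rule extend_to_all_times[where S = slow])
  fix x :: 'x and t :: real and v :: 'v
  assume t: "0 \<le> t" "t \<le> 1" and v: "v \<in> slow x"
  obtain D N1 where D: "0 < D" "N \<le> N1" "\<And>n x. n \<ge> N1 \<Longrightarrow> near (D * \<tau> ^ n) (slow x) (kerQ x n)"
    by (rule near_slow) (rule that)
  have "\<forall>n\<ge>N1. \<exists>w. Q n x w = 0 \<and> norm (v - w) \<le> D * \<tau> ^ n * norm v"
    using D(3) v unfolding near_def by blast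
  then obtain w where w: "\<And>n. n \<ge> N1 \<Longrightarrow> Q n x (w n) = 0"
    "\<And>n. n \<ge> N1 \<Longrightarrow> norm (v - w n) \<le> D * \<tau> ^ n * norm v" by metis
  let ?y = "\<phi> t x"
  define z where "z n = B x t (w n)" for n
  let ?c = "K * (C * M * M * M + C * M * M)"
  let ?r = "M * D * norm v + ?c * ((1 + D) * norm v)"
  have c: "0 \<le> ?c" using K1 C M1 by simp
  have est: "norm (B x t v - (z n - Q n ?y (z n))) \<le> ?r * \<tau> ^ n" if n: "n \<ge> N1" for n
  proof -
    have nN: "n \<ge> N" using n D(2) by simp
    have "D * norm v * \<tau> ^ n \<le> D * norm v" using tau_power[of n] D(1) by (intro mult_left_le) auto
    moreover have "norm (w n) \<le> norm v + norm (v - w n)" by (metis norm_minus_commute norm_triangle_sub)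
    ultimately have wn: "norm (w n) \<le> (1 + D) * norm v" using w(2)[OF n] by (simp add: algebra_simps)
    have zn: "norm (z n) \<le> M * norm (w n)" unfolding z_def using MB t by blast
    have "B ?y (real n) (z n) = B x (real n + t) (w n)" unfolding z_def using B_add_apply[of "real n" t] t by simp
    also have "\<dots> = B (\<phi> (real n) x) t (B x (real n) (w n))"
      using B_add_apply[of t "real n"] t by (simp add: add.commute)
    finally have "norm (B ?y (real n) (z n)) \<le> M * norm (B x (real n) (w n))" using MB t by simp
    also have "\<dots> \<le> M * (C * \<tau> ^ n * gk x (real n + 1) * norm (w n))"
      using remainder[OF nN, of x "w n"] w(1)[OF n] M1 by (intro mult_left_mono) auto
    also have "\<dots> \<le> M * (C * \<tau> ^ n * (M * M * gk ?y (real n)) * norm (w n))"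
      using gk_compare[of "real n" t x] t M1 C tau_power[of n]
      by (intro mult_left_mono mult_right_mono) auto
    finally have "norm (B ?y (real n) (z n)) \<le> (C * M * M * M * \<tau> ^ n * norm (w n)) * gk ?y (real n)"
      by (simp add: mult_ac)
    from Q_small[OF nN this]
    have "norm (Q n ?y (z n)) \<le> K * (C * M * M * M * \<tau> ^ n * norm (w n) + C * M * \<tau> ^ n * norm (z n))" .
    also have "\<dots> \<le> K * (C * M * M * M * \<tau> ^ n * norm (w n) + C * M * \<tau> ^ n * (M * norm (w n)))"
      using zn K1 C M1 tau_power[of n] by (intro mult_left_mono add_left_mono) auto
    also have "\<dots> = ?c * \<tau> ^ n * norm (w n)" by (simp add: algebra_simps)
    also have "\<dots> \<le> ?c * \<tau> ^ n * ((1 + D) * norm v)"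
      using wn c tau_power[of n] by (intro mult_left_mono) auto
    finally have Qz: "norm (Q n ?y (z n)) \<le> ?c * \<tau> ^ n * ((1 + D) * norm v)" .
    have "norm (B x t (v - w n)) \<le> M * norm (v - w n)" using MB t by blast
    also have "\<dots> \<le> M * (D * \<tau> ^ n * norm v)" using w(2)[OF n] M1 by (intro mult_left_mono) auto
    finally have "norm (B x t v - z n) \<le> M * (D * \<tau> ^ n * norm v)" by (simp add: z_def blinfun.diff_right)
    moreover have "norm (B x t v - (z n - Q n ?y (z n))) \<le> norm (B x t v - z n) + norm (Q n ?y (z n))"
      using norm_triangle_ineq[of "B x t v - z n" "Q n ?y (z n)"] by (simp add: algebra_simps)
    ultimately have "norm (B x t v - (z n - Q n ?y (z n)))
        \<le> M * (D * \<tau> ^ n * norm v) + ?c * \<tau> ^ n * ((1 + D) * norm v)" using Qz by linarith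
    also have "\<dots> = ?r * \<tau> ^ n" by (simp add: algebra_simps)
    finally show ?thesis .
  qed
  show "B x t v \<in> slow (\<phi> t x)"
    unfolding slow_def
  proof (rule limit_spaceI[of _ N1 "\<lambda>n. z n - Q n ?y (z n)" _ "\<lambda>n. ?r * \<tau> ^ n"])
    show "(\<lambda>n. ?r * \<tau> ^ n) \<longlonglongrightarrow> 0"
      using \<tau> by (intro tendsto_mult_right_zero LIMSEQ_power_zero) auto
  qed (use est rank_proj_ker[OF Q] subspace_ker in auto)
qed (use assms in auto)

section \<open>The limit of the images from the past\<close>

definition pushed :: "'x \<Rightarrow> nat \<Rightarrow> 'v set" where
  "pushed x n = B (\<phi> (- real n) x) (real n) ` range (Q n (\<phi> (- real n) x))"

lemma pushedE:
  assumes "v \<in> pushed x n"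
  obtains u where "v = B (\<phi> (- real n) x) (real n) u" "Q n (\<phi> (- real n) x) u = u"
  using assms rank_proj_idem[OF Q] by (auto simp: pushed_def)

lemma pushedI:
  assumes "Q n (\<phi> (- real n) x) u = u"
  shows "B (\<phi> (- real n) x) (real n) u \<in> pushed x n"
  unfolding pushed_def using assms by (metis imageI rangeI)

lemma has_dim_pushed: "has_dim (pushed x n) k"
  unfolding pushed_def
  by (rule has_dim_image[OF rank_proj_range[OF Q] linear_B]) (use B_nonzero of_nat_0_le_iff in blast)

text \<open>A vector u from time - n - 1 is moved one step and then projected at time - n. The error
  is bounded by \<open>remainder'\<close>, whose Gelfand number belongs to the whole interval of
  length n + 1; by \<open>growth\<close> that is, up to K, a rate at which u itself has grown, so
  the error is small relative to v.\<close>

lemma pushed_next: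
  assumes n: "n \<ge> N"
  shows "near (C * M * K * \<tau> ^ n) (pushed x (Suc n)) (pushed x n)"
  unfolding near_def
proof
  fix v assume "v \<in> pushed x (Suc n)"
  let ?y = "\<phi> (- real n) x" and ?y' = "\<phi> (- real (Suc n)) x"
  obtain u where u: "v = B ?y' (real (Suc n)) u" "Q (Suc n) ?y' u = u"
    using \<open>v \<in> pushed x (Suc n)\<close> by (rule pushedE)
  have y: "?y = \<phi> 1 ?y'" and y': "?y' = \<phi> (- 1) ?y"
    using flow_add[of 1 "- real (Suc n)" x] flow_add[of "- 1" "- real n" x] by simp_all
  let ?z = "B ?y' 1 u"
  let ?w = "B ?y (real n) (Q n ?y ?z)"
  have v: "v = B ?y (real n) ?z" unfolding u(1) y using B_add_apply[of "real n" 1 ?y' u] by (simp add: add.commute)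
  have w: "?w \<in> pushed x n" by (rule pushedI) (rule rank_proj_idem[OF Q])
  have g: "gk ?y' (real n + 1) * norm u \<le> K * norm v"
    using range_bound[of "Suc n" ?y' u] u n by (simp add: add.commute)
  have "norm (v - ?w) = norm (B ?y (real n) (?z - Q n ?y ?z))" by (simp add: v blinfun.diff_right)
  also have "\<dots> \<le> C * \<tau> ^ n * gk ?y' (real n + 1) * norm ?z"
    using remainder'[OF n, of ?y ?z] unfolding y'[symmetric] .
  also have "\<dots> \<le> C * \<tau> ^ n * gk ?y' (real n + 1) * (M * norm u)"
    using MB[of 1 ?y' u] C tau_power[of n] gk_pos[of "real n + 1" ?y'] by (intro mult_left_mono) auto
  also have "\<dots> = C * M * \<tau> ^ n * (gk ?y' (real n + 1) * norm u)" by simp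
  also have "\<dots> \<le> C * M * \<tau> ^ n * (K * norm v)"
    using g C M1 tau_power[of n] by (intro mult_left_mono) auto
  finally show "\<exists>w\<in>pushed x n. norm (v - w) \<le> C * M * K * \<tau> ^ n * norm v" using w by (auto simp: mult_ac)
qed

definition fast :: "'x \<Rightarrow> 'v set" where
  "fast x = limit_space (pushed x)"

lemma near_fast:
  obtains D N1 where "0 < D" "N \<le> N1" "\<And>n x. n \<ge> N1 \<Longrightarrow> near (D * \<tau> ^ n) (fast x) (pushed x n)"
    "\<And>n x. n \<ge> N1 \<Longrightarrow> near (D * \<tau> ^ n) (pushed x n) (fast x)"
proof -
  define s where "s = C * M * K"
  have s: "0 < s" using K1 M1 C by (simp add: s_def)
  let ?q = "1 + 3 ^ k :: real"
  have "0 < ?q" by (intro add_pos_pos) simp_all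
  then have q0: "0 < 2 * ?q * s" using s by (intro mult_pos_pos) auto
  obtain N1 where N1: "N1 \<ge> N" "\<And>n. n \<ge> N1 \<Longrightarrow> ?q * s * \<tau> ^ n \<le> 1 / 2"
    using eventually_small[of "1 / 2" N "?q * s"] by auto
  \<comment> \<open>Only one direction has been estimated. Equal dimensions give the reverse one
    with an additional factor 2 \<open>?q\<close>, which is built into the constant.\<close>
  have cauchy: "near_cauchy (pushed x) N1 (2 * ?q * s) \<tau>" for x
  proof
    fix n
    show "subspace (pushed x n)" by (rule has_dim_subspace[OF has_dim_pushed])
    assume n: "n \<ge> N1"
    have s0: "0 \<le> s * \<tau> ^ n" using s tau_power[of n] by simp
    have *: "near (s * \<tau> ^ n) (pushed x (Suc n)) (pushed x n)"
      unfolding s_def by (rule pushed_next) (use n N1(1) in simp)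
    have "s * \<tau> ^ n * 1 \<le> s * \<tau> ^ n * (2 * ?q)" using s0 by (intro mult_left_mono) auto
    then show "near (2 * ?q * s * \<tau> ^ n) (pushed x (Suc n)) (pushed x n)"
      by (intro near_mono[OF *]) (simp add: mult_ac)
    have "?q * (s * \<tau> ^ n) \<le> 1 / 2" using N1(2)[OF n] by (simp add: mult.assoc)
    from near_sym_has_dim(1)[OF * has_dim_pushed has_dim_pushed s0 this]
    show "near (2 * ?q * s * \<tau> ^ n) (pushed x n) (pushed x (Suc n))" by (simp add: mult.assoc)
  qed (use q0 \<tau> in auto)
  show ?thesis
  proof (rule that[of "near_cauchy.rate (2 * ?q * s) \<tau>" N1])
    show "0 < near_cauchy.rate (2 * ?q * s) \<tau>" by (rule near_cauchy.rate_pos[OF cauchy])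
    show "near (near_cauchy.rate (2 * ?q * s) \<tau> * \<tau> ^ n) (fast x) (pushed x n)" if "n \<ge> N1" for n x
      unfolding fast_def using near_cauchy.limit_near[OF cauchy that] .
    show "near (near_cauchy.rate (2 * ?q * s) \<tau> * \<tau> ^ n) (pushed x n) (fast x)" if "n \<ge> N1" for n x
      unfolding fast_def using near_cauchy.near_limit[OF cauchy that] .
  qed (rule N1(1))
qed

lemma has_dim_fast: "has_dim (fast x) k"
proof -
  obtain D N1 where D: "0 < D" "N \<le> N1" "\<And>n x. n \<ge> N1 \<Longrightarrow> near (D * \<tau> ^ n) (fast x) (pushed x n)"
    "\<And>n x. n \<ge> N1 \<Longrightarrow> near (D * \<tau> ^ n) (pushed x n) (fast x)" by (rule near_fast) (rule that)
  obtain n where n: "n \<ge> N1" "(1 + 3 ^ k) * D * \<tau> ^ n \<le> 1 / 2"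
    using eventually_small[of "1 / 2" N1 "(1 + 3 ^ k) * D"] by auto
  have "subspace (fast x)"
    unfolding fast_def by (rule subspace_limit_space) (rule has_dim_subspace[OF has_dim_pushed])
  then show ?thesis
    using has_dim_near[OF has_dim_pushed _ D(3,4)[OF n(1)]] n D(1) tau_power[of n] by (simp add: mult.assoc)
qed

text \<open>The reference point in the past moves from \<phi> (- n) x to \<phi> (t - n) x. The
  vector is carried there by time t and projected. The interval in \<open>remainder'\<close> starts
  1 - t before \<phi> (- n) x, so \<open>gk_compare\<close> with the shift 1 - t bounds the error by
  the growth along the original interval.\<close>

lemma fast_forward:
  assumes "0 \<le> t" "v \<in> fast x"
  shows "B x t v \<in> fast (\<phi> t x)"
proof (rule extend_to_all_times[where S = fast])
  fix x :: 'x and t :: real and v :: 'v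
  assume t: "0 \<le> t" "t \<le> 1" and v: "v \<in> fast x"
  obtain D N1 where D: "0 < D" "N \<le> N1" "\<And>n x. n \<ge> N1 \<Longrightarrow> near (D * \<tau> ^ n) (fast x) (pushed x n)"
    by (rule near_fast) (rule that)
  have "\<forall>n\<ge>N1. \<exists>w. w \<in> pushed x n \<and> norm (v - w) \<le> D * \<tau> ^ n * norm v"
    using D(3) v unfolding near_def by blast
  then obtain w where w: "\<And>n. n \<ge> N1 \<Longrightarrow> w n \<in> pushed x n"
    "\<And>n. n \<ge> N1 \<Longrightarrow> norm (v - w n) \<le> D * \<tau> ^ n * norm v" by metis
  let ?y = "\<lambda>n. \<phi> (- real n) x" and ?y' = "\<lambda>n. \<phi> (- real n) (\<phi> t x)"
  have "\<forall>n. \<exists>u. n \<ge> N1 \<longrightarrow> w n = B (?y n) (real n) u \<and> Q n (?y n) u = u"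
    using pushedE[OF w(1)] by metis
  then obtain u where u: "\<And>n. n \<ge> N1 \<Longrightarrow> w n = B (?y n) (real n) (u n)"
    "\<And>n. n \<ge> N1 \<Longrightarrow> Q n (?y n) (u n) = u n" by metis
  define z where "z n = B (?y n) t (u n)" for n
  let ?c = "C * M * M * M * K"
  let ?r = "M * D * norm v + ?c * ((1 + D) * norm v)"
  have c: "0 \<le> ?c" using K1 C M1 by simp
  have est: "norm (B x t v - B (?y' n) (real n) (Q n (?y' n) (z n))) \<le> ?r * \<tau> ^ n" if n: "n \<ge> N1" for n
  proof -
    have nN: "n \<ge> N" using n D(2) by simp
    have "D * norm v * \<tau> ^ n \<le> D * norm v" using tau_power[of n] D(1) by (intro mult_left_le) auto
    moreover have "norm (w n) \<le> norm v + norm (v - w n)" by (metis norm_minus_commute norm_triangle_sub)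
    ultimately have wn: "norm (w n) \<le> (1 + D) * norm v" using w(2)[OF n] by (simp add: algebra_simps)
    have y': "?y' n = \<phi> t (?y n)"
      using flow_add[of "- real n" t x] flow_add[of t "- real n" x] by (simp add: add.commute)
    have yx: "\<phi> (real n) (?y n) = x" by (rule flow_inverse)
    have "B x t (w n) = B (?y n) (t + real n) (u n)"
      using u(1)[OF n] B_add_apply[of t "real n" "?y n"] t yx by simp
    also have "\<dots> = B (?y' n) (real n) (z n)"
      unfolding y' z_def using B_add_apply[of "real n" t "?y n"] t by (simp add: add.commute)
    finally have eq: "B x t (w n) = B (?y' n) (real n) (z n)" .
    have ret: "\<phi> (1 - t) (\<phi> (- 1) (?y' n)) = ?y n"
    proof -
      have "\<phi> (1 - t) (\<phi> (- 1) (\<phi> t (?y n))) = \<phi> ((1 - t) + (- 1 + t)) (?y n)"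
        by (simp only: flow_add)
      then show ?thesis by (simp add: y' flow_0)
    qed
    have "gk (\<phi> (- 1) (?y' n)) (real n + 1) \<le> M * M * gk (?y n) (real n)"
      using gk_compare[of "real n" "1 - t" "\<phi> (- 1) (?y' n)"] t unfolding ret by simp
    note g = this
    have "norm (B (?y' n) (real n) (z n - Q n (?y' n) (z n)))
        \<le> C * \<tau> ^ n * gk (\<phi> (- 1) (?y' n)) (real n + 1) * norm (z n)" by (rule remainder'[OF nN])
    also have "\<dots> \<le> C * \<tau> ^ n * (M * M * gk (?y n) (real n)) * (M * norm (u n))"
      using g MB[OF t, of "?y n" "u n"] C M1 tau_power[of n] gk_pos[of "real n + 1" "\<phi> (- 1) (?y' n)"]
        gk_pos[of "real n" "?y n"]
      unfolding z_def by (intro mult_mono mult_nonneg_nonneg) auto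
    also have "\<dots> = C * M * M * M * \<tau> ^ n * (gk (?y n) (real n) * norm (u n))" by simp
    also have "\<dots> \<le> C * M * M * M * \<tau> ^ n * (K * norm (w n))"
      using range_bound[OF nN u(2)[OF n]] u(1)[OF n] C M1 tau_power[of n] by (intro mult_left_mono) auto
    also have "\<dots> = ?c * \<tau> ^ n * norm (w n)" by simp
    also have "\<dots> \<le> ?c * \<tau> ^ n * ((1 + D) * norm v)"
      using wn c tau_power[of n] by (intro mult_left_mono) auto
    finally have rem: "norm (B x t (w n) - B (?y' n) (real n) (Q n (?y' n) (z n)))
      \<le> ?c * \<tau> ^ n * ((1 + D) * norm v)" unfolding eq by (simp add: blinfun.diff_right)
    have "norm (B x t (v - w n)) \<le> M * norm (v - w n)" using MB t by blast
    also have "\<dots> \<le> M * (D * \<tau> ^ n * norm v)" using w(2)[OF n] M1 by (intro mult_left_mono) auto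
    finally have "norm (B x t v - B x t (w n)) \<le> M * (D * \<tau> ^ n * norm v)" by (simp add: blinfun.diff_right)
    moreover have "norm (B x t v - B (?y' n) (real n) (Q n (?y' n) (z n)))
        \<le> norm (B x t v - B x t (w n)) + norm (B x t (w n) - B (?y' n) (real n) (Q n (?y' n) (z n)))"
      using norm_triangle_ineq[of "B x t v - B x t (w n)" "B x t (w n) - B (?y' n) (real n) (Q n (?y' n) (z n))"] by simp
    ultimately have "norm (B x t v - B (?y' n) (real n) (Q n (?y' n) (z n)))
        \<le> M * (D * \<tau> ^ n * norm v) + ?c * \<tau> ^ n * ((1 + D) * norm v)" using rem by linarith
    also have "\<dots> = ?r * \<tau> ^ n" by (simp add: algebra_simps)
    finally show ?thesis .
  qed
  show "B x t v \<in> fast (\<phi> t x)"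
    unfolding fast_def
  proof (rule limit_spaceI[of _ N1 "\<lambda>n. B (?y' n) (real n) (Q n (?y' n) (z n))" _ "\<lambda>n. ?r * \<tau> ^ n"])
    show "(\<lambda>n. ?r * \<tau> ^ n) \<longlonglongrightarrow> 0"
      using \<tau> by (intro tendsto_mult_right_zero LIMSEQ_power_zero) auto
    show "B (?y' n) (real n) (Q n (?y' n) (z n)) \<in> pushed (\<phi> t x) n" for n
      by (rule pushedI) (rule rank_proj_idem[OF Q])
    show "subspace (pushed (\<phi> t x) n)" for n by (rule has_dim_subspace[OF has_dim_pushed])
  qed (use est in auto)
qed (use assms in auto)

text \<open>Equality instead of inclusion, because B x t is injective and both spaces have dimension
  k.\<close>

lemma fast_invariant: "0 \<le> t \<Longrightarrow> B x t ` fast x = fast (\<phi> t x)"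
  using fast_forward B_nonzero
  by (intro has_dim_image_eq[OF has_dim_fast has_dim_fast linear_B]) blast+

section \<open>Continuity of the two families of subspaces\<close>

lemma continuous_if_near:
  fixes S :: "'x \<Rightarrow> 'v set"
  assumes sub: "\<And>x. S x \<in> grassmannian"
    and close: "\<And>x0 n. n \<ge> n0 \<Longrightarrow> \<exists>U. open U \<and> x0 \<in> U \<and>
      (\<forall>x\<in>U. near (c * \<tau> ^ n) (S x0) (S x) \<and> near (c * \<tau> ^ n) (S x) (S x0))"
    and c: "0 \<le> c"
  shows "continuous_map euclidean grassmann.mtopology S"
  unfolding grassmann.continuous_map_to_metric
proof (intro ballI allI impI)
  fix x0 and e :: real assume e: "0 < e"
  obtain n where n: "n \<ge> n0" "c * \<tau> ^ n \<le> min (1 / 2) (e / 4)"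
    using eventually_small[of "min (1 / 2) (e / 4)" n0 c] e by auto
  from close[OF n(1), of x0] obtain U where U: "open U" "x0 \<in> U"
    "\<forall>x\<in>U. near (c * \<tau> ^ n) (S x0) (S x) \<and> near (c * \<tau> ^ n) (S x) (S x0)"
    by (elim exE conjE)
  have sS: "subspace (S x)" for x using sub by (simp add: grassmannian_def)
  have "grassmann_dist (S x0) (S x) < e" if x: "x \<in> U" for x
  proof -
    have "grassmann_dist (S x0) (S x) \<le> 2 * (c * \<tau> ^ n)"
      using bspec[OF U(3) x] sS c tau_power[of n] n by (intro grassmann_dist_le_near) auto
    then show ?thesis using n e by simp
  qed
  then show "\<exists>U. openin euclidean U \<and> x0 \<in> U \<and> (\<forall>y\<in>U. S y \<in> grassmann.mball (S x0) e)"
    using U sub by (intro exI[of _ U]) auto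
qed

lemma near_sandwich:
  assumes "near a S W" "near a W W'" "near a W' S'" "0 \<le> a" "a \<le> 1 / 3"
  shows "near (9 * a) S S'"
proof -
  have "near (3 * a) S W'" by (rule near_trans3[OF assms(1,2)]) (use assms in auto)
  moreover have "near (3 * a) W' S'" by (rule near_mono[OF assms(3)]) (use assms in auto)
  ultimately have "near (3 * (3 * a)) S S'" by (rule near_trans3) (use assms in auto)
  then show ?thesis by simp
qed

text \<open>The limit spaces are compared through the kernels at one large time n, uniformly near to
  them. At that time the operator depends continuously on x in norm; the tolerance is \<tau>^n times
  a uniform lower bound of the Gelfand numbers.\<close>

lemma continuous_slow: "continuous_map euclidean grassmann.mtopology slow"
proof -
  obtain D N1 where D: "0 < D" "N \<le> N1" "\<And>n x. n \<ge> N1 \<Longrightarrow> near (D * \<tau> ^ n) (slow x) (kerQ x n)"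
    "\<And>n x. n \<ge> N1 \<Longrightarrow> near (D * \<tau> ^ n) (kerQ x n) (slow x)" by (rule near_slow) (rule that)
  let ?c = "K * (3 * C * M + 1)"
  let ?d = "max D ?c"
  have d: "0 \<le> ?d" using D(1) by simp
  obtain N2 where N2: "N2 \<ge> N1" "\<And>n. n \<ge> N2 \<Longrightarrow> ?d * \<tau> ^ n \<le> 1 / 3"
    using eventually_small[of "1 / 3" N1 ?d] by auto
  show ?thesis
  proof (rule continuous_if_near[of _ N2 "9 * ?d"])
    show "slow x \<in> grassmannian" for x using subspace_slow closed_slow by (simp add: grassmannian_def)
    fix x0 n assume n: "n \<ge> N2"
    have nN: "n \<ge> N" and nN1: "n \<ge> N1" using n N2 D(2) by auto
    obtain g where g: "0 < g" "\<And>x. g \<le> gk x (real n)" by (rule gk_lower[of "real n"]) auto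
    have "0 < \<tau> ^ n * g" using g tau_power by simp
    then obtain U where U: "open U" "x0 \<in> U" "\<And>x. x \<in> U \<Longrightarrow> norm (B x (real n) - B x0 (real n)) < \<tau> ^ n * g"
      by (rule close_B[of "real n" "\<tau> ^ n * g" x0, rotated]) auto
    \<comment> \<open>Stated for any two points with close operators, so that it serves both
      directions.\<close>
    have ker: "near (?d * \<tau> ^ n) (kerQ x n) (kerQ y n)"
      if xy: "norm (B y (real n) - B x (real n)) \<le> \<tau> ^ n * g" for x y
      unfolding near_def
    proof
      fix v assume "v \<in> kerQ x n"
      then have v: "Q n x v = 0" by simp
      have "\<tau> ^ n * g \<le> 1 * gk y (real n)" using tau_power[of n] g by (intro mult_mono) auto
      then have gxy: "gk x (real n) \<le> 2 * gk y (real n)"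
        using gk_lipschitz[of x "real n" y] xy by (simp add: norm_minus_commute)
      have "norm (B y (real n) v) \<le> norm (B x (real n) v) + norm ((B y (real n) - B x (real n)) v)"
        by (simp add: blinfun.diff_left norm_triangle_sub)
      also have "\<dots> \<le> C * M * \<tau> ^ n * norm v * gk x (real n) + \<tau> ^ n * g * norm v"
        using ker_small[OF nN v] norm_blinfun[of "B y (real n) - B x (real n)" v] mult_right_mono[OF xy norm_ge_zero[of v]]
        by linarith
      also have "\<dots> \<le> C * M * \<tau> ^ n * norm v * (2 * gk y (real n)) + \<tau> ^ n * gk y (real n) * norm v"
        using gxy g C M1 tau_power[of n] by (intro add_mono mult_left_mono mult_right_mono) auto
      finally have "norm (B y (real n) v) \<le> ((2 * C * M + 1) * \<tau> ^ n * norm v) * gk y (real n)"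
        by (simp add: algebra_simps)
      from Q_small[OF nN this] have "norm (Q n y v) \<le> ?c * \<tau> ^ n * norm v" by (simp add: algebra_simps)
      also have "\<dots> \<le> ?d * \<tau> ^ n * norm v" using tau_power[of n] by (intro mult_right_mono) auto
      finally show "\<exists>w\<in>kerQ y n. norm (v - w) \<le> ?d * \<tau> ^ n * norm v"
        using rank_proj_ker[OF Q] by (intro bexI[of _ "v - Q n y v"]) auto
    qed
    have dD: "D * \<tau> ^ n \<le> ?d * \<tau> ^ n" using tau_power[of n] by (intro mult_right_mono) auto
    have sl: "near (?d * \<tau> ^ n) (slow x) (kerQ x n)" "near (?d * \<tau> ^ n) (kerQ x n) (slow x)" for x
      by (rule near_mono[OF D(3)[OF nN1] dD], rule near_mono[OF D(4)[OF nN1] dD])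
    have "near (9 * (?d * \<tau> ^ n)) (slow x0) (slow x) \<and> near (9 * (?d * \<tau> ^ n)) (slow x) (slow x0)"
      if x: "x \<in> U" for x
      using U(3)[OF x] near_sandwich[OF sl(1) ker sl(2)] N2(2)[OF n] d tau_power[of n]
      by (simp add: norm_minus_commute)
    then show "\<exists>U. open U \<and> x0 \<in> U \<and>
      (\<forall>x\<in>U. near (9 * ?d * \<tau> ^ n) (slow x0) (slow x) \<and> near (9 * ?d * \<tau> ^ n) (slow x) (slow x0))"
      using U(1,2) by (intro exI[of _ U]) (simp add: mult.assoc)
  qed (use d in simp)
qed

text \<open>As for the kernels, except that the operators belong to the points \<phi> (- n) x; the
  neighbourhood is pulled back by the continuous map \<phi> (- n).\<close>

lemma continuous_fast: "continuous_map euclidean grassmann.mtopology fast"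
proof -
  obtain D N1 where D: "0 < D" "N \<le> N1" "\<And>n x. n \<ge> N1 \<Longrightarrow> near (D * \<tau> ^ n) (fast x) (pushed x n)"
    "\<And>n x. n \<ge> N1 \<Longrightarrow> near (D * \<tau> ^ n) (pushed x n) (fast x)" by (rule near_fast) (rule that)
  let ?c = "K * (2 * C * M + 1)"
  let ?d = "max D ?c"
  have d: "0 \<le> ?d" using D(1) by simp
  obtain N2 where N2: "N2 \<ge> N1" "\<And>n. n \<ge> N2 \<Longrightarrow> ?d * \<tau> ^ n \<le> 1 / 3"
    using eventually_small[of "1 / 3" N1 ?d] by auto
  show ?thesis
  proof (rule continuous_if_near[of _ N2 "9 * ?d"])
    show "fast x \<in> grassmannian" for x
      by (simp add: grassmannian_def has_dim_subspace[OF has_dim_fast] has_dim_closed[OF has_dim_fast])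
    fix x0 n assume n: "n \<ge> N2"
    have nN: "n \<ge> N" and nN1: "n \<ge> N1" using n N2 D(2) by auto
    let ?p = "\<phi> (- real n)"
    obtain g where g: "0 < g" "\<And>x. g \<le> gk x (real n)" by (rule gk_lower[of "real n"]) auto
    have "0 < \<tau> ^ n * g" using g tau_power by simp
    then obtain U where U: "open U" "?p x0 \<in> U" "\<And>x. x \<in> U \<Longrightarrow> norm (B x (real n) - B (?p x0) (real n)) < \<tau> ^ n * g"
      by (rule close_B[of "real n" "\<tau> ^ n * g" "?p x0", rotated]) auto
    have push: "near (?d * \<tau> ^ n) (pushed x n) (pushed y n)"
      if xy: "norm (B (?p y) (real n) - B (?p x) (real n)) \<le> \<tau> ^ n * g" for x y
      unfolding near_def
    proof
      fix v assume "v \<in> pushed x n"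
      then obtain u where u: "v = B (?p x) (real n) u" "Q n (?p x) u = u" by (rule pushedE)
      let ?w = "B (?p y) (real n) (Q n (?p y) u)"
      have "\<tau> ^ n * g \<le> 1 * gk (?p x) (real n)" using tau_power[of n] g by (intro mult_mono) auto
      then have gxy: "gk (?p y) (real n) \<le> 2 * gk (?p x) (real n)"
        using gk_lipschitz[of "?p y" "real n" "?p x"] xy by simp
      have "v - ?w = (B (?p x) (real n) - B (?p y) (real n)) u + B (?p y) (real n) (u - Q n (?p y) u)"
        by (simp add: u(1) blinfun.diff_left blinfun.diff_right)
      then have "norm (v - ?w) \<le> norm ((B (?p x) (real n) - B (?p y) (real n)) u) + norm (B (?p y) (real n) (u - Q n (?p y) u))"
        by (metis norm_triangle_ineq)
      also have "\<dots> \<le> \<tau> ^ n * g * norm u + C * M * \<tau> ^ n * gk (?p y) (real n) * norm u"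
        using remainder_le[OF nN, of "?p y" u] norm_blinfun[of "B (?p x) (real n) - B (?p y) (real n)" u]
          mult_right_mono[OF xy, of "norm u"] by (simp add: norm_minus_commute)
      also have "\<dots> \<le> \<tau> ^ n * gk (?p x) (real n) * norm u + C * M * \<tau> ^ n * (2 * gk (?p x) (real n)) * norm u"
        using gxy g C M1 tau_power[of n] by (intro add_mono mult_left_mono mult_right_mono) auto
      also have "\<dots> = (2 * C * M + 1) * \<tau> ^ n * (gk (?p x) (real n) * norm u)" by (simp add: algebra_simps)
      also have "\<dots> \<le> (2 * C * M + 1) * \<tau> ^ n * (K * norm v)"
        using range_bound[OF nN u(2)] u(1) C M1 tau_power[of n] by (intro mult_left_mono) auto
      also have "\<dots> = ?c * \<tau> ^ n * norm v" by simp
      also have "\<dots> \<le> ?d * \<tau> ^ n * norm v" using tau_power[of n] by (intro mult_right_mono) auto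
      finally have "norm (v - ?w) \<le> ?d * \<tau> ^ n * norm v" .
      moreover have "?w \<in> pushed y n" by (rule pushedI) (rule rank_proj_idem[OF Q])
      ultimately show "\<exists>w\<in>pushed y n. norm (v - w) \<le> ?d * \<tau> ^ n * norm v" by blast
    qed
    have dD: "D * \<tau> ^ n \<le> ?d * \<tau> ^ n" using tau_power[of n] by (intro mult_right_mono) auto
    have fa: "near (?d * \<tau> ^ n) (fast x) (pushed x n)" "near (?d * \<tau> ^ n) (pushed x n) (fast x)" for x
      by (rule near_mono[OF D(3)[OF nN1] dD], rule near_mono[OF D(4)[OF nN1] dD])
    have "near (9 * (?d * \<tau> ^ n)) (fast x0) (fast x) \<and> near (9 * (?d * \<tau> ^ n)) (fast x) (fast x0)"
      if x: "?p x \<in> U" for x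
      using U(3)[OF x] near_sandwich[OF fa(1) push fa(2)] N2(2)[OF n] d tau_power[of n]
      by (simp add: norm_minus_commute)
    moreover have "open (?p -` U)" using U(1) continuous_flow_map by (intro open_vimage)
    ultimately show "\<exists>U. open U \<and> x0 \<in> U \<and>
      (\<forall>x\<in>U. near (9 * ?d * \<tau> ^ n) (fast x0) (fast x) \<and> near (9 * ?d * \<tau> ^ n) (fast x) (fast x0))"
      using U(2) by (intro exI[of _ "?p -` U"]) (simp add: mult.assoc)
  qed (use d in simp)
qed

end

subsection \<open>Determinants and volume comparison\<close>

definition kdet :: "nat \<Rightarrow> (nat \<Rightarrow> nat \<Rightarrow> real) \<Rightarrow> real" where
  "kdet k A = Determinant.det (Matrix.mat k k (\<lambda>(i, j). A i j))"

lemma kdet_expand: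
  "kdet k A = (\<Sum>p | p permutes {0..<k}. signof p * (\<Prod>i=0..<k. A i (p i)))"
proof -
  have "(\<Prod>i=0..<k. Matrix.mat k k (\<lambda>(i, j). A i j) $$ (i, p i)) = (\<Prod>i=0..<k. A i (p i))"
    if "p permutes {0..<k}" for p
    using that by (intro prod.cong) (auto dest: permutes_in_image)
  then show ?thesis
    unfolding kdet_def by (subst det_def'[of _ k]) (auto intro!: sum.cong)
qed

lemma kdet_cong:
  assumes "\<And>i j. i < k \<Longrightarrow> j < k \<Longrightarrow> A i j = A' i j"
  shows "kdet k A = kdet k A'"
proof -
  have "Matrix.mat k k (\<lambda>(i, j). A i j) = Matrix.mat k k (\<lambda>(i, j). A' i j)"
    by (rule eq_matI) (use assms in auto)
  then show ?thesis by (simp add: kdet_def)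
qed

lemma kdet_mult: "kdet k (\<lambda>i j. \<Sum>l<k. A i l * A' l j) = kdet k A * kdet k A'"
proof -
  have "Matrix.mat k k (\<lambda>(i, j). \<Sum>l<k. A i l * A' l j)
      = Matrix.mat k k (\<lambda>(i, j). A i j) * Matrix.mat k k (\<lambda>(i, j). A' i j)"
    by (rule eq_matI) (auto simp: scalar_prod_def atLeast0LessThan)
  then show ?thesis by (simp add: kdet_def det_mult[of _ k])
qed

lemma kdet_nonzero:
  assumes "\<And>c. (\<And>i. i < k \<Longrightarrow> (\<Sum>j<k. A i j * c j) = 0) \<Longrightarrow> \<forall>j<k. c j = 0"
  shows "kdet k A \<noteq> 0"
proof
  let ?A = "Matrix.mat k k (\<lambda>(i, j). A i j)"
  assume "kdet k A = 0"
  then obtain v where v: "v \<in> carrier_vec k" "v \<noteq> 0\<^sub>v k" "?A *\<^sub>v v = 0\<^sub>v k"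
    using det_0_iff_vec_prod_zero_field[of ?A k] by (auto simp: kdet_def)
  have "(\<Sum>j<k. A i j * vec_index v j) = 0" if i: "i < k" for i
  proof -
    have "vec_index (?A *\<^sub>v v) i = (\<Sum>j<k. A i j * vec_index v j)"
      using i v(1) by (auto simp: scalar_prod_def atLeast0LessThan intro!: sum.cong)
    then show ?thesis using v(3) i by simp
  qed
  then have "\<forall>j<k. vec_index v j = 0" by (rule assms)
  then have "v = 0\<^sub>v k" using v(1) by (intro eq_vecI) auto
  then show False using v(2) by simp
qed

lemma abs_sum_permutes_le:
  assumes "\<And>p. p permutes {0..<k} \<Longrightarrow> \<bar>f p\<bar> \<le> (c :: real)"
  shows "\<bar>\<Sum>p | p permutes {0..<k}. signof p * f p\<bar> \<le> fact k * c"
proof -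
  have "\<bar>\<Sum>p | p permutes {0..<k}. signof p * f p\<bar> \<le> (\<Sum>p | p permutes {0..<k}. \<bar>signof p * f p\<bar>)"
    by (rule sum_abs)
  also have "\<dots> \<le> (\<Sum>p | p permutes {0..<k}. c)"
    using assms by (intro sum_mono) (auto simp: abs_mult sign_def)
  also have "\<dots> = fact k * c" by (simp add: card_permutations)
  finally show ?thesis .
qed

text \<open>The Leibniz expansions are compared term by term. The entries are at most 1 + e <= 2;
  halving them makes them at most 1, as needed to bound a difference of products by the sum of the
  differences, and costs the factor 2^k.\<close>

lemma kdet_near_identity:
  assumes A: "\<And>i j. i < k \<Longrightarrow> j < k \<Longrightarrow> \<bar>A i j - (if i = j then 1 else 0)\<bar> \<le> e" and e: "0 \<le> e" "e \<le> 1"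
  shows "\<bar>kdet k A - 1\<bar> \<le> fact k * (2 ^ k * (real k * e))"
proof -
  let ?I = "\<lambda>i j. if i = j then 1 else 0 :: real"
  have "Matrix.mat k k (\<lambda>(i, j). ?I i j) = 1\<^sub>m k" by (rule eq_matI) auto
  then have I: "kdet k ?I = 1" by (simp add: kdet_def)
  have "\<bar>(\<Prod>i=0..<k. A i (p i)) - (\<Prod>i=0..<k. ?I i (p i))\<bar> \<le> 2 ^ k * (real k * e)"
    if p: "p permutes {0..<k}" for p
  proof -
    have pk: "p i < k" if "i < k" for i using permutes_in_image[OF p, of i] that by simp
    have "norm ((\<Prod>i=0..<k. A i (p i) / 2) - (\<Prod>i=0..<k. ?I i (p i) / 2))
      \<le> (\<Sum>i=0..<k. norm (A i (p i) / 2 - ?I i (p i) / 2))"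
    proof (rule norm_prod_diff)
      fix i assume "i \<in> {0..<k}"
      then show "norm (A i (p i) / 2) \<le> 1" using A[of i "p i"] pk[of i] e by (auto split: if_splits)
    qed auto
    also have "\<dots> \<le> (\<Sum>i=0..<k. e)"
    proof (rule sum_mono)
      fix i assume "i \<in> {0..<k}"
      then have *: "\<bar>A i (p i) - ?I i (p i)\<bar> \<le> e" using A[of i "p i"] pk[of i] by simp
      have "norm (A i (p i) / 2 - ?I i (p i) / 2) = \<bar>A i (p i) - ?I i (p i)\<bar> / 2"
        by (simp only: diff_divide_distrib[symmetric] real_norm_def abs_divide abs_numeral)
      also have "\<dots> \<le> \<bar>A i (p i) - ?I i (p i)\<bar>" by simp
      finally show "norm (A i (p i) / 2 - ?I i (p i) / 2) \<le> e" using * by (rule order_trans)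
    qed
    finally have "\<bar>(\<Prod>i=0..<k. A i (p i)) / 2 ^ k - (\<Prod>i=0..<k. ?I i (p i)) / 2 ^ k\<bar> \<le> real k * e"
      by (simp add: prod_dividef)
    then have "\<bar>(\<Prod>i=0..<k. A i (p i)) - (\<Prod>i=0..<k. ?I i (p i))\<bar> / 2 ^ k \<le> real k * e"
      by (simp only: diff_divide_distrib[symmetric] abs_divide) simp
    then show ?thesis by (simp add: field_simps)
  qed
  then have "\<bar>\<Sum>p | p permutes {0..<k}. signof p * ((\<Prod>i=0..<k. A i (p i)) - (\<Prod>i=0..<k. ?I i (p i)))\<bar>
      \<le> fact k * (2 ^ k * (real k * e))" by (rule abs_sum_permutes_le)
  then have "\<bar>kdet k A - kdet k ?I\<bar> \<le> fact k * (2 ^ k * (real k * e))"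
    unfolding kdet_expand by (simp only: right_diff_distrib sum_subtractf)
  then show ?thesis by (simp only: I)
qed

text \<open>Every term of the Leibniz expansion has exactly one factor from column j.\<close>

lemma kdet_small_column:
  assumes S: "\<And>i j. i < k \<Longrightarrow> j < k \<Longrightarrow> \<bar>S i j\<bar> \<le> R" and j: "j < k" "\<And>i. i < k \<Longrightarrow> \<bar>S i j\<bar> \<le> s"
  shows "\<bar>kdet k S\<bar> \<le> fact k * (R ^ (k - 1) * s)"
  unfolding kdet_expand
proof (rule abs_sum_permutes_le)
  fix p assume p: "p permutes {0..<k}"
  obtain i where i: "i < k" "p i = j" using permutes_image[OF p] j(1) by (metis atLeast0LessThan imageE lessThan_iff)
  have pk: "p i < k" if "i < k" for i using permutes_in_image[OF p, of i] that by simp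
  have "\<bar>\<Prod>i=0..<k. S i (p i)\<bar> = (\<Prod>i=0..<k. \<bar>S i (p i)\<bar>)" by (rule abs_prod)
  also have "\<dots> = \<bar>S i (p i)\<bar> * (\<Prod>i\<in>{0..<k} - {i}. \<bar>S i (p i)\<bar>)" by (rule prod.remove) (use i in auto)
  also have "\<dots> \<le> s * (\<Prod>i\<in>{0..<k} - {i}. R)"
    using i j(2)[OF i(1)] S pk by (intro mult_mono prod_mono prod_nonneg) auto
  also have "\<dots> = R ^ (k - 1) * s" using i by simp
  finally show "\<bar>\<Prod>i=0..<k. S i (p i)\<bar> \<le> R ^ (k - 1) * s" .
qed

lemma exp_le_one_minus:
  fixes y :: real
  assumes "0 \<le> y" "y \<le> 1 / 2"
  shows "exp (- (2 * y)) \<le> 1 - y"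
proof -
  have "0 \<le> y * (1 - 2 * y)" using assms by (intro mult_nonneg_nonneg) auto
  then have "1 \<le> (1 - y) * (1 + 2 * y)" by (simp add: algebra_simps)
  also have "\<dots> \<le> (1 - y) * exp (2 * y)" using assms exp_ge_add_one_self[of "2 * y"] by (intro mult_left_mono) auto
  finally have "exp (- (2 * y)) * 1 \<le> exp (- (2 * y)) * ((1 - y) * exp (2 * y))" by (intro mult_left_mono) auto
  also have "\<dots> = 1 - y" by (simp add: exp_minus)
  finally show ?thesis by simp
qed

text \<open>Since 1 - y >= exp (- 2 y), the product of the factors is bounded below by the
  exponential of a geometric sum. The induction carries the exact partial sum, with \<tau>^m -
  \<tau>^n, because the cruder final bound would not reproduce itself.\<close>

lemma bounded_away_if_summable_loss:
  fixes d :: "nat \<Rightarrow> real"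
  assumes step: "\<And>n. n \<ge> m \<Longrightarrow> (1 - c * \<tau> ^ n) * d n \<le> d (Suc n)"
    and small: "\<And>n. n \<ge> m \<Longrightarrow> c * \<tau> ^ n \<le> 1 / 2"
    and c: "0 \<le> c" "0 < \<tau>" "\<tau> < 1" and pos: "0 < d m"
  obtains \<delta> where "0 < \<delta>" "\<And>n. n \<ge> m \<Longrightarrow> \<delta> \<le> d n"
proof -
  have lower: "d m * exp (- (2 * c * (\<tau> ^ m - \<tau> ^ n) / (1 - \<tau>))) \<le> d n" if "n \<ge> m" for n
    using that
  proof (induction n rule: dec_induct)
    case (step n)
    have dn: "0 < d n" by (rule less_le_trans[OF _ step.IH]) (use pos in simp)
    have eq: "2 * c * (\<tau> ^ m - \<tau> ^ Suc n) / (1 - \<tau>) = 2 * c * (\<tau> ^ m - \<tau> ^ n) / (1 - \<tau>) + 2 * (c * \<tau> ^ n)"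
      using c by (simp add: field_simps)
    have "d m * exp (- (2 * c * (\<tau> ^ m - \<tau> ^ Suc n) / (1 - \<tau>)))
      = d m * exp (- (2 * c * (\<tau> ^ m - \<tau> ^ n) / (1 - \<tau>))) * exp (- (2 * (c * \<tau> ^ n)))"
      unfolding eq by (simp add: exp_add[symmetric])
    also have "\<dots> \<le> d n * exp (- (2 * (c * \<tau> ^ n)))" using step.IH by (intro mult_right_mono) auto
    also have "\<dots> \<le> d n * (1 - c * \<tau> ^ n)"
      using dn c small[of n] step.hyps by (intro mult_left_mono exp_le_one_minus) auto
    also have "\<dots> \<le> d (Suc n)" using assms(1)[of n] step.hyps by (simp add: mult.commute)
    finally show ?case .
  qed simp
  show ?thesis
  proof (rule that[of "d m * exp (- (2 * c * \<tau> ^ m / (1 - \<tau>)))"])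
    fix n assume n: "n \<ge> m"
    have "2 * c * (\<tau> ^ m - \<tau> ^ n) / (1 - \<tau>) \<le> 2 * c * \<tau> ^ m / (1 - \<tau>)"
      using c by (intro divide_right_mono mult_left_mono) auto
    then have "d m * exp (- (2 * c * \<tau> ^ m / (1 - \<tau>))) \<le> d m * exp (- (2 * c * (\<tau> ^ m - \<tau> ^ n) / (1 - \<tau>)))"
      using pos by (intro mult_left_mono) auto
    then show "d m * exp (- (2 * c * \<tau> ^ m / (1 - \<tau>))) \<le> d n" using lower[OF n] by linarith
  qed (use pos in simp)
qed

text \<open>The determinant of \<open>(A n | U)\<inverse> \<circ> \<theta>\<^sub>n \<circ> A n | E\<close>, where \<open>\<theta>\<^sub>n\<close> projects onto \<open>A n ` U\<close>, changes in each
  step only by the determinant of a map that is exponentially close to the identity, since conjugation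
  by \<open>A n | U\<close> does not affect determinants. Hence it cannot tend to \<open>0\<close>.\<close>

lemma no_collapse:
  fixes A L :: "nat \<Rightarrow> 'v::real_normed_vector \<Rightarrow>\<^sub>L 'v"
  assumes U: "has_dim U k" and E: "has_dim E k"
    and A: "\<And>n v. A (Suc n) v = L n (A n v)" and inj: "\<And>n v. A n v = 0 \<Longrightarrow> v = 0"
    and near: "\<And>n. n \<ge> m \<Longrightarrow> near (s * \<tau> ^ n) (A n ` E) (A n ` U)"
    and s: "0 \<le> s" "0 < \<tau>" "\<tau> < 1" "\<And>n. n \<ge> m \<Longrightarrow> (1 + 3 ^ k) * (s * \<tau> ^ n) \<le> 1 / 2"
    and L: "\<And>n v. norm (L n v) \<le> M * norm v" "0 \<le> M"
    and low: "\<And>n b. n \<ge> m \<Longrightarrow> b \<in> A n ` U \<Longrightarrow> \<eta> * norm b \<le> norm (L n b)" "0 < \<eta>"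
    and bounded: "\<And>n u v \<theta>. n \<ge> m \<Longrightarrow> v \<in> E \<Longrightarrow> u \<in> U \<Longrightarrow> rank_proj k (3 ^ k) \<theta> \<Longrightarrow> range \<theta> = A n ` U
      \<Longrightarrow> A n u = \<theta> (A n v) \<Longrightarrow> norm u \<le> R * norm v"
    and w: "w \<in> E" "w \<noteq> 0"
    and collapse: "\<And>n u \<theta>. n \<ge> m \<Longrightarrow> u \<in> U \<Longrightarrow> rank_proj k (3 ^ k) \<theta> \<Longrightarrow> range \<theta> = A n ` U
      \<Longrightarrow> A n u = \<theta> (A n w) \<Longrightarrow> norm u \<le> R * \<tau> ^ n"
  shows False
proof -
  have lin: "linear (blinfun_apply (A n))" "linear (blinfun_apply (L n))" for n
    using blinfun.bounded_linear_right bounded_linear.linear by blast+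
  have dU: "has_dim (A n ` U) k" and dE: "has_dim (A n ` E) k" for n
    by (rule has_dim_image[OF U lin(1)], erule inj) (rule has_dim_image[OF E lin(1)], erule inj)
  have "\<forall>n. \<exists>bl. biorthogonal k (fst bl) (snd bl) \<and> (\<forall>i<k. fst bl i \<in> A n ` U \<and> norm (fst bl i) = 1 \<and>
      (\<forall>v. \<bar>blinfun_apply (snd bl i) v\<bar> \<le> 3 ^ k * norm v)) \<and>
      rank_proj k (3 ^ k) (biorth_proj k (fst bl) (snd bl)) \<and> range (biorth_proj k (fst bl) (snd bl)) = A n ` U"
  proof
    fix n
    show "\<exists>bl. biorthogonal k (fst bl) (snd bl) \<and> (\<forall>i<k. fst bl i \<in> A n ` U \<and> norm (fst bl i) = 1 \<and>
      (\<forall>v. \<bar>blinfun_apply (snd bl i) v\<bar> \<le> 3 ^ k * norm v)) \<and>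
      rank_proj k (3 ^ k) (biorth_proj k (fst bl) (snd bl)) \<and> range (biorth_proj k (fst bl) (snd bl)) = A n ` U"
    proof -
      obtain b l where "biorthogonal k b l" "\<And>i. i < k \<Longrightarrow> b i \<in> A n ` U" "\<And>i. i < k \<Longrightarrow> norm (b i) = 1"
        "\<And>i v. i < k \<Longrightarrow> \<bar>blinfun_apply (l i) v\<bar> \<le> 3 ^ k * norm v"
        "rank_proj k (3 ^ k) (biorth_proj k b l)" "range (biorth_proj k b l) = A n ` U"
        by (rule biorthogonal_on[OF dU[of n]]) (rule that)
      then show ?thesis by (intro exI[of _ "(b, l)"]) simp
    qed
  qed
  then obtain bl where bl: "\<And>n. biorthogonal k (fst (bl n)) (snd (bl n)) \<and>
      (\<forall>i<k. fst (bl n) i \<in> A n ` U \<and> norm (fst (bl n) i) = 1 \<and>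
      (\<forall>v. \<bar>blinfun_apply (snd (bl n) i) v\<bar> \<le> 3 ^ k * norm v)) \<and>
      rank_proj k (3 ^ k) (biorth_proj k (fst (bl n)) (snd (bl n))) \<and>
      range (biorth_proj k (fst (bl n)) (snd (bl n))) = A n ` U"
    by (auto simp only: choice_iff)
  define b where "b n = fst (bl n)" for n
  define l where "l n = snd (bl n)" for n
  define \<theta> where "\<theta> n = biorth_proj k (b n) (l n)" for n
  have bi: "biorthogonal k (b n) (l n)" and bW: "i < k \<Longrightarrow> b n i \<in> A n ` U" and b1: "i < k \<Longrightarrow> norm (b n i) = 1"
    and lb: "i < k \<Longrightarrow> \<bar>blinfun_apply (l n i) v\<bar> \<le> 3 ^ k * norm v"
    and \<theta>: "rank_proj k (3 ^ k) (\<theta> n)" "range (\<theta> n) = A n ` U" for n i v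
    using bl[of n] unfolding b_def l_def \<theta>_def by simp_all
  have \<theta>_expand: "\<theta> n v = (\<Sum>i<k. blinfun_apply (l n i) v *\<^sub>R b n i)" for n v
    by (simp add: \<theta>_def biorth_proj_def)
  have \<theta>_fix: "v \<in> A n ` U \<Longrightarrow> \<theta> n v = v" for n v using rank_proj_range_iff[OF \<theta>(1)] \<theta>(2) by blast
  have l\<theta>: "i < k \<Longrightarrow> blinfun_apply (l n i) (\<theta> n v) = blinfun_apply (l n i) v" for n i v
    unfolding \<theta>_def by (rule biorth_proj_coeff[OF bi])
  obtain u lU where u: "biorthogonal k u lU" "\<And>i. i < k \<Longrightarrow> u i \<in> U"
    "\<And>i v. i < k \<Longrightarrow> \<bar>blinfun_apply (lU i) v\<bar> \<le> 3 ^ k * norm v"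
    "rank_proj k (3 ^ k) (biorth_proj k u lU)" "range (biorth_proj k u lU) = U"
    by (rule biorthogonal_on[OF U]) (rule that)
  have U_expand: "v = (\<Sum>i<k. blinfun_apply (lU i) v *\<^sub>R u i)" if "v \<in> U" for v
    using rank_proj_range_iff[OF u(4), of v] u(5) that by (simp add: biorth_proj_def)
  obtain e j0 where e: "j0 < k" "e j0 = w" "\<And>i. i < k \<Longrightarrow> e i \<in> E"
    "\<And>c. (\<Sum>i<k. c i *\<^sub>R e i) = 0 \<Longrightarrow> \<forall>i<k. c i = (0::real)"
    by (rule has_dim_basis_containing[OF E w]) (rule that)
  \<comment> \<open>\<open>S n j\<close> is the image of \<open>e j\<close> under the comparison map
    from E to U whose determinant is followed.\<close>
  have "\<forall>n j. \<exists>y. y \<in> U \<and> A n y = \<theta> n (A n (e j))" using \<theta>(2) by (metis imageE rangeI)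
  then obtain S where S: "\<And>n j. S n j \<in> U" "\<And>n j. A n (S n j) = \<theta> n (A n (e j))" by metis
  \<comment> \<open>Matrices in the bases e of E, u of U and b n of the image of U under A n:
    \<open>Tm\<close> is A n on U, \<open>am\<close> is \<theta> n after A n on E, \<open>Sm\<close>
    is the comparison map and \<open>\<beta>\<close> is L n on the image of U.\<close>
  define Tm where "Tm n i j = blinfun_apply (l n i) (A n (u j))" for n i j
  define am where "am n i j = blinfun_apply (l n i) (A n (e j))" for n i j
  define Sm where "Sm n i j = blinfun_apply (lU i) (S n j)" for n i j
  define \<beta> where "\<beta> n i j = blinfun_apply (l (Suc n) i) (L n (b n j))" for n i j
  have am: "kdet k (am n) = kdet k (Tm n) * kdet k (Sm n)" for n
  proof -
    have "am n i j = (\<Sum>p<k. Tm n i p * Sm n p j)" if "i < k" for i j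
    proof -
      have "am n i j = blinfun_apply (l n i) (A n (S n j))" unfolding am_def S(2) using l\<theta>[OF that] by simp
      also have "\<dots> = blinfun_apply (l n i) (A n (\<Sum>p<k. Sm n p j *\<^sub>R u p))"
        unfolding Sm_def using U_expand[OF S(1), of n j] by simp
      finally show ?thesis by (simp add: blinfun.sum_right blinfun.scaleR_right Tm_def mult.commute)
    qed
    then show ?thesis unfolding kdet_mult[symmetric] by (rule kdet_cong)
  qed
  have Tm: "kdet k (Tm (Suc n)) = kdet k (\<beta> n) * kdet k (Tm n)" for n
  proof -
    have "Tm (Suc n) i j = (\<Sum>p<k. \<beta> n i p * Tm n p j)" if "i < k" "j < k" for i j
    proof -
      have "A n (u j) = (\<Sum>p<k. Tm n p j *\<^sub>R b n p)"
        using \<theta>_fix[of "A n (u j)" n] u(2)[OF that(2)] unfolding \<theta>_expand Tm_def by simp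
      then have "Tm (Suc n) i j = blinfun_apply (l (Suc n) i) (L n (\<Sum>p<k. Tm n p j *\<^sub>R b n p))"
        unfolding Tm_def A by simp
      then show ?thesis by (simp add: blinfun.sum_right blinfun.scaleR_right \<beta>_def mult.commute)
    qed
    then show ?thesis unfolding kdet_mult[symmetric] by (rule kdet_cong)
  qed
  have Tm0: "kdet k (Tm n) \<noteq> 0" for n
  proof (rule kdet_nonzero)
    fix c assume c: "\<And>i. i < k \<Longrightarrow> (\<Sum>j<k. Tm n i j * c j) = 0"
    let ?v = "\<Sum>j<k. c j *\<^sub>R u j"
    have "blinfun_apply (l n i) (A n ?v) = 0" if "i < k" for i
      using c[OF that] by (simp add: blinfun.sum_right blinfun.scaleR_right Tm_def mult.commute)
    then have "\<theta> n (A n ?v) = 0" unfolding \<theta>_expand by simp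
    moreover have "?v \<in> U" using u(2) has_dim_subspace[OF U] by (intro subspace_sum subspace_scale) auto
    ultimately have "A n ?v = 0" using \<theta>_fix[of "A n ?v" n] by simp
    then have "?v = 0" by (rule inj)
    then show "\<forall>j<k. c j = 0" using biorthogonal_coeff[OF u(1), of _ c] by (simp add: blinfun.zero_right)
  qed
  have \<theta>E: "\<theta> n ` (A n ` E) = A n ` U \<and>
      (\<forall>g\<in>A n ` E. norm (g - \<theta> n g) \<le> (1 + 3 ^ k) * (s * \<tau> ^ n) * norm g \<and> norm g \<le> 2 * norm (\<theta> n g))"
    if "n \<ge> m" for n
    using near_sym_has_dim(2)[OF near[OF that] dU dE _ s(4)[OF that] \<theta>] s by simp
  have Sm0: "kdet k (Sm n) \<noteq> 0" if n: "n \<ge> m" for n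
  proof (rule kdet_nonzero)
    fix c assume c: "\<And>i. i < k \<Longrightarrow> (\<Sum>j<k. Sm n i j * c j) = 0"
    let ?v = "\<Sum>j<k. c j *\<^sub>R e j" and ?s = "\<Sum>j<k. c j *\<^sub>R S n j"
    have "?s \<in> U" using S(1) has_dim_subspace[OF U] by (intro subspace_sum subspace_scale) auto
    moreover have "blinfun_apply (lU i) ?s = 0" if "i < k" for i
      using c[OF that] by (simp add: blinfun.sum_right blinfun.scaleR_right Sm_def mult.commute)
    ultimately have "?s = 0" using U_expand[of ?s] by simp
    then have "A n ?s = 0" by simp
    then have "(\<Sum>j<k. c j *\<^sub>R \<theta> n (A n (e j))) = 0" by (simp add: blinfun.sum_right blinfun.scaleR_right S(2))
    then have "\<theta> n (A n ?v) = 0"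
      using linear_sum[OF rank_proj_linear[OF \<theta>(1)[of n]], of "\<lambda>j. c j *\<^sub>R A n (e j)" "{..<k}"]
      by (simp add: blinfun.sum_right blinfun.scaleR_right rank_proj_scale[OF \<theta>(1)])
    moreover have "?v \<in> E" using e(3) has_dim_subspace[OF E] by (intro subspace_sum subspace_scale) auto
    ultimately have "A n ?v = 0" using \<theta>E[OF n] by fastforce
    then have "?v = 0" by (rule inj)
    then show "\<forall>j<k. c j = 0" by (rule e(4))
  qed
  let ?r = "2 * (1 + 3 ^ k) * s"
  let ?rate = "3 ^ k * (3 ^ k * M * ?r / \<eta>)"
  let ?c = "fact k * (2 ^ k * (real k * ?rate))"
  have c0: "0 \<le> ?rate" and c: "0 \<le> ?c" using s L(2) low(2) by (auto intro!: mult_nonneg_nonneg divide_nonneg_pos)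
  \<comment> \<open>To follow \<theta> through one step, each basis vector b of the image of U is
    lifted along \<theta> n to a vector g of the image of E. The small difference r = g - b is
    carried through L n, projected by \<theta> (n + 1) and pulled back through L n to the image of
    U. \<open>\<Delta>\<close> is the matrix of the identity plus this correction.\<close>
  have step: "\<exists>\<Delta>. kdet k (am (Suc n)) = kdet k (\<beta> n) * (kdet k \<Delta> * kdet k (am n)) \<and>
      (\<forall>i<k. \<forall>j<k. \<bar>\<Delta> i j - (if i = j then 1 else 0)\<bar> \<le> ?rate * \<tau> ^ n)" if n: "n \<ge> m" for n
  proof -
    have "\<forall>j. \<exists>y. j < k \<longrightarrow> y \<in> A n ` E \<and> \<theta> n y = b n j" using \<theta>E[OF n] bW by (metis imageE)
    then obtain g where g: "\<And>j. j < k \<Longrightarrow> g j \<in> A n ` E" "\<And>j. j < k \<Longrightarrow> \<theta> n (g j) = b n j" by metis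
    define r where "r j = g j - b n j" for j
    have r: "norm (r j) \<le> ?r * \<tau> ^ n" if "j < k" for j
    proof -
      have "norm (r j) \<le> (1 + 3 ^ k) * (s * \<tau> ^ n) * norm (g j)" "norm (g j) \<le> 2"
        using \<theta>E[OF n] g(1,2)[OF that] b1[OF that] unfolding r_def by (metis mult.right_neutral)+
      moreover have "(1 + 3 ^ k) * (s * \<tau> ^ n) * norm (g j) \<le> (1 + 3 ^ k) * (s * \<tau> ^ n) * 2"
        using calculation(2) s by (intro mult_left_mono) auto
      moreover have "(1 + 3 ^ k) * (s * \<tau> ^ n) * 2 = ?r * \<tau> ^ n" by simp
      ultimately show ?thesis by linarith
    qed
    have "\<forall>j. \<exists>y. y \<in> A n ` U \<and> L n y = \<theta> (Suc n) (L n (r j))"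
    proof
      fix j
      have "\<theta> (Suc n) (L n (r j)) \<in> A (Suc n) ` U" using \<theta>(2) by blast
      then obtain y where "y \<in> U" "\<theta> (Suc n) (L n (r j)) = A (Suc n) y" by blast
      then show "\<exists>y. y \<in> A n ` U \<and> L n y = \<theta> (Suc n) (L n (r j))" using A by force
    qed
    then obtain b' where b': "\<And>j. b' j \<in> A n ` U" "\<And>j. L n (b' j) = \<theta> (Suc n) (L n (r j))" by metis
    have nb': "norm (b' j) \<le> 3 ^ k * M * ?r / \<eta> * \<tau> ^ n" if "j < k" for j
    proof -
      have "\<eta> * norm (b' j) \<le> norm (\<theta> (Suc n) (L n (r j)))" using low(1)[OF n b'(1)[of j]] b'(2) by simp
      also have "\<dots> \<le> 3 ^ k * norm (L n (r j))" by (rule rank_proj_norm[OF \<theta>(1)])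
      also have "\<dots> \<le> 3 ^ k * (M * norm (r j))" using L(1) by (intro mult_left_mono) auto
      also have "\<dots> \<le> 3 ^ k * (M * (?r * \<tau> ^ n))" using r[OF that] L(2) by (intro mult_left_mono) auto
      finally show ?thesis using low(2) by (simp add: field_simps)
    qed
    define \<Delta> where "\<Delta> i j = blinfun_apply (l n i) (b n j + b' j)" for i j
    have \<Delta>1: "\<bar>\<Delta> i j - (if i = j then 1 else 0)\<bar> \<le> ?rate * \<tau> ^ n" if "i < k" "j < k" for i j
    proof -
      have "\<Delta> i j - (if i = j then 1 else 0) = blinfun_apply (l n i) (b' j)"
        using bi[of n] that by (simp add: \<Delta>_def biorthogonal_def blinfun.add_right)
      then have "\<bar>\<Delta> i j - (if i = j then 1 else 0)\<bar> \<le> 3 ^ k * norm (b' j)" using lb[OF that(1)] by simp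
      also have "\<dots> \<le> 3 ^ k * (3 ^ k * M * ?r / \<eta> * \<tau> ^ n)" using nb'[OF that(2)] by (intro mult_left_mono) auto
      finally show ?thesis by (simp add: mult_ac)
    qed
    have "am (Suc n) i j = (\<Sum>q<k. \<beta> n i q * (\<Sum>p<k. \<Delta> q p * am n p j))" if ij: "i < k" "j < k" for i j
    proof -
      let ?g = "A n (e j)" and ?h = "\<Sum>p<k. am n p j *\<^sub>R g p"
      have sE: "subspace (A n ` E)" using dE by (rule has_dim_subspace)
      have "?g - ?h \<in> A n ` E"
        using e(3)[OF ij(2)] g(1) sE by (intro subspace_diff subspace_sum subspace_scale) auto
      moreover have "\<theta> n ?h = \<theta> n ?g"
        using linear_sum[OF rank_proj_linear[OF \<theta>(1)[of n]], of "\<lambda>p. am n p j *\<^sub>R g p" "{..<k}"] g(2)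
        by (simp add: rank_proj_scale[OF \<theta>(1)] am_def \<theta>_expand[of n ?g])
      then have "\<theta> n (?g - ?h) = 0" using rank_proj_diff[OF \<theta>(1)] by simp
      ultimately have "norm (?g - ?h) \<le> 2 * norm (0 :: 'v)" using \<theta>E[OF n] by metis
      then have gh: "?g = ?h" by simp
      have lg: "blinfun_apply (l (Suc n) i) (L n (g p)) = (\<Sum>q<k. \<beta> n i q * \<Delta> q p)" if p: "p < k" for p
      proof -
        have "L n (g p) = L n (b n p) + L n (r p)" by (simp add: r_def blinfun.diff_right)
        then have "blinfun_apply (l (Suc n) i) (L n (g p))
          = blinfun_apply (l (Suc n) i) (L n (b n p)) + blinfun_apply (l (Suc n) i) (L n (b' p))"
          using l\<theta>[OF ij(1), of "Suc n" "L n (r p)"] by (simp add: b'(2) blinfun.add_right)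
        also have "\<dots> = blinfun_apply (l (Suc n) i) (L n (b n p + b' p))" by (simp add: blinfun.add_right)
        also have "b n p + b' p = (\<Sum>q<k. \<Delta> q p *\<^sub>R b n q)"
          using \<theta>_fix[of "b n p + b' p" n] subspace_add[OF has_dim_subspace[OF dU] bW[OF p] b'(1)]
          unfolding \<theta>_expand \<Delta>_def by simp
        finally show ?thesis by (simp add: blinfun.sum_right blinfun.scaleR_right \<beta>_def mult.commute)
      qed
      have "am (Suc n) i j = blinfun_apply (l (Suc n) i) (L n ?g)" unfolding am_def A ..
      also have "\<dots> = blinfun_apply (l (Suc n) i) (L n ?h)" by (subst gh) (rule refl)
      also have "\<dots> = (\<Sum>p<k. am n p j * blinfun_apply (l (Suc n) i) (L n (g p)))"
        by (simp add: blinfun.sum_right blinfun.scaleR_right)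
      also have "\<dots> = (\<Sum>p<k. am n p j * (\<Sum>q<k. \<beta> n i q * \<Delta> q p))" using lg by (intro sum.cong) auto
      also have "\<dots> = (\<Sum>p<k. \<Sum>q<k. \<beta> n i q * (\<Delta> q p * am n p j))"
        by (simp add: sum_distrib_left mult_ac)
      also have "\<dots> = (\<Sum>q<k. \<Sum>p<k. \<beta> n i q * (\<Delta> q p * am n p j))" by (rule sum.swap)
      finally show ?thesis by (simp add: sum_distrib_left)
    qed
    then have "kdet k (am (Suc n)) = kdet k (\<lambda>i j. \<Sum>q<k. \<beta> n i q * (\<Sum>p<k. \<Delta> q p * am n p j))"
      by (intro kdet_cong)
    also have "\<dots> = kdet k (\<beta> n) * (kdet k \<Delta> * kdet k (am n))" by (simp only: kdet_mult)
    finally show ?thesis using \<Delta>1 by blast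
  qed
  obtain m' where m': "m' \<ge> m" "\<And>n. n \<ge> m' \<Longrightarrow> ?rate * \<tau> ^ n \<le> 1" "\<And>n. n \<ge> m' \<Longrightarrow> ?c * \<tau> ^ n \<le> 1 / 2"
  proof -
    have ev: "\<forall>\<^sub>F n in sequentially. a * \<tau> ^ n < y" if "0 < y" for a y :: real
      using s that by (intro order_tendstoD(2)[of _ 0] tendsto_mult_right_zero LIMSEQ_power_zero) auto
    have "\<forall>\<^sub>F n in sequentially. ?rate * \<tau> ^ n < 1" "\<forall>\<^sub>F n in sequentially. ?c * \<tau> ^ n < 1 / 2"
      by (rule ev, simp)+
    then have "\<forall>\<^sub>F n in sequentially. n \<ge> m \<and> ?rate * \<tau> ^ n < 1 \<and> ?c * \<tau> ^ n < 1 / 2"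
      using eventually_ge_at_top[of m] by eventually_elim blast
    then obtain m' where "\<And>n. n \<ge> m' \<Longrightarrow> n \<ge> m \<and> ?rate * \<tau> ^ n < 1 \<and> ?c * \<tau> ^ n < 1 / 2"
      unfolding eventually_sequentially by blast
    then show ?thesis using that[of m'] by (meson less_imp_le order_refl)
  qed
  have loss: "(1 - ?c * \<tau> ^ n) * \<bar>kdet k (Sm n)\<bar> \<le> \<bar>kdet k (Sm (Suc n))\<bar>" if n: "n \<ge> m'" for n
  proof -
    have nm: "n \<ge> m" using n m'(1) by simp
    obtain \<Delta> where \<Delta>: "kdet k (am (Suc n)) = kdet k (\<beta> n) * (kdet k \<Delta> * kdet k (am n))"
      "\<And>i j. i < k \<Longrightarrow> j < k \<Longrightarrow> \<bar>\<Delta> i j - (if i = j then 1 else 0)\<bar> \<le> ?rate * \<tau> ^ n"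
      using step[OF nm] by metis
    \<comment> \<open>Here the uncontrolled determinant of \<open>\<beta>\<close> is absorbed into
      that of \<open>Tm\<close> at time n + 1, which is nonzero and cancels; only
      \<open>\<Delta>\<close> is left.\<close>
    have "kdet k (Tm (Suc n)) * kdet k (Sm (Suc n)) = kdet k (Tm (Suc n)) * (kdet k \<Delta> * kdet k (Sm n))"
      using \<Delta>(1) unfolding am Tm by (simp add: mult_ac)
    then have eq: "kdet k (Sm (Suc n)) = kdet k \<Delta> * kdet k (Sm n)" using Tm0[of "Suc n"] by simp
    have "\<bar>kdet k \<Delta> - 1\<bar> \<le> fact k * (2 ^ k * (real k * (?rate * \<tau> ^ n)))"
      by (rule kdet_near_identity[OF \<Delta>(2) mult_nonneg_nonneg[OF c0] m'(2)[OF n]]) (use s in simp_all)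
    also have "\<dots> = ?c * \<tau> ^ n" by (simp only: mult.assoc)
    finally have "1 - ?c * \<tau> ^ n \<le> \<bar>kdet k \<Delta>\<bar>" by linarith
    then show ?thesis unfolding eq abs_mult by (rule mult_right_mono) simp
  qed
  have "0 < \<bar>kdet k (Sm m')\<bar>" using Sm0[OF m'(1)] by simp
  note away = bounded_away_if_summable_loss[of m' ?c \<tau> "\<lambda>n. \<bar>kdet k (Sm n)\<bar>",
      OF loss m'(3) c s(2,3) this]
  obtain \<delta> where \<delta>: "0 < \<delta>" "\<And>n. n \<ge> m' \<Longrightarrow> \<delta> \<le> \<bar>kdet k (Sm n)\<bar>"
    by (rule away) (assumption, assumption, rule that)
  let ?R = "3 ^ k * (\<bar>R\<bar> * (\<Sum>j<k. norm (e j)))"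
  \<comment> \<open>Column j0 belongs to w and decays like \<tau>^n while the others stay bounded,
    so the determinant tends to 0, against the lower bound \<delta>.\<close>
  have upper: "\<bar>kdet k (Sm n)\<bar> \<le> fact k * (?R ^ (k - 1) * (3 ^ k * (R * \<tau> ^ n)))" if n: "n \<ge> m'" for n
  proof (rule kdet_small_column)
    have nm: "n \<ge> m" using n m'(1) by simp
    show "\<bar>Sm n i j\<bar> \<le> ?R" if "i < k" "j < k" for i j
    proof -
      have "\<bar>Sm n i j\<bar> \<le> 3 ^ k * norm (S n j)" unfolding Sm_def using u(3)[OF that(1)] .
      moreover have "norm (S n j) \<le> R * norm (e j)"
        by (rule bounded[OF nm e(3)[OF that(2)] S(1) \<theta> S(2)])
      moreover have "R * norm (e j) \<le> \<bar>R\<bar> * (\<Sum>j<k. norm (e j))"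
        using that by (intro mult_mono member_le_sum) auto
      ultimately show ?thesis by (smt (verit) mult_left_mono zero_le_power)
    qed
    show "j0 < k" by (rule e(1))
    show "\<bar>Sm n i j0\<bar> \<le> 3 ^ k * (R * \<tau> ^ n)" if "i < k" for i
    proof -
      have "\<bar>Sm n i j0\<bar> \<le> 3 ^ k * norm (S n j0)" unfolding Sm_def using u(3)[OF that] .
      also have "\<dots> \<le> 3 ^ k * (R * \<tau> ^ n)"
        by (intro mult_left_mono collapse[OF nm S(1) \<theta>]) (use S(2)[of n j0] e(2) in simp_all)
      finally show ?thesis .
    qed
  qed
  have "(\<lambda>n. fact k * (?R ^ (k - 1) * (3 ^ k * (R * \<tau> ^ n)))) \<longlonglongrightarrow> 0"
    using s by (intro tendsto_mult_right_zero LIMSEQ_power_zero) auto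
  then have "\<forall>\<^sub>F n in sequentially. fact k * (?R ^ (k - 1) * (3 ^ k * (R * \<tau> ^ n))) < \<delta>"
    using \<delta>(1) by (rule order_tendstoD(2))
  then obtain n where "n \<ge> m'" "fact k * (?R ^ (k - 1) * (3 ^ k * (R * \<tau> ^ n))) < \<delta>"
    unfolding eventually_sequentially by (metis nle_le)
  then show False using upper[of n] \<delta>(2)[of n] by linarith
qed

subsection \<open>Transversality\<close>

lemma continuous_near:
  fixes S :: "'x::topological_space \<Rightarrow> 'v::real_normed_vector set"
  assumes "continuous_map euclidean grassmann.mtopology S" "0 < d" "d \<le> 1"
  obtains U where "open U" "x0 \<in> U" "\<And>x. x \<in> U \<Longrightarrow> near d (S x) (S x0)"
proof -
  obtain U where U: "openin euclidean U" "x0 \<in> U" "\<forall>y\<in>U. S y \<in> grassmann.mball (S x0) d"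
    using assms(1,2) unfolding grassmann.continuous_map_to_metric by (metis UNIV_I topspace_euclidean)
  have "near d (S x) (S x0)" if "x \<in> U" for x
  proof (rule near_if_grassmann_dist[OF _ assms(3)])
    have "S x \<in> grassmann.mball (S x0) d" using U(3) that by blast
    then show "grassmann_dist (S x) (S x0) < d" "subspace (S x)" "subspace (S x0)"
      by (simp_all add: grassmann.in_mball grassmann.commute) (simp_all add: grassmannian_def)
  qed
  then show ?thesis using that[of U] U by simp
qed

text \<open>At x0 the distance from F x0 attains a positive minimum on the compact unit sphere of E
  x0; F itself may be infinite-dimensional. Nearness carries the bound to a neighbourhood.\<close>

lemma uniform_angle:
  fixes E F :: "'x::topological_space \<Rightarrow> 'v::real_normed_vector set"
  assumes "compact (UNIV :: 'x set)"
    and E: "continuous_map euclidean grassmann.mtopology E" "\<And>x. has_dim (E x) k"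
    and F: "continuous_map euclidean grassmann.mtopology F" "\<And>x. subspace (F x)" "\<And>x. closed (F x)"
    and triv: "\<And>x. E x \<inter> F x = {0}"
  obtains \<alpha> where "0 < \<alpha>" "\<And>x e f. e \<in> E x \<Longrightarrow> f \<in> F x \<Longrightarrow> \<alpha> * norm e \<le> norm (e - f)"
proof -
  define P where "P x c \<longleftrightarrow> (\<forall>e\<in>E x. \<forall>f\<in>F x. c * norm e \<le> norm (e - f))" for x and c :: real
  obtain \<alpha> where "0 < \<alpha>" "\<And>x. P x \<alpha>"
  proof (rule compact_uniform_constant[OF assms(1), of P])
    fix x0
    have "infdist v (F x0) > 0" if "v \<in> unit_sphere (E x0)" for v
    proof -
      have "v \<noteq> 0" "v \<in> E x0" using that by (auto simp: unit_sphere_def)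
      then have "v \<notin> F x0" using triv by blast
      moreover have "F x0 \<noteq> {}" using subspace_0[OF F(2)] by blast
      ultimately show ?thesis
        using in_closed_iff_infdist_zero[OF F(3)] infdist_nonneg[of v "F x0"] by (metis order_le_less)
    qed
    then obtain c where c: "c > 0" "\<And>v. v \<in> unit_sphere (E x0) \<Longrightarrow> c \<le> infdist v (F x0)"
      by (rule bounded_below_on_has_dim[OF E(2), rotated])
        (auto intro!: continuous_on_infdist continuous_on_id)
    have lower: "c * norm e \<le> norm (e - f)" if e: "e \<in> E x0" and f: "f \<in> F x0" for e f
    proof (cases "e = 0")
      case False
      have "e /\<^sub>R norm e \<in> unit_sphere (E x0)"
        using e False has_dim_subspace[OF E(2)] by (simp add: unit_sphere_def subspace_scale)
      then have "c \<le> infdist (e /\<^sub>R norm e) (F x0)" by (rule c(2))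
      also have "\<dots> \<le> dist (e /\<^sub>R norm e) (f /\<^sub>R norm e)"
        using f F(2) by (intro infdist_le subspace_scale)
      also have "\<dots> = norm (e - f) / norm e"
        using False by (simp add: dist_norm scaleR_diff_right[symmetric] divide_inverse_commute)
      finally show ?thesis using False by (simp add: field_simps)
    qed simp
    \<comment> \<open>If the bound d failed at x, passing to nearby e0 and f0 would give norm (e0 -
      f0) < 4 d norm e, while 8 d <= c and norm e0 >= norm e / 2 give c norm e0 >= 4 d norm
      e.\<close>
    define d where "d = min 1 c / 8"
    have d: "0 < d" "d \<le> 1" "8 * d \<le> c" "8 * d \<le> 1" using c(1) by (auto simp: d_def)
    obtain U where U: "open U" "x0 \<in> U" "\<And>x. x \<in> U \<Longrightarrow> near d (E x) (E x0)"
      by (rule continuous_near[OF E(1) d(1,2)]) (rule that)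
    obtain U' where U': "open U'" "x0 \<in> U'" "\<And>x. x \<in> U' \<Longrightarrow> near d (F x) (F x0)"
      by (rule continuous_near[OF F(1) d(1,2)]) (rule that)
    have "P x d" if x: "x \<in> U \<inter> U'" for x
      unfolding P_def
    proof (intro ballI)
      fix e f assume e: "e \<in> E x" and f: "f \<in> F x"
      have "near d (E x) (E x0)" using U(3) x by blast
      then obtain e0 where e0: "e0 \<in> E x0" "norm (e - e0) \<le> d * norm e" using e by (rule nearE)
      have "near d (F x) (F x0)" using U'(3) x by blast
      then obtain f0 where f0: "f0 \<in> F x0" "norm (f - f0) \<le> d * norm f" using f by (rule nearE)
      show "d * norm e \<le> norm (e - f)"
      proof (rule ccontr)
        assume "\<not> d * norm e \<le> norm (e - f)"
        then have small: "norm (e - f) < d * norm e" by simp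
        then have pos: "0 < norm e" using d(1) by (smt (verit) norm_ge_zero zero_less_mult_pos)
        have "d * norm e \<le> 1 * norm e" using d(2) by (intro mult_right_mono) auto
        then have "norm f \<le> 2 * norm e"
          using norm_triangle_sub[of f e] small by (simp add: norm_minus_commute)
        then have "d * norm f \<le> d * (2 * norm e)" using d(1) by (intro mult_left_mono) auto
        moreover have "norm (e0 - f0) \<le> norm (e - e0) + norm (e - f) + norm (f - f0)"
        proof -
          have "e0 - f0 = - (e - e0) + (e - f) + (f - f0)" by simp
          then have "norm (e0 - f0) \<le> norm (- (e - e0) + (e - f)) + norm (f - f0)" by (metis norm_triangle_ineq)
          also have "norm (- (e - e0) + (e - f)) \<le> norm (- (e - e0)) + norm (e - f)" by (rule norm_triangle_ineq)
          finally show ?thesis by (simp add: norm_minus_commute)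
        qed
        ultimately have upper: "norm (e0 - f0) < 4 * (d * norm e)" using e0 f0 small by linarith
        have "norm e \<le> norm e0 + norm (e - e0)" by (rule norm_triangle_sub)
        moreover have "8 * (d * norm e) \<le> norm e" using mult_right_mono[OF d(4) norm_ge_zero[of e]] by simp
        ultimately have "norm e * (1 / 2) \<le> norm e0" using e0(2) norm_ge_zero[of e] by linarith
        then have "8 * d * (norm e * (1 / 2)) \<le> c * norm e0" using d c(1) by (intro mult_mono) auto
        then show False using lower[OF e0(1) f0(1)] upper by simp
      qed
    qed
    then show "\<exists>U c. open U \<and> x0 \<in> U \<and> 0 < c \<and> (\<forall>x\<in>U. P x c)"
      using U(1,2) U'(1,2) d(1) by (intro exI[of _ "U \<inter> U'"] exI[of _ d]) auto
  next
    fix x c c' assume "P x c" "0 < c'" "c' \<le> (c :: real)"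
    then show "P x c'" unfolding P_def by (meson mult_right_mono norm_ge_zero order_trans)
  qed (rule that)
  then show ?thesis using that[of \<alpha>] unfolding P_def by blast
qed

text \<open>Injectivity alone gives no lower bound in infinite dimension. On the finite-dimensional
  E x it does, and continuity of E together with compactness makes it uniform.\<close>

lemma (in continuous_cocycle) uniform_expansion:
  fixes E :: "'x \<Rightarrow> 'v set"
  assumes E: "continuous_map euclidean grassmann.mtopology E" "\<And>x. has_dim (E x) k"
  obtains \<eta> where "0 < \<eta>" "\<And>x v. v \<in> E x \<Longrightarrow> \<eta> * norm v \<le> norm (B x 1 v)"
proof -
  define P where "P x c \<longleftrightarrow> (\<forall>v\<in>E x. c * norm v \<le> norm (B x 1 v))" for x and c :: real
  obtain \<eta> where "0 < \<eta>" "\<And>x. P x \<eta>"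
  proof (rule compact_uniform_constant[OF compact_base, of P])
    fix x0
    obtain c where c: "c > 0" "\<And>v. v \<in> E x0 \<Longrightarrow> c * norm v \<le> norm (B x0 1 v)"
      by (rule injective_bounded_below[OF E(2) injB[of 1 x0]]) (simp, rule that)
    let ?b = "norm (B x0 1)"
    \<comment> \<open>Replacing v by u then costs at most c / 4; another c / 4 goes into replacing
      the operator, and c / 2 remains.\<close>
    define d where "d = min 1 (c / (4 * (c + ?b)))"
    have cb: "0 < c + ?b" using c(1) norm_ge_zero[of "B x0 1"] by linarith
    have d: "0 < d" "d \<le> 1" using c(1) cb by (auto simp: d_def)
    have d2: "d * (c + ?b) \<le> c / 4"
    proof -
      have "d * (c + ?b) \<le> c / (4 * (c + ?b)) * (c + ?b)" using cb by (intro mult_right_mono) (auto simp: d_def)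
      also have "\<dots> = c / 4" using cb by (simp add: field_simps)
      finally show ?thesis .
    qed
    obtain U where U: "open U" "x0 \<in> U" "\<And>x. x \<in> U \<Longrightarrow> near d (E x) (E x0)"
      by (rule continuous_near[OF E(1) d]) (rule that)
    have "0 < c / 4" using c(1) by simp
    then obtain U' where U': "open U'" "x0 \<in> U'" "\<And>x. x \<in> U' \<Longrightarrow> norm (B x 1 - B x0 1) < c / 4"
      by (rule close_B[of 1 "c / 4" x0, rotated]) (rule that, simp_all)
    have "P x (c / 2)" if x: "x \<in> U \<inter> U'" for x
      unfolding P_def
    proof
      fix v assume v: "v \<in> E x"
      have "near d (E x) (E x0)" using U(3) x by blast
      then obtain u where u: "u \<in> E x0" "norm (v - u) \<le> d * norm v" using v by (rule nearE)
      have "norm v \<le> norm u + norm (v - u)" by (rule norm_triangle_sub)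
      then have "c * norm v \<le> c * norm u + c * (d * norm v)"
        using u(2) c(1) by (simp add: distrib_left[symmetric])
      also have "c * norm u \<le> norm (B x0 1 u)" by (rule c(2)[OF u(1)])
      also have "norm (B x0 1 u) \<le> norm (B x0 1 v) + norm (B x0 1 (v - u))"
        unfolding blinfun.diff_right by (metis norm_minus_commute norm_triangle_sub)
      also have "norm (B x0 1 (v - u)) \<le> ?b * (d * norm v)"
        using norm_blinfun[of "B x0 1" "v - u"] mult_left_mono[OF u(2) norm_ge_zero[of "B x0 1"]] by linarith
      also have "norm (B x0 1 v) \<le> norm (B x 1 v) + norm ((B x 1 - B x0 1) v)"
        unfolding blinfun.diff_left by (metis norm_minus_commute norm_triangle_sub)
      also have "norm ((B x 1 - B x0 1) v) \<le> c / 4 * norm v"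
      proof -
        have "norm (B x 1 - B x0 1) \<le> c / 4" using U'(3) x by (intro less_imp_le) blast
        then have "norm (B x 1 - B x0 1) * norm v \<le> c / 4 * norm v" by (rule mult_right_mono) simp
        then show ?thesis using norm_blinfun[of "B x 1 - B x0 1" v] by linarith
      qed
      finally have "c * norm v \<le> norm (B x 1 v) + c / 4 * norm v + d * (c + ?b) * norm v"
        by (simp add: algebra_simps)
      moreover have "d * (c + ?b) * norm v \<le> c / 4 * norm v" using d2 by (intro mult_right_mono) auto
      ultimately show "c / 2 * norm v \<le> norm (B x 1 v)" by simp
    qed
    then show "\<exists>U c. open U \<and> x0 \<in> U \<and> 0 < c \<and> (\<forall>x\<in>U. P x c)"
      using U(1,2) U'(1,2) c(1) by (intro exI[of _ "U \<inter> U'"] exI[of _ "c / 2"]) auto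
  next
    fix x c c' assume "P x c" "0 < c'" "c' \<le> (c :: real)"
    then show "P x c'" unfolding P_def by (meson mult_right_mono norm_ge_zero order_trans)
  qed (rule that)
  then show ?thesis using that[of \<eta>] unfolding P_def by blast
qed

context approx_splitting
begin

lemma fast_expansion:
  obtains \<eta> where "0 < \<eta>" "\<eta> \<le> 1" "\<And>x v. v \<in> fast x \<Longrightarrow> \<eta> * norm v \<le> norm (B x 1 v)"
proof -
  obtain \<eta> where \<eta>: "0 < \<eta>" "\<And>x v. v \<in> fast x \<Longrightarrow> \<eta> * norm v \<le> norm (B x 1 v)"
    by (rule uniform_expansion[OF continuous_fast has_dim_fast]) (rule that)
  have "min 1 \<eta> * norm v \<le> norm (B x 1 v)" if "v \<in> fast x" for x v
    using \<eta>(2)[OF that] mult_right_mono[of "min 1 \<eta>" \<eta> "norm v"] by simp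
  then show ?thesis using that[of "min 1 \<eta>"] \<eta>(1) by simp
qed

text \<open>Supplies the complement U of F(x) for the determinant argument: the range of
  \<open>Q m x\<close> at one fixed time m. The later kernels stay near the kernel of
  \<open>Q m x\<close>, so \<open>Q n x\<close> remains bounded below on this range.\<close>

lemma transverse_range:
  obtains m where "N \<le> m" "\<And>n x u. n \<ge> m \<Longrightarrow> u \<in> range (Q m x) \<Longrightarrow> norm u \<le> 2 * K * norm (Q n x u)"
proof -
  obtain D N1 where D: "0 < D" "N \<le> N1" "\<And>n x. n \<ge> N1 \<Longrightarrow> near (D * \<tau> ^ n) (slow x) (kerQ x n)"
    "\<And>n x. n \<ge> N1 \<Longrightarrow> near (D * \<tau> ^ n) (kerQ x n) (slow x)" by (rule near_slow) (rule that)
  let ?c = "3 * K * D * (1 + K)"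
  obtain m where m: "m \<ge> N1" "\<And>n. n \<ge> m \<Longrightarrow> max D ?c * \<tau> ^ n \<le> 1 / 2"
    using eventually_small[of "1 / 2" N1 "max D ?c"] by auto
  have Dm: "D * \<tau> ^ m \<le> 1 / 2" "?c * \<tau> ^ m \<le> 1 / 2"
    using m(2)[of m] mult_right_mono[OF max.cobounded1[of D ?c] less_imp_le[OF tau_power(1)[of m]]]
      mult_right_mono[OF max.cobounded2[of ?c D] less_imp_le[OF tau_power(1)[of m]]] by linarith+
  show ?thesis
  proof (rule that[of m])
    show "N \<le> m" using m(1) D(2) by simp
    fix n x u assume n: "n \<ge> m" and u: "u \<in> range (Q m x)"
    have "near (D * \<tau> ^ m) (kerQ x n) (slow x)"
      using D(1) \<tau> n m(1) by (intro near_mono[OF D(4)] mult_left_mono power_decreasing) auto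
    then have near3: "near (3 * (D * \<tau> ^ m)) (kerQ x n) (kerQ x m)"
      using D(3)[OF m(1)] D(1) tau_power[of m] Dm(1) by (intro near_trans3) auto
    have "u - Q n x u \<in> kerQ x n" using rank_proj_ker[OF Q] by simp
    then obtain g where g: "Q m x g = 0" "norm ((u - Q n x u) - g) \<le> 3 * (D * \<tau> ^ m) * norm (u - Q n x u)"
      using nearE[OF near3] by (metis (mono_tags, lifting) mem_Collect_eq)
    have Qu: "Q m x u = u" using u rank_proj_range_iff[OF Q] by blast
    have nu: "norm (u - Q n x u) \<le> (1 + K) * norm u"
      using norm_triangle_ineq4[of u "Q n x u"] rank_proj_norm[OF Q[of n x], of u] by (simp add: algebra_simps)
    have "u - Q m x (Q n x u) = Q m x ((u - Q n x u) - g)"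
      using Qu g(1) by (simp add: rank_proj_diff[OF Q])
    then have "norm (u - Q m x (Q n x u)) \<le> K * norm ((u - Q n x u) - g)"
      using rank_proj_norm[OF Q] by simp
    also have "\<dots> \<le> K * (3 * (D * \<tau> ^ m) * ((1 + K) * norm u))"
      using g(2) nu K1 D(1) tau_power[of m] by (intro mult_left_mono order_trans[OF g(2)]) auto
    also have "\<dots> = ?c * \<tau> ^ m * norm u" by simp
    also have "\<dots> \<le> 1 / 2 * norm u" using Dm(2) by (intro mult_right_mono) auto
    finally have "norm u \<le> 2 * norm (Q m x (Q n x u))"
      using norm_triangle_sub[of u "Q m x (Q n x u)"] by simp
    then show "norm u \<le> 2 * K * norm (Q n x u)" using rank_proj_norm[OF Q, of m x "Q n x u"] by simp
  qed
qed

text \<open>A vector not too close to the kernel of Q grows at the rate of the Gelfand number,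
  because its remainder is absorbed by half of the growth of its projection.\<close>

lemma transverse_lower_bound:
  assumes n: "n \<ge> N" and u: "norm u \<le> 2 * K * norm (Q n x u)" and small: "2 * K * K * C * M * \<tau> ^ n \<le> 1 / 2"
  shows "gk x (real n) * norm u \<le> 4 * K * K * norm (B x (real n) u)"
proof -
  let ?g = "gk x (real n)" and ?q = "norm (Q n x u)"
  have g: "0 < ?g" by (simp add: gk_pos)
  have "norm (B x (real n) (Q n x u)) \<le> norm (B x (real n) u) + norm (B x (real n) (u - Q n x u))"
    unfolding blinfun.diff_right by (metis norm_minus_commute norm_triangle_sub)
  also have "norm (B x (real n) (u - Q n x u)) \<le> C * M * \<tau> ^ n * ?g * norm u" by (rule remainder_le[OF n])
  also have "\<dots> \<le> C * M * \<tau> ^ n * ?g * (2 * K * ?q)"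
    using u C M1 tau_power[of n] g by (intro mult_left_mono) auto
  finally have "K * norm (B x (real n) (Q n x u)) \<le> K * (norm (B x (real n) u) + C * M * \<tau> ^ n * ?g * (2 * K * ?q))"
    using K1 by (intro mult_left_mono) auto
  then have "?g * ?q \<le> K * norm (B x (real n) u) + (2 * K * K * C * M * \<tau> ^ n) * (?g * ?q)"
    using growth[OF n, of x u] by (simp add: algebra_simps)
  also have "(2 * K * K * C * M * \<tau> ^ n) * (?g * ?q) \<le> 1 / 2 * (?g * ?q)"
    using small g by (intro mult_right_mono) auto
  finally have "?g * ?q \<le> 2 * K * norm (B x (real n) u)" by simp
  then have "2 * K * (?g * ?q) \<le> 2 * K * (2 * K * norm (B x (real n) u))" using K1 by (intro mult_left_mono) auto
  moreover have "?g * norm u \<le> ?g * (2 * K * ?q)" using u g by (intro mult_left_mono) auto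
  ultimately show ?thesis by (simp add: mult_ac)
qed

lemma fast_slow_transverse: "fast x \<inter> slow x = {0}"
proof (rule ccontr)
  assume "fast x \<inter> slow x \<noteq> {0}"
  moreover have "0 \<in> fast x \<inter> slow x"
    using subspace_0[OF subspace_slow] subspace_0[OF has_dim_subspace[OF has_dim_fast]] by blast
  ultimately obtain w where w: "w \<in> fast x" "w \<in> slow x" "w \<noteq> 0" by blast
  obtain DF NF where DF: "0 < DF" "N \<le> NF" "\<And>n x. n \<ge> NF \<Longrightarrow> near (DF * \<tau> ^ n) (slow x) (kerQ x n)"
    by (rule near_slow) (rule that)
  obtain DE NE where DE: "0 < DE" "N \<le> NE" "\<And>n x. n \<ge> NE \<Longrightarrow> near (DE * \<tau> ^ n) (fast x) (pushed x n)"
    "\<And>n x. n \<ge> NE \<Longrightarrow> near (DE * \<tau> ^ n) (pushed x n) (fast x)" by (rule near_fast) (rule that)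
  obtain m where m: "N \<le> m" "\<And>n x u. n \<ge> m \<Longrightarrow> u \<in> range (Q m x) \<Longrightarrow> norm u \<le> 2 * K * norm (Q n x u)"
    by (rule transverse_range) (rule that)
  obtain \<eta> where \<eta>: "0 < \<eta>" "\<eta> \<le> 1" "\<And>x v. v \<in> fast x \<Longrightarrow> \<eta> * norm v \<le> norm (B x 1 v)"
    by (rule fast_expansion) (rule that)
  let ?q = "1 + 3 ^ k :: real"
  \<comment> \<open>\<open>c1\<close> measures the distance from the image of U to
    \<open>pushed\<close>, \<open>d\<close> is a common constant for the gaps between
    \<open>pushed\<close> and either the image of U or \<open>fast\<close>, and s = 3 d arises from
    composing two such gaps. \<open>bad\<close> collects everything that must be small from
    \<open>n1\<close> on.\<close>
  define c1 where "c1 = 4 * K * K * C * M"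
  define d where "d = max DE (2 * ?q * c1)"
  define s where "s = 3 * d"
  have c1: "0 < c1" using K1 C M1 by (simp add: c1_def)
  have q: "0 < ?q" by (intro add_pos_pos) simp_all
  have d: "DE \<le> d" "2 * ?q * c1 \<le> d" "0 < d" using DE(1) by (auto simp: d_def)
  have s: "0 < s" "s = 3 * d" using d by (auto simp: s_def)
  define bad where "bad = c1 + ?q * c1 + d + ?q * s + (\<eta> + M) * s"
  obtain n1 where n1: "n1 \<ge> max m (max NE NF)" "\<And>n. n \<ge> n1 \<Longrightarrow> bad * \<tau> ^ n \<le> \<eta> / 2"
    using eventually_small[of "\<eta> / 2" "max m (max NE NF)" bad] \<eta>(1) by auto
  have sm: "c1 * \<tau> ^ n \<le> 1 / 2" "?q * c1 * \<tau> ^ n \<le> 1 / 2" "d * \<tau> ^ n \<le> 1 / 2" "?q * s * \<tau> ^ n \<le> 1 / 2"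
    "(\<eta> + M) * s * \<tau> ^ n \<le> \<eta> / 2" if n: "n \<ge> n1" for n
  proof -
    have t: "0 < \<tau> ^ n" by (rule tau_power)
    have pos: "0 \<le> c1 * \<tau> ^ n" "0 \<le> ?q * c1 * \<tau> ^ n" "0 \<le> d * \<tau> ^ n" "0 \<le> ?q * s * \<tau> ^ n"
      "0 \<le> (\<eta> + M) * s * \<tau> ^ n"
      using t c1 q d(3) s(1) \<eta>(1) M1 by (auto intro!: mult_nonneg_nonneg)
    have "c1 * \<tau> ^ n + ?q * c1 * \<tau> ^ n + d * \<tau> ^ n + ?q * s * \<tau> ^ n + (\<eta> + M) * s * \<tau> ^ n \<le> \<eta> / 2"
      using n1(2)[OF n] unfolding bad_def by (simp only: distrib_right)
    then show "c1 * \<tau> ^ n \<le> 1 / 2" "?q * c1 * \<tau> ^ n \<le> 1 / 2" "d * \<tau> ^ n \<le> 1 / 2" "?q * s * \<tau> ^ n \<le> 1 / 2"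
      "(\<eta> + M) * s * \<tau> ^ n \<le> \<eta> / 2" using pos \<eta>(2) by linarith+
  qed
  let ?U = "range (Q m x)"
  have dU: "has_dim ?U k" by (rule rank_proj_range[OF Q])
  have U1: "gk x (real n) * norm u \<le> 4 * K * K * norm (B x (real n) u)" if n: "n \<ge> n1" and u: "u \<in> ?U" for n u
  proof (rule transverse_lower_bound)
    show "n \<ge> N" using n n1(1) m(1) by simp
    show "norm u \<le> 2 * K * norm (Q n x u)" using m(2)[OF _ u] n n1(1) by simp
    have "0 \<le> c1 * \<tau> ^ n" using c1 tau_power[of n] by simp
    then show "2 * K * K * C * M * \<tau> ^ n \<le> 1 / 2" using sm(1)[OF n] by (simp add: c1_def mult_ac)
  qed
  have push: "near (c1 * \<tau> ^ n) (B x (real n) ` ?U) (pushed (\<phi> (real n) x) n)" if n: "n \<ge> n1" for n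
    unfolding near_def
  proof
    fix v assume "v \<in> B x (real n) ` ?U"
    then obtain u where u: "u \<in> ?U" "v = B x (real n) u" by blast
    have nN: "n \<ge> N" using n n1(1) m(1) by simp
    have "norm (v - B x (real n) (Q n x u)) \<le> C * M * \<tau> ^ n * (gk x (real n) * norm u)"
      using remainder_le[OF nN, of x u] u(2) by (simp add: blinfun.diff_right mult_ac)
    also have "\<dots> \<le> C * M * \<tau> ^ n * (4 * K * K * norm v)"
      using U1[OF n u(1)] u(2) C M1 tau_power[of n] by (intro mult_left_mono) auto
    also have "\<dots> = c1 * \<tau> ^ n * norm v" by (simp add: c1_def)
    finally have "norm (v - B x (real n) (Q n x u)) \<le> c1 * \<tau> ^ n * norm v" .
    moreover have "B x (real n) (Q n x u) \<in> pushed (\<phi> (real n) x) n"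
      using pushedI[of n "\<phi> (real n) x" "Q n x u"] rank_proj_idem[OF Q] by (simp add: flow_inverse)
    ultimately show "\<exists>w\<in>pushed (\<phi> (real n) x) n. norm (v - w) \<le> c1 * \<tau> ^ n * norm v" by blast
  qed
  have dBU: "has_dim (B x (real n) ` ?U) k" for n
    by (rule has_dim_image[OF dU linear_B]) (use B_nonzero of_nat_0_le_iff in blast)
  have near_EU: "near (s * \<tau> ^ n) (fast (\<phi> (real n) x)) (B x (real n) ` ?U)"
    and near_UE: "near (s * \<tau> ^ n) (B x (real n) ` ?U) (fast (\<phi> (real n) x))" if n: "n \<ge> n1" for n
  proof -
    have nE: "n \<ge> NE" using n n1(1) by simp
    have t: "0 < \<tau> ^ n" by (rule tau_power)
    have 1: "near (d * \<tau> ^ n) (fast (\<phi> (real n) x)) (pushed (\<phi> (real n) x) n)"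
      "near (d * \<tau> ^ n) (pushed (\<phi> (real n) x) n) (fast (\<phi> (real n) x))"
      using mult_right_mono[OF d(1) less_imp_le[OF t]]
      by (rule near_mono[OF DE(3)[OF nE]], rule near_mono[OF DE(4)[OF nE]])
    have "near (2 * ?q * (c1 * \<tau> ^ n)) (pushed (\<phi> (real n) x) n) (B x (real n) ` ?U)"
      using near_sym_has_dim(1)[OF push[OF n] has_dim_pushed dBU] sm(2)[OF n] c1 t by (simp add: mult.assoc)
    moreover have "2 * ?q * (c1 * \<tau> ^ n) \<le> d * \<tau> ^ n"
      using mult_right_mono[OF d(2) less_imp_le[OF t]] by (simp only: mult.assoc)
    ultimately have 2: "near (d * \<tau> ^ n) (pushed (\<phi> (real n) x) n) (B x (real n) ` ?U)" by (rule near_mono)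
    have "c1 * 1 \<le> c1 * (2 * ?q)" using c1 by (intro mult_left_mono) auto
    then have "c1 \<le> d" using d(2) by (simp add: mult_ac)
    then have 3: "near (d * \<tau> ^ n) (B x (real n) ` ?U) (pushed (\<phi> (real n) x) n)"
      by (intro near_mono[OF push[OF n]] mult_right_mono) (use t in auto)
    have dd: "0 \<le> d * \<tau> ^ n" "d * \<tau> ^ n \<le> 1" using d(3) t sm(3)[OF n] by auto
    show "near (s * \<tau> ^ n) (fast (\<phi> (real n) x)) (B x (real n) ` ?U)"
      using near_trans3[OF 1(1) 2 dd] by (simp add: s_def mult.assoc)
    show "near (s * \<tau> ^ n) (B x (real n) ` ?U) (fast (\<phi> (real n) x))"
      using near_trans3[OF 3 1(2) dd] by (simp add: s_def mult.assoc)
  qed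
  define c2 where "c2 = 4 * K * K * 3 ^ k * C * M"
  have c2: "0 \<le> c2" using K1 C M1 by (simp add: c2_def)
  \<comment> \<open>v is split into u' in U and f in the kernel of \<open>Q n x\<close>. The
    comparison map fixes u' and nearly kills f, because B stretches f less than it stretches U by a
    factor of order \<tau>^n.\<close>
  have lift: "norm u \<le> 2 * K * norm (Q n x v) + c2 * \<tau> ^ n * (norm v + 2 * K * norm (Q n x v))"
    if n: "n \<ge> n1" and u: "u \<in> ?U" and \<theta>: "rank_proj k (3 ^ k) \<theta>" "range \<theta> = B x (real n) ` ?U"
      and eq: "B x (real n) u = \<theta> (B x (real n) v)" for n u v \<theta>
  proof -
    have nN: "n \<ge> N" and nm: "n \<ge> m" using n n1(1) m(1) by auto
    have "Q n x ` ?U = range (Q n x)"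
    proof (rule has_dim_image_eq[OF dU rank_proj_range[OF Q] rank_proj_linear[OF Q]])
      show "v = 0" if "v \<in> ?U" "Q n x v = 0" for v using m(2)[OF nm that(1)] that(2) by simp
    qed auto
    then obtain u' where u': "u' \<in> ?U" "Q n x u' = Q n x v" by (metis imageE rangeI)
    let ?f = "v - u'"
    have Qf: "Q n x ?f = 0" using u'(2) by (simp add: rank_proj_diff[OF Q])
    have nu': "norm u' \<le> 2 * K * norm (Q n x v)" using m(2)[OF nm u'(1)] u'(2) by simp
    have "\<theta> (B x (real n) u') = B x (real n) u'" using rank_proj_range_iff[OF \<theta>(1)] \<theta>(2) u'(1) by blast
    then have "B x (real n) (u - u') = \<theta> (B x (real n) ?f)"
      using eq rank_proj_diff[OF \<theta>(1)] by (simp add: blinfun.diff_right)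
    then have "norm (B x (real n) (u - u')) \<le> 3 ^ k * norm (B x (real n) ?f)"
      using rank_proj_norm[OF \<theta>(1)] by simp
    also have "\<dots> \<le> 3 ^ k * (C * M * \<tau> ^ n * norm ?f * gk x (real n))"
      using ker_small[OF nN Qf] by (intro mult_left_mono) auto
    finally have "4 * K * K * norm (B x (real n) (u - u')) \<le> 4 * K * K * (3 ^ k * (C * M * \<tau> ^ n * norm ?f * gk x (real n)))"
      using K1 by (intro mult_left_mono) auto
    moreover have "u - u' \<in> ?U" using u u'(1) has_dim_subspace[OF dU] by (simp add: subspace_diff)
    ultimately have "gk x (real n) * norm (u - u') \<le> gk x (real n) * (c2 * \<tau> ^ n * norm ?f)"
      using U1[OF n, of "u - u'"] by (simp add: c2_def mult_ac)
    then have "norm (u - u') \<le> c2 * \<tau> ^ n * norm ?f" using gk_pos[of "real n" x] by simp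
    also have "\<dots> \<le> c2 * \<tau> ^ n * (norm v + 2 * K * norm (Q n x v))"
      using c2 tau_power[of n] norm_triangle_ineq4[of v u'] nu' by (intro mult_left_mono) auto
    finally show ?thesis using nu' norm_triangle_sub[of u u'] by linarith
  qed
  define R where "R = 2 * K * K + c2 * (1 + 2 * K * K) + (2 * K * K * DF + c2 * (1 + 2 * K * K)) * norm w"
  have R1: "2 * K * K + c2 * (1 + 2 * K * K) \<le> R" and R2: "(2 * K * K * DF + c2 * (1 + 2 * K * K)) * norm w \<le> R"
    using K1 c2 DF(1) by (simp_all add: R_def)
  have QK: "2 * K * norm (Q n x v) \<le> 2 * K * K * norm v" for n v
    using mult_left_mono[OF rank_proj_norm[OF Q], of "2 * K" n x v] K1 by simp
  have lift': "c2 * \<tau> ^ n * (norm v + 2 * K * norm (Q n x v)) \<le> c2 * \<tau> ^ n * ((1 + 2 * K * K) * norm v)" for n v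
    using c2 tau_power[of n] QK[of n v] by (intro mult_left_mono) (auto simp: algebra_simps)
  show False
  proof (rule no_collapse[where A = "\<lambda>n. B x (real n)" and L = "\<lambda>n. B (\<phi> (real n) x) 1" and U = ?U
        and E = "fast x" and m = n1 and s = s and M = M and \<eta> = "\<eta> / 2" and R = R and w = w, OF dU has_dim_fast])
    show "B x (real (Suc n)) v = B (\<phi> (real n) x) 1 (B x (real n) v)" for n v
      using B_add_apply[of 1 "real n" x v] by (simp add: add.commute)
    show "v = 0" if "B x (real n) v = 0" for n v using that B_nonzero of_nat_0_le_iff by blast
    show "near (s * \<tau> ^ n) (B x (real n) ` fast x) (B x (real n) ` ?U)" if "n \<ge> n1" for n
      using near_EU[OF that] fast_invariant[of "real n" x] by simp
    show "0 \<le> s" "0 < \<tau>" "\<tau> < 1" "0 \<le> M" "0 < \<eta> / 2" using s(1) \<tau> M1 \<eta>(1) by auto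
    show "(1 + 3 ^ k) * (s * \<tau> ^ n) \<le> 1 / 2" if "n \<ge> n1" for n using sm(4)[OF that] by (simp only: mult.assoc)
    show "norm (B (\<phi> (real n) x) 1 v) \<le> M * norm v" for n v using MB by simp
    \<comment> \<open>The image of U is near the fast space and inherits its expansion with half the
      constant.\<close>
    show "\<eta> / 2 * norm b \<le> norm (B (\<phi> (real n) x) 1 b)" if n: "n \<ge> n1" and b: "b \<in> B x (real n) ` ?U" for n b
    proof -
      let ?z = "\<phi> (real n) x"
      obtain g where g: "g \<in> fast ?z" "norm (b - g) \<le> s * \<tau> ^ n * norm b" by (rule nearE[OF near_UE[OF n] b])
      have "\<eta> * norm b \<le> \<eta> * (norm g + norm (b - g))"
        using norm_triangle_sub[of b g] \<eta>(1) by (intro mult_left_mono) auto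
      also have "\<dots> \<le> norm (B ?z 1 g) + \<eta> * norm (b - g)" using \<eta>(3)[OF g(1)] by (simp add: distrib_left)
      also have "norm (B ?z 1 g) \<le> norm (B ?z 1 b) + norm (B ?z 1 (b - g))"
        unfolding blinfun.diff_right by (metis norm_minus_commute norm_triangle_sub)
      also have "norm (B ?z 1 (b - g)) \<le> M * norm (b - g)" using MB by simp
      finally have "\<eta> * norm b \<le> norm (B ?z 1 b) + (\<eta> + M) * norm (b - g)" by (simp add: algebra_simps)
      also have "(\<eta> + M) * norm (b - g) \<le> (\<eta> + M) * (s * \<tau> ^ n * norm b)"
        using g(2) \<eta>(1) M1 by (intro mult_left_mono) auto
      also have "\<dots> = (\<eta> + M) * s * \<tau> ^ n * norm b" by simp
      also have "\<dots> \<le> \<eta> / 2 * norm b" using sm(5)[OF n] by (intro mult_right_mono) auto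
      finally show ?thesis by simp
    qed
    show "norm u \<le> R * norm v"
      if "n \<ge> n1" "u \<in> ?U" "rank_proj k (3 ^ k) \<theta>" "range \<theta> = B x (real n) ` ?U"
        "B x (real n) u = \<theta> (B x (real n) v)" for n u v \<theta>
    proof -
      have "norm u \<le> 2 * K * K * norm v + c2 * \<tau> ^ n * ((1 + 2 * K * K) * norm v)"
        using lift[OF that] QK[of n v] lift'[of n v] by linarith
      also have "c2 * \<tau> ^ n * ((1 + 2 * K * K) * norm v) \<le> c2 * 1 * ((1 + 2 * K * K) * norm v)"
        using c2 tau_power[of n] K1 by (intro mult_right_mono mult_left_mono) auto
      finally have "norm u \<le> (2 * K * K + c2 * (1 + 2 * K * K)) * norm v" by (simp add: algebra_simps)
      also have "\<dots> \<le> R * norm v" using R1 by (intro mult_right_mono) auto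
      finally show ?thesis .
    qed
    \<comment> \<open>Here w being slow enters: it is near the kernel of \<open>Q n x\<close>, so
      its projection is of order \<tau>^n.\<close>
    show "norm u \<le> R * \<tau> ^ n"
      if n: "n \<ge> n1" and that': "u \<in> ?U" "rank_proj k (3 ^ k) \<theta>" "range \<theta> = B x (real n) ` ?U"
        "B x (real n) u = \<theta> (B x (real n) w)" for n u \<theta>
    proof -
      have "n \<ge> NF" using n n1(1) by simp
      then obtain g where g: "Q n x g = 0" "norm (w - g) \<le> DF * \<tau> ^ n * norm w"
        using nearE[OF DF(3) w(2)] by (metis (mono_tags, lifting) mem_Collect_eq)
      have "Q n x w = Q n x (w - g)" using g(1) by (simp add: rank_proj_diff[OF Q])
      then have "norm (Q n x w) \<le> K * (DF * \<tau> ^ n * norm w)"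
        using rank_proj_norm[OF Q, of n x "w - g"] g(2) K1 by (metis mult_left_mono order_trans zero_le_one)
      then have "2 * K * norm (Q n x w) \<le> 2 * K * (K * (DF * \<tau> ^ n * norm w))" using K1 by (intro mult_left_mono) auto
      then have "norm u \<le> 2 * K * (K * (DF * \<tau> ^ n * norm w)) + c2 * \<tau> ^ n * ((1 + 2 * K * K) * norm w)"
        using lift[OF n that'] lift'[of n w] by linarith
      also have "\<dots> = (2 * K * K * DF + c2 * (1 + 2 * K * K)) * norm w * \<tau> ^ n" by (simp add: algebra_simps)
      also have "\<dots> \<le> R * \<tau> ^ n" using R2 tau_power[of n] by (intro mult_right_mono) auto
      finally show ?thesis .
    qed
  qed (use w in auto)
qed

end

subsection \<open>Domination\<close>

context approx_splitting
begin

text \<open>B v stays in the slow space, while its part B (Q v) is near the fast space. The uniform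
  angle bounds this part by the other one, B (v - Q v), which is small by the remainder
  estimate.\<close>

lemma slow_decay:
  obtains R n1 where "0 < R" "\<And>n x v. n \<ge> n1 \<Longrightarrow> v \<in> slow x \<Longrightarrow>
    norm (B x (real n) v) \<le> R * \<tau> ^ n * gk x (real n) * norm v"
proof -
  obtain \<alpha> where \<alpha>: "0 < \<alpha>" "\<And>x e f. e \<in> fast x \<Longrightarrow> f \<in> slow x \<Longrightarrow> \<alpha> * norm e \<le> norm (e - f)"
    by (rule uniform_angle[OF compact_base continuous_fast has_dim_fast continuous_slow subspace_slow
          closed_slow fast_slow_transverse]) (rule that)
  obtain D N1 where D: "0 < D" "N \<le> N1" "\<And>n x. n \<ge> N1 \<Longrightarrow> near (D * \<tau> ^ n) (pushed x n) (fast x)"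
    by (rule near_fast) (rule that)
  have "0 < min (1 / 2) (\<alpha> / 4)" using \<alpha>(1) by simp
  then obtain n1 where n1: "n1 \<ge> N1" "\<And>n. n \<ge> n1 \<Longrightarrow> D * \<tau> ^ n \<le> min (1 / 2) (\<alpha> / 4)"
    using eventually_small[of _ N1 D] by blast
  let ?R = "(4 / \<alpha> + 1) * (C * M)"
  show ?thesis
  proof (rule that[of ?R n1])
    show "0 < ?R" using \<alpha>(1) C M1 by (intro mult_pos_pos add_pos_pos) auto
    fix n x v assume n: "n \<ge> n1" and v: "v \<in> slow x"
    have nN: "n \<ge> N" and nN1: "n \<ge> N1" using n n1(1) D(2) by auto
    let ?z = "\<phi> (real n) x"
    let ?e = "B x (real n) (Q n x v)" and ?f = "B x (real n) (v - Q n x v)"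
    have sum: "B x (real n) v = ?e + ?f" by (simp add: blinfun.diff_right)
    have "?e \<in> pushed ?z n"
      using pushedI[of n ?z "Q n x v"] rank_proj_idem[OF Q] by (simp add: flow_inverse)
    then obtain g where g: "g \<in> fast ?z" "norm (?e - g) \<le> D * \<tau> ^ n * norm ?e" by (rule nearE[OF D(3)[OF nN1]])
    have Dn: "D * \<tau> ^ n \<le> 1 / 2" "D * \<tau> ^ n \<le> \<alpha> / 4" using n1(2)[OF n] by auto
    have eg: "norm (?e - g) \<le> 1 / 2 * norm ?e" "norm (?e - g) \<le> \<alpha> / 4 * norm ?e"
      using order_trans[OF g(2) mult_right_mono[OF Dn(1) norm_ge_zero]]
        order_trans[OF g(2) mult_right_mono[OF Dn(2) norm_ge_zero]] by blast+
    have "B x (real n) v \<in> slow ?z" by (rule slow_invariant) (use v in auto)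
    then have "\<alpha> * norm g \<le> norm (g - (?e + ?f))" unfolding sum[symmetric] using \<alpha>(2) g(1) by blast
    also have "\<dots> = norm (- (?e - g) - ?f)" by (simp add: algebra_simps)
    also have "\<dots> \<le> norm (?e - g) + norm ?f" by (metis norm_minus_cancel norm_triangle_ineq4)
    finally have "\<alpha> * norm g \<le> \<alpha> / 4 * norm ?e + norm ?f" using eg(2) by linarith
    moreover have "norm ?e \<le> 2 * norm g" using norm_triangle_sub[of ?e g] eg(1) by linarith
    then have "\<alpha> * norm ?e \<le> \<alpha> * (2 * norm g)" using \<alpha>(1) by (intro mult_left_mono) auto
    ultimately have "\<alpha> * norm ?e \<le> 4 * norm ?f" by simp
    then have "norm ?e \<le> 4 / \<alpha> * norm ?f" using \<alpha>(1) by (simp add: field_simps)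
    then have "norm (B x (real n) v) \<le> (4 / \<alpha> + 1) * norm ?f"
      unfolding sum using norm_triangle_ineq[of ?e ?f] by (simp add: distrib_right)
    also have "\<dots> \<le> (4 / \<alpha> + 1) * (C * M * \<tau> ^ n * gk x (real n) * norm v)"
      using remainder_le[OF nN] \<alpha>(1) by (intro mult_left_mono) auto
    also have "\<dots> = ?R * \<tau> ^ n * gk x (real n) * norm v" by (simp only: mult.assoc)
    finally show "norm (B x (real n) v) \<le> ?R * \<tau> ^ n * gk x (real n) * norm v" .
  qed
qed

text \<open>The angle keeps u away from the slow space, hence from the nearby kernel of
  \<open>Q n x\<close>; so Q u is bounded below by a multiple of norm u, and it grows with the
  Gelfand number.\<close>

lemma fast_growth:
  obtains c n1 where "0 < c" "\<And>n x u. n \<ge> n1 \<Longrightarrow> u \<in> fast x \<Longrightarrow>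
    c * gk x (real n) * norm u \<le> norm (B x (real n) u)"
proof -
  obtain \<alpha> where \<alpha>: "0 < \<alpha>" "\<And>x e f. e \<in> fast x \<Longrightarrow> f \<in> slow x \<Longrightarrow> \<alpha> * norm e \<le> norm (e - f)"
    by (rule uniform_angle[OF compact_base continuous_fast has_dim_fast continuous_slow subspace_slow
          closed_slow fast_slow_transverse]) (rule that)
  obtain D N1 where D: "0 < D" "N \<le> N1" "\<And>n x. n \<ge> N1 \<Longrightarrow> near (D * \<tau> ^ n) (slow x) (kerQ x n)"
    "\<And>n x. n \<ge> N1 \<Longrightarrow> near (D * \<tau> ^ n) (kerQ x n) (slow x)" by (rule near_slow) (rule that)
  \<comment> \<open>With \<alpha> = 4 K c, the growth of Q u gives 2 c \<open>gk\<close> norm u,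
    half of which is given up to the remainder.\<close>
  define c where "c = \<alpha> / (4 * K)"
  have c: "0 < c" "\<alpha> = 4 * K * c" using \<alpha>(1) K1 by (auto simp: c_def)
  define a where "a = D * (1 + K) + C * M"
  have a: "0 \<le> D * (1 + K)" "0 \<le> C * M" using D(1) K1 C M1 by auto
  have "0 < min (\<alpha> / 2) c" using \<alpha>(1) c by simp
  then obtain n1 where n1: "n1 \<ge> N1" "\<And>n. n \<ge> n1 \<Longrightarrow> a * \<tau> ^ n \<le> min (\<alpha> / 2) c"
    using eventually_small[of _ N1 a] by blast
  show ?thesis
  proof (rule that[of c n1])
    show "0 < c" by (rule c(1))
    fix n x u assume n: "n \<ge> n1" and u: "u \<in> fast x"
    have nN: "n \<ge> N" and nN1: "n \<ge> N1" using n n1(1) D(2) by auto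
    have t: "0 < \<tau> ^ n" by (rule tau_power)
    have small: "D * (1 + K) * \<tau> ^ n \<le> \<alpha> / 2" "C * M * \<tau> ^ n \<le> c"
      using n1(2)[OF n] mult_nonneg_nonneg[OF a(1) less_imp_le[OF t]] mult_nonneg_nonneg[OF a(2) less_imp_le[OF t]]
      unfolding a_def distrib_right[of "D * (1 + K)"] by auto
    let ?g = "gk x (real n)" and ?e = "Q n x u"
    have g: "0 < ?g" by (simp add: gk_pos)
    have "u - ?e \<in> kerQ x n" using rank_proj_ker[OF Q] by simp
    then obtain f where f: "f \<in> slow x" "norm ((u - ?e) - f) \<le> D * \<tau> ^ n * norm (u - ?e)"
      by (rule nearE[OF D(4)[OF nN1]])
    have "norm (u - ?e) \<le> (1 + K) * norm u"
      using norm_triangle_ineq4[of u ?e] rank_proj_norm[OF Q[of n x], of u] by (simp add: algebra_simps)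
    then have "D * \<tau> ^ n * norm (u - ?e) \<le> D * \<tau> ^ n * ((1 + K) * norm u)"
      using D(1) t by (intro mult_left_mono) auto
    also have "\<dots> = D * (1 + K) * \<tau> ^ n * norm u" by simp
    also have "\<dots> \<le> \<alpha> / 2 * norm u" using small(1) by (intro mult_right_mono) auto
    finally have "norm ((u - ?e) - f) \<le> \<alpha> / 2 * norm u" using f(2) by linarith
    moreover have "\<alpha> * norm u \<le> norm (u - f)" by (rule \<alpha>(2)[OF u f(1)])
    moreover have "norm (u - f) \<le> norm ?e + norm ((u - ?e) - f)"
      using norm_triangle_ineq[of ?e "(u - ?e) - f"] by (simp add: algebra_simps)
    ultimately have "\<alpha> * norm u \<le> 2 * norm ?e" by linarith
    then have "2 * K * c * norm u \<le> norm ?e" using c(2) by simp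
    then have "?g * (2 * K * c * norm u) \<le> ?g * norm ?e" using g by (intro mult_left_mono) auto
    also have "\<dots> \<le> K * norm (B x (real n) ?e)" by (rule growth[OF nN])
    finally have "K * (2 * c * ?g * norm u) \<le> K * norm (B x (real n) ?e)" by (simp add: mult_ac)
    then have "2 * c * ?g * norm u \<le> norm (B x (real n) ?e)" using K1 by simp
    also have "\<dots> \<le> norm (B x (real n) u) + norm (B x (real n) (u - ?e))"
      unfolding blinfun.diff_right by (metis norm_minus_commute norm_triangle_sub)
    also have "norm (B x (real n) (u - ?e)) \<le> C * M * \<tau> ^ n * ?g * norm u" by (rule remainder_le[OF nN])
    also have "\<dots> = C * M * \<tau> ^ n * (?g * norm u)" by simp
    also have "\<dots> \<le> c * (?g * norm u)" using small(2) g by (intro mult_right_mono) auto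
    finally show "c * ?g * norm u \<le> norm (B x (real n) u)" by (simp add: mult_ac)
  qed
qed

lemma domination:
  obtains R where "0 < R" "\<And>x t u v. 0 \<le> t \<Longrightarrow> u \<in> fast x \<Longrightarrow> v \<in> slow x \<Longrightarrow>
    norm (B x t v) * norm u \<le> R * \<tau> ^ nat \<lfloor>t\<rfloor> * norm (B x t u) * norm v"
proof -
  obtain R n1 where R: "0 < R" "\<And>n x v. n \<ge> n1 \<Longrightarrow> v \<in> slow x \<Longrightarrow>
    norm (B x (real n) v) \<le> R * \<tau> ^ n * gk x (real n) * norm v" by (rule slow_decay) (rule that)
  obtain c n2 where c: "0 < c" "\<And>n x u. n \<ge> n2 \<Longrightarrow> u \<in> fast x \<Longrightarrow>
    c * gk x (real n) * norm u \<le> norm (B x (real n) u)" by (rule fast_growth) (rule that)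
  obtain \<eta> where \<eta>: "0 < \<eta>" "\<eta> \<le> 1" "\<And>x v. v \<in> fast x \<Longrightarrow> \<eta> * norm v \<le> norm (B x 1 v)"
    by (rule fast_expansion) (rule that)
  have fast_nat: "B x (real n) u \<in> fast (\<phi> (real n) x)" if "u \<in> fast x" for n u x
    using fast_forward[OF _ that] by simp
  have \<eta>n: "\<eta> ^ n * norm u \<le> norm (B x (real n) u)" if u: "u \<in> fast x" for n u x
  proof (induction n)
    case (Suc n)
    have "\<eta> ^ Suc n * norm u \<le> \<eta> * norm (B x (real n) u)" using Suc \<eta>(1) by simp
    also have "\<dots> \<le> norm (B (\<phi> (real n) x) 1 (B x (real n) u))" by (rule \<eta>(3)[OF fast_nat[OF u]])
    also have "B (\<phi> (real n) x) 1 (B x (real n) u) = B x (real (Suc n)) u"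
      using B_add_apply[of 1 "real n" x u] by (simp add: add.commute)
    finally show ?case .
  qed (simp add: B_0)
  let ?m = "max n1 n2"
  \<comment> \<open>The first summand serves n >= \<open>?m\<close>. For the smaller n only the
    crude bounds M^n and \<eta>^n are available, and dividing by the power of \<tau> at
    \<open>?m\<close> makes up for the missing decay.\<close>
  define R1 where "R1 = R / c + (M / \<eta>) ^ ?m / \<tau> ^ ?m"
  have R1: "R / c \<le> R1" "(M / \<eta>) ^ ?m / \<tau> ^ ?m \<le> R1" "0 < R1"
    using R(1) c(1) M1 \<eta>(1) \<tau> by (auto simp: R1_def intro!: add_pos_nonneg)
  have nat: "norm (B x (real n) v) * norm u \<le> R1 * \<tau> ^ n * (norm (B x (real n) u) * norm v)"
    if u: "u \<in> fast x" and v: "v \<in> slow x" for n x u v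
  proof (cases "n \<ge> ?m")
    case True
    have "norm (B x (real n) v) * norm u \<le> R * \<tau> ^ n * gk x (real n) * norm v * norm u"
      using R(2)[OF _ v] True by (intro mult_right_mono) auto
    also have "\<dots> = R / c * \<tau> ^ n * ((c * gk x (real n) * norm u) * norm v)" using c(1) by simp
    also have "\<dots> \<le> R / c * \<tau> ^ n * (norm (B x (real n) u) * norm v)"
      using c(2)[OF _ u] True R(1) c(1) tau_power[of n] by (intro mult_left_mono mult_right_mono) auto
    also have "\<dots> \<le> R1 * \<tau> ^ n * (norm (B x (real n) u) * norm v)"
      using R1(1) tau_power[of n] by (intro mult_right_mono) auto
    finally show ?thesis .
  next
    case False
    have "norm (B x (real n) v) * norm u * \<eta> ^ n \<le> (M ^ n * norm v) * (\<eta> ^ n * norm u)"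
      using mult_right_mono[OF norm_B_power[of x n v], of "\<eta> ^ n * norm u"] \<eta>(1) by (simp add: mult_ac)
    also have "\<dots> \<le> (M ^ n * norm v) * norm (B x (real n) u)"
      using \<eta>n[OF u] M1 by (intro mult_left_mono) auto
    finally have "norm (B x (real n) v) * norm u \<le> (M / \<eta>) ^ n * (norm (B x (real n) u) * norm v)"
      using \<eta>(1) by (simp add: power_divide field_simps)
    also have "\<dots> \<le> R1 * \<tau> ^ n * (norm (B x (real n) u) * norm v)"
    proof (rule mult_right_mono)
      have "1 \<le> M / \<eta>" using M1 \<eta>(1,2) by simp
      then have "(M / \<eta>) ^ n \<le> (M / \<eta>) ^ ?m" using False by (intro power_increasing) auto
      also have "\<dots> \<le> (M / \<eta>) ^ ?m * (\<tau> ^ n / \<tau> ^ ?m)"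
      proof -
        have "\<tau> ^ ?m \<le> \<tau> ^ n" using False \<tau> by (intro power_decreasing) auto
        then have "1 \<le> \<tau> ^ n / \<tau> ^ ?m" using \<tau> by simp
        moreover have "0 \<le> (M / \<eta>) ^ ?m" using M1 \<eta>(1) by simp
        ultimately show ?thesis using mult_left_mono[of 1 "\<tau> ^ n / \<tau> ^ ?m" "(M / \<eta>) ^ ?m"] by simp
      qed
      also have "\<dots> = (M / \<eta>) ^ ?m / \<tau> ^ ?m * \<tau> ^ n" by simp
      also have "\<dots> \<le> R1 * \<tau> ^ n" using R1(2) tau_power[of n] by (intro mult_right_mono) auto
      finally show "(M / \<eta>) ^ n \<le> R1 * \<tau> ^ n" .
    qed simp
    finally show ?thesis .
  qed
  show ?thesis
  proof (rule that[of "M * (R1 * (M / \<eta>))"])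
    show "0 < M * (R1 * (M / \<eta>))" using M1 R1(3) \<eta>(1) by auto
    fix x t u v assume t: "0 \<le> (t :: real)" and u: "u \<in> fast x" and v: "v \<in> slow x"
    let ?n = "nat \<lfloor>t\<rfloor>"
    let ?r = "t - real ?n" and ?z = "\<phi> (real ?n) x"
    have r: "0 \<le> ?r" "?r \<le> 1" using t by linarith+
    have tr: "B x t w = B ?z ?r (B x (real ?n) w)" for w
      using B_add_apply[of ?r "real ?n" x w] r by simp
    have up: "norm (B x t v) \<le> M * norm (B x (real ?n) v)" unfolding tr using MB r by blast
    \<comment> \<open>The lower bound \<eta> holds for unit time only, so the fractional step is
      completed to a full one, which expands by at most M.\<close>
    have "\<eta> * norm (B x (real ?n) u) \<le> norm (B ?z 1 (B x (real ?n) u))" by (rule \<eta>(3)[OF fast_nat[OF u]])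
    also have "B ?z 1 (B x (real ?n) u) = B (\<phi> ?r ?z) (1 - ?r) (B x t u)"
      unfolding tr using B_add_apply[of "1 - ?r" ?r ?z] r by simp
    also have "norm (B (\<phi> ?r ?z) (1 - ?r) (B x t u)) \<le> M * norm (B x t u)" using MB r by simp
    finally have low: "norm (B x (real ?n) u) \<le> M / \<eta> * norm (B x t u)" using \<eta>(1) by (simp add: field_simps)
    have "norm (B x t v) * norm u \<le> M * (norm (B x (real ?n) v) * norm u)"
      using mult_right_mono[OF up, of "norm u"] by simp
    also have "\<dots> \<le> M * (R1 * \<tau> ^ ?n * (norm (B x (real ?n) u) * norm v))"
      using nat[OF u v] M1 by (intro mult_left_mono) auto
    also have "\<dots> \<le> M * (R1 * \<tau> ^ ?n * (M / \<eta> * norm (B x t u) * norm v))"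
      using low M1 R1(3) tau_power[of ?n] by (intro mult_left_mono mult_right_mono) auto
    also have "\<dots> = M * (R1 * (M / \<eta>)) * \<tau> ^ ?n * norm (B x t u) * norm v" by simp
    finally show "norm (B x t v) * norm u \<le> M * (R1 * (M / \<eta>)) * \<tau> ^ ?n * norm (B x t u) * norm v" .
  qed
qed

lemma splitting: "continuous_equivariant_splitting \<phi> B fast slow"
  unfolding continuous_equivariant_splitting_def
proof (intro conjI allI impI)
  fix x
  show "fast x \<inter> slow x = {0}" by (rule fast_slow_transverse)
  have "\<exists>u\<in>fast x. \<exists>v\<in>slow x. w = u + v" for w
    by (rule codim_complement[OF subspace_slow codim_slow has_dim_fast fast_slow_transverse])
  then show "{u + v |u v. u \<in> fast x \<and> v \<in> slow x} = UNIV" by blast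
  fix t :: real assume t: "0 \<le> t"
  show "B x t ` fast x = fast (\<phi> t x)" by (rule fast_invariant[OF t])
  show "B x t ` slow x \<subseteq> slow (\<phi> t x)" using slow_invariant[OF t] by blast
qed (rule continuous_fast continuous_slow)+

end

section \<open>Construction of the approximating projections\<close>

text \<open>The range of P is kept and its kernel replaced by F. From P v = q v + P (v - q v)
  follows norm (q v) <= c norm v + (norm v + norm (q v)) / 2, whence the constant 2 c + 1.\<close>

lemma projection_along:
  fixes P :: "'v::real_normed_vector \<Rightarrow> 'v"
  assumes P: "rank_proj k c P" and F: "closed_codim k F" and c: "0 \<le> c"
    and small: "\<And>f. f \<in> F \<Longrightarrow> norm (P f) \<le> 1 / 2 * norm f"
  obtains q where "rank_proj k (2 * c + 1) q" "\<And>v. v - q v \<in> F" "\<And>v. P (q v) = q v"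
proof -
  have sF: "subspace F" and cF: "has_codim F k" using F by (auto simp: closed_codim_def)
  have sR: "subspace (range P)" by (rule has_dim_subspace[OF rank_proj_range[OF P]])
  have "e = 0" if "e \<in> range P" "e \<in> F" for e
    using small[OF that(2)] that(1) rank_proj_range_iff[OF P, of e] by simp
  moreover have "0 \<in> range P \<inter> F" using subspace_0[OF sF] subspace_0[OF sR] by blast
  ultimately have triv: "range P \<inter> F = {0}" by blast
  have ex: "\<exists>u\<in>range P. \<exists>f\<in>F. v = u + f" for v
    by (rule codim_complement[OF sF cF rank_proj_range[OF P] triv])
  obtain q where q: "linear q" "\<And>v. q v \<in> range P" "\<And>v. v - q v \<in> F" "\<And>u. u \<in> range P \<Longrightarrow> q u = u"
    by (rule direct_sum_projection[OF sR sF triv ex]) (rule that)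
  have Pq: "P (q v) = q v" for v using q(2) rank_proj_range_iff[OF P] by blast
  have bound: "norm (q v) \<le> (2 * c + 1) * norm v" for v
  proof -
    have "P v = q v + P (v - q v)" using Pq rank_proj_diff[OF P] by simp
    then have "norm (q v) \<le> norm (P v) + norm (P (v - q v))" by (metis norm_triangle_ineq4 add_diff_cancel_right')
    also have "\<dots> \<le> c * norm v + 1 / 2 * norm (v - q v)"
      using rank_proj_norm[OF P] small[OF q(3)] by (intro add_mono)
    also have "norm (v - q v) \<le> norm v + norm (q v)" by (rule norm_triangle_ineq4)
    finally show ?thesis by (simp add: algebra_simps)
  qed
  have "range q = range P" using q(2,4) by (metis image_subset_iff rangeI subsetI subset_antisym)
  moreover have "bounded_linear q"
    using linear_add[OF q(1)] linear_scale[OF q(1)] bound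
    by (intro bounded_linear_intro[of _ "2 * c + 1"]) (auto simp: mult.commute)
  ultimately have "rank_proj k (2 * c + 1) q"
    using q(2,4) bound rank_proj_range[OF P] by (simp add: rank_proj_def)
  then show ?thesis using that q(3) Pq by blast
qed

lemma rank_proj_mono: "rank_proj k c q \<Longrightarrow> c \<le> c' \<Longrightarrow> rank_proj k c' q"
  unfolding rank_proj_def by (meson mult_right_mono norm_ge_zero order_trans)

text \<open>The range has to come from the k-th Gelfand number, so that B expands it, and the kernel
  from the (k + 1)-th, so that B is small on it. These fit together: on a subspace F almost optimal
  for the latter, B is small against \<open>gk\<close>, so the Gelfand projection P nearly kills F,
  and its range can be projected onto along F.\<close>

lemma (in bounded_cocycle) approx_splitting_exists:
  assumes c: "0 < c" and \<gamma>: "0 < \<gamma>"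
    and gap: "\<And>x t. 0 \<le> t \<Longrightarrow> gelfand_number (k + 1) (B x t) \<le> c * exp (- \<gamma> * t) * gk x (t + 1)"
    and gap': "\<And>x t. 0 \<le> t \<Longrightarrow> gelfand_number (k + 1) (B (\<phi> 1 x) t) \<le> c * exp (- \<gamma> * t) * gk x (t + 1)"
  obtains Q N K C where "approx_splitting \<phi> B k M Q N K C (exp (- \<gamma>))"
proof -
  let ?\<tau> = "exp (- \<gamma>)"
  have \<tau>: "0 < ?\<tau>" "?\<tau> < 1" using \<gamma> by auto
  have exp: "exp (- \<gamma> * real n) = ?\<tau> ^ n" for n by (simp add: exp_of_nat_mult[symmetric] mult.commute)
  \<comment> \<open>One constant above three: the bound 3^k for P, the bound 2 * 3^k + 1 for q, and
    the factor 2^(k + 1) in the growth estimate.\<close>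
  define K :: real where "K = 2 * 3 ^ k + 1 + 2 ^ (k + 1)"
  define C where "C = (c + 1) * (1 + K)"
  have "0 \<le> (2 * 3 ^ k :: real)" "0 \<le> (2 ^ (k + 1) :: real)" by simp_all
  then have K: "1 \<le> K" "2 * 3 ^ k + 1 \<le> K" "2 ^ (k + 1) \<le> K" unfolding K_def by linarith+
  have C: "0 < C" using c K by (simp add: C_def)
  obtain E0 :: "'v set" where E0: "has_dim E0 k" by (rule dim_space)
  have "(\<lambda>n. 2 ^ (k + 1) * (c + 1) * M * ?\<tau> ^ n) \<longlonglongrightarrow> 0"
    using \<tau> by (intro tendsto_mult_right_zero LIMSEQ_power_zero) auto
  then have "\<forall>\<^sub>F n in sequentially. 2 ^ (k + 1) * (c + 1) * M * ?\<tau> ^ n < 1 / 2"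
    by (rule order_tendstoD(2)) simp
  then obtain N where N: "\<And>n. n \<ge> N \<Longrightarrow> 2 ^ (k + 1) * (c + 1) * M * ?\<tau> ^ n < 1 / 2"
    unfolding eventually_sequentially by blast
  have "\<exists>q. rank_proj k K q \<and> (n \<ge> N \<longrightarrow>
      (\<forall>v. norm (B x (real n) (v - q v)) \<le> C * ?\<tau> ^ n * gk x (real n + 1) * norm v) \<and>
      (\<forall>v. norm (B x (real n) (v - q v)) \<le> C * ?\<tau> ^ n * gk (\<phi> (- 1) x) (real n + 1) * norm v) \<and>
      (\<forall>v. gk x (real n) * norm (q v) \<le> K * norm (B x (real n) (q v))))" for n x
  proof -
    have g: "0 < gk x (real n)" by (simp add: gk_pos)
    obtain P where P: "rank_proj k (3 ^ k) P"
      "\<And>v. gk x (real n) * norm (P v) \<le> 2 ^ (k + 1) * norm (B x (real n) v)"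
      by (rule gelfand_projection[OF E0, of "B x (real n)"]) (use g in \<open>auto simp: gk_def\<close>)
    show ?thesis
    proof (cases "n \<ge> N")
      case False
      have "rank_proj k K P" by (rule rank_proj_mono[OF P(1)]) (use K(2) in \<open>simp add: K_def\<close>)
      then show ?thesis using False by blast
    next
      case True
      \<comment> \<open>The minimum over both ends of the gap condition, so that a single F yields
        both remainder estimates.\<close>
      let ?m = "min (gk x (real n + 1)) (gk (\<phi> (- 1) x) (real n + 1))"
      have m: "0 < ?m" by (simp add: gk_pos)
      have t: "0 < ?\<tau> ^ n" using \<tau> by simp
      have "gelfand_number (k + 1) (B x (real n)) \<le> c * ?\<tau> ^ n * ?m"
        using gap[of "real n" x] gap'[of "real n" "\<phi> (- 1) x"] unfolding exp
        by (cases "gk x (real n + 1) \<le> gk (\<phi> (- 1) x) (real n + 1)") (simp_all add: flow_inverse min_def)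
      \<comment> \<open>c + 1 instead of c, because the infimum over subspaces need not be
        attained.\<close>
      also have "\<dots> < (c + 1) * ?\<tau> ^ n * ?m" using m t by (intro mult_strict_right_mono) auto
      finally have less: "gelfand_number (k + 1) (B x (real n)) < (c + 1) * ?\<tau> ^ n * ?m" .
      have "closed_codim (k + 1 - 1) {v. P v = 0}" using closed_codim_ker[OF P(1)] by simp
      from gelfand_number_approx[OF this less] obtain F
        where F: "closed_codim k F" "restr_norm (B x (real n)) F < (c + 1) * ?\<tau> ^ n * ?m" by auto
      have sF: "subspace F" using F(1) by (simp add: closed_codim_def)
      have BF: "norm (B x (real n) f) \<le> (c + 1) * ?\<tau> ^ n * ?m * norm f" if "f \<in> F" for f
        using restr_norm_bound[OF sF that, of "B x (real n)"] mult_right_mono[OF less_imp_le[OF F(2)], of "norm f"]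
        by simp
      have smallP: "norm (P f) \<le> 1 / 2 * norm f" if f: "f \<in> F" for f
      proof -
        have "gk x (real n) * norm (P f) \<le> 2 ^ (k + 1) * ((c + 1) * ?\<tau> ^ n * ?m * norm f)"
          using P(2)[of f] BF[OF f] by (meson mult_left_mono order_trans zero_le_numeral zero_le_power)
        also have "\<dots> \<le> 2 ^ (k + 1) * ((c + 1) * ?\<tau> ^ n * (M * gk x (real n)) * norm f)"
          using gk_left[of "real n" 1 x] c t by (intro mult_left_mono mult_right_mono) auto
        also have "\<dots> = (2 ^ (k + 1) * (c + 1) * M * ?\<tau> ^ n) * (gk x (real n) * norm f)" by simp
        also have "\<dots> \<le> 1 / 2 * (gk x (real n) * norm f)"
          using N[OF True] g by (intro mult_right_mono) auto
        finally show ?thesis using g by simp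
      qed
      have "0 \<le> (3 ^ k :: real)" by simp
      from projection_along[OF P(1) F(1) this smallP]
      obtain q where q: "rank_proj k (2 * 3 ^ k + 1) q" "\<And>v. v - q v \<in> F" "\<And>v. P (q v) = q v"
        by metis
      have qK: "rank_proj k K q" by (rule rank_proj_mono[OF q(1) K(2)])
      have rem: "norm (B x (real n) (v - q v)) \<le> C * ?\<tau> ^ n * m' * norm v" if m': "?m \<le> m'" for v m'
      proof -
        have "norm (v - q v) \<le> (1 + K) * norm v"
          using norm_triangle_ineq4[of v "q v"] rank_proj_norm[OF qK, of v] by (simp add: algebra_simps)
        then have "(c + 1) * ?\<tau> ^ n * ?m * norm (v - q v) \<le> (c + 1) * ?\<tau> ^ n * ?m * ((1 + K) * norm v)"
          using c t m by (intro mult_left_mono) auto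
        also have "\<dots> = C * ?\<tau> ^ n * ?m * norm v" by (simp add: C_def)
        also have "\<dots> \<le> C * ?\<tau> ^ n * m' * norm v" using m' C t by (intro mult_right_mono mult_left_mono) auto
        finally show ?thesis using BF[OF q(2), of v] by linarith
      qed
      have "gk x (real n) * norm (q v) \<le> K * norm (B x (real n) (q v))" for v
        using P(2)[of "q v"] q(3)[of v] mult_right_mono[OF K(3), of "norm (B x (real n) (q v))"] by simp
      then show ?thesis using qK rem by (intro exI[of _ q] conjI impI allI) auto
    qed
  qed
  then obtain Q where Q: "\<And>n x. rank_proj k K (Q n x)"
    "\<And>n x v. n \<ge> N \<Longrightarrow> norm (B x (real n) (v - Q n x v)) \<le> C * ?\<tau> ^ n * gk x (real n + 1) * norm v"
    "\<And>n x v. n \<ge> N \<Longrightarrow> norm (B x (real n) (v - Q n x v)) \<le> C * ?\<tau> ^ n * gk (\<phi> (- 1) x) (real n + 1) * norm v"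
    "\<And>n x v. n \<ge> N \<Longrightarrow> gk x (real n) * norm (Q n x v) \<le> K * norm (B x (real n) (Q n x v))"
    by metis
  have "approx_splitting \<phi> B k M Q N K C ?\<tau>"
    by unfold_locales (use Q K(1) C \<tau> in auto)
  then show ?thesis by (rule that)
qed

section \<open>The two implications\<close>

context continuous_cocycle
begin

lemma splitting_if_gap:
  assumes "\<exists>C>0. \<exists>\<gamma>>0. \<forall>x. \<forall>t\<ge>0.
      (SUP \<epsilon>\<in>{0..1}. ereal (gelfand_number (k + 1) (B (\<phi> \<epsilon> x) t)))
        \<le> ereal (C * exp (- \<gamma> * t) * gelfand_number k (B x (t + 1)))"
  shows "\<exists>E F. continuous_equivariant_splitting \<phi> B E F \<and>
      (\<forall>x. (\<exists>b. finite b \<and> span b = E x) \<and> dim (E x) = k) \<and>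
      (\<exists>C>0. \<exists>\<gamma>>0. \<forall>x. \<forall>t\<ge>0.
        (SUP (u, v)\<in>{(u, v). u \<in> E x \<and> v \<in> F x \<and> norm u = 1 \<and> norm v = 1}.
            ereal (norm (blinfun_apply (B x t) v) / norm (blinfun_apply (B x t) u)))
          \<le> ereal (C * exp (- \<gamma> * t)))"
proof -
  obtain c \<gamma> where c: "0 < c" "0 < \<gamma>" and sup: "\<And>x t. 0 \<le> t \<Longrightarrow>
      (SUP \<epsilon>\<in>{0..1}. ereal (gelfand_number (k + 1) (B (\<phi> \<epsilon> x) t)))
        \<le> ereal (c * exp (- \<gamma> * t) * gelfand_number k (B x (t + 1)))" using assms by blast
  have gap: "gelfand_number (k + 1) (B (\<phi> \<epsilon> x) t) \<le> c * exp (- \<gamma> * t) * gk x (t + 1)"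
    if "0 \<le> t" "0 \<le> \<epsilon>" "\<epsilon> \<le> 1" for x t \<epsilon>
  proof -
    have "ereal (gelfand_number (k + 1) (B (\<phi> \<epsilon> x) t)) \<le> ereal (c * exp (- \<gamma> * t) * gelfand_number k (B x (t + 1)))"
      using that by (intro SUP_upper2[THEN order_trans, OF _ order_refl sup[OF that(1)]]) auto
    then show ?thesis by (simp add: gk_def)
  qed
  obtain M where M: "1 \<le> M" "\<And>x t v. 0 \<le> t \<Longrightarrow> t \<le> 1 \<Longrightarrow> norm (B x t v) \<le> M * norm v"
    by (rule uniform_bound) (rule that)
  interpret bounded_cocycle \<phi> B k M by unfold_locales (use M in auto)
  have gap0: "gelfand_number (k + 1) (B x t) \<le> c * exp (- \<gamma> * t) * gk x (t + 1)" if "0 \<le> t" for x t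
    using gap[OF that, of 0 x] by (simp add: flow_0)
  have gap1: "gelfand_number (k + 1) (B (\<phi> 1 x) t) \<le> c * exp (- \<gamma> * t) * gk x (t + 1)" if "0 \<le> t" for x t
    using gap[OF that, of 1 x] by simp
  obtain Q N K C where "approx_splitting \<phi> B k M Q N K C (exp (- \<gamma>))"
    by (rule approx_splitting_exists[OF c gap0 gap1]) (assumption, assumption, rule that)
  then interpret approx_splitting \<phi> B k M Q N K C "exp (- \<gamma>)" .
  obtain R where R: "0 < R" "\<And>x t u v. 0 \<le> t \<Longrightarrow> u \<in> fast x \<Longrightarrow> v \<in> slow x \<Longrightarrow>
    norm (B x t v) * norm u \<le> R * exp (- \<gamma>) ^ nat \<lfloor>t\<rfloor> * norm (B x t u) * norm v"
    by (rule domination) (rule that)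
  have "(SUP (u, v)\<in>{(u, v). u \<in> fast x \<and> v \<in> slow x \<and> norm u = 1 \<and> norm v = 1}.
            ereal (norm (B x t v) / norm (B x t u)))
          \<le> ereal (R * exp \<gamma> * exp (- \<gamma> * t))" if t: "0 \<le> t" for x t
  proof (rule SUP_least, clarify)
    fix u v assume u: "u \<in> fast x" "norm u = 1" and v: "v \<in> slow x" "norm v = 1"
    have "u \<noteq> 0" using u(2) by auto
    then have Bu: "0 < norm (B x t u)" using B_nonzero[OF t] by simp
    \<comment> \<open>The factor exp \<gamma> makes up for rounding t down to an integer.\<close>
    have "exp (- \<gamma>) ^ nat \<lfloor>t\<rfloor> = exp (- \<gamma> * real (nat \<lfloor>t\<rfloor>))"
      by (simp add: exp_of_nat_mult[symmetric] mult.commute)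
    also have "\<dots> \<le> exp (\<gamma> - \<gamma> * t)"
    proof -
      have "t - 1 \<le> real (nat \<lfloor>t\<rfloor>)" using t by linarith
      then have "\<gamma> * (t - 1) \<le> \<gamma> * real (nat \<lfloor>t\<rfloor>)" using c(2) by (intro mult_left_mono) auto
      then show ?thesis by (simp add: algebra_simps)
    qed
    also have "\<dots> = exp \<gamma> * exp (- \<gamma> * t)" by (simp add: exp_add[symmetric])
    finally have e: "exp (- \<gamma>) ^ nat \<lfloor>t\<rfloor> \<le> exp \<gamma> * exp (- \<gamma> * t)" .
    have "norm (B x t v) \<le> R * exp (- \<gamma>) ^ nat \<lfloor>t\<rfloor> * norm (B x t u)" using R(2)[OF t u(1) v(1)] u(2) v(2) by simp
    also have "\<dots> \<le> R * (exp \<gamma> * exp (- \<gamma> * t)) * norm (B x t u)"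
      using e R(1) by (intro mult_right_mono mult_left_mono) auto
    finally show "ereal (norm (B x t v) / norm (B x t u)) \<le> ereal (R * exp \<gamma> * exp (- \<gamma> * t))"
      using Bu by (simp add: field_simps)
  qed
  moreover have "0 < R * exp \<gamma>" using R(1) by simp
  ultimately have "\<exists>C>0. \<exists>\<gamma>>0. \<forall>x. \<forall>t\<ge>0.
        (SUP (u, v)\<in>{(u, v). u \<in> fast x \<and> v \<in> slow x \<and> norm u = 1 \<and> norm v = 1}.
            ereal (norm (blinfun_apply (B x t) v) / norm (blinfun_apply (B x t) u)))
          \<le> ereal (C * exp (- \<gamma> * t))" using c(2) by blast
  moreover have "\<forall>x. (\<exists>b. finite b \<and> span b = fast x) \<and> dim (fast x) = k"
    unfolding has_dim_iff using has_dim_fast by blast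
  ultimately show ?thesis using splitting by (intro exI[of _ fast] exI[of _ slow] conjI)
qed

text \<open>M / \<eta> enters twice: for moving the start from x to \<phi> \<epsilon> x, and for
  prolonging the time from t + \<epsilon> to t + 1. Both rest on the lower bound for B on E over
  times up to 1.\<close>

lemma gap_if_splitting:
  assumes split: "continuous_equivariant_splitting \<phi> B E F"
    and dimE: "\<And>x. has_dim (E x) k" and c: "0 < c" "0 < \<gamma>"
    and dom: "\<And>x t. 0 \<le> t \<Longrightarrow>
      (SUP (u, v)\<in>{(u, v). u \<in> E x \<and> v \<in> F x \<and> norm u = 1 \<and> norm v = 1}.
          ereal (norm (blinfun_apply (B x t) v) / norm (blinfun_apply (B x t) u)))
        \<le> ereal (c * exp (- \<gamma> * t))"
  shows "\<exists>C>0. \<exists>\<gamma>>0. \<forall>x. \<forall>t\<ge>0.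
      (SUP \<epsilon>\<in>{0..1}. ereal (gelfand_number (k + 1) (B (\<phi> \<epsilon> x) t)))
        \<le> ereal (C * exp (- \<gamma> * t) * gelfand_number k (B x (t + 1)))"
proof -
  have cE: "continuous_map euclidean grassmann.mtopology E" and cF: "continuous_map euclidean grassmann.mtopology F"
    and triv: "\<And>x. E x \<inter> F x = {0}" and sum: "\<And>x. {u + v |u v. u \<in> E x \<and> v \<in> F x} = UNIV"
    and inv: "\<And>x t. 0 \<le> t \<Longrightarrow> B x t ` E x = E (\<phi> t x)"
    using split by (auto simp: continuous_equivariant_splitting_def)
  have FG: "subspace (F x)" "closed (F x)" for x
  proof -
    have "F x \<in> grassmannian"
      using continuous_map_image_subset_topspace[OF cF] by (auto simp: grassmann.topspace_mtopology)
    then show "subspace (F x)" "closed (F x)" by (simp_all add: grassmannian_def)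
  qed
  have "\<exists>u\<in>E x. \<exists>f\<in>F x. v = u + f" for x v
  proof -
    have "v \<in> {u + v |u v. u \<in> E x \<and> v \<in> F x}" unfolding sum by simp
    then show ?thesis by blast
  qed
  then have codim: "closed_codim k (F x)" for x
    using has_codimI[OF FG(1) dimE triv] FG by (simp add: closed_codim_def)
  obtain M where M: "1 \<le> M" "\<And>x t v. 0 \<le> t \<Longrightarrow> t \<le> 1 \<Longrightarrow> norm (B x t v) \<le> M * norm v"
    by (rule uniform_bound) (rule that)
  obtain \<eta> where \<eta>: "0 < \<eta>" "\<And>x v. v \<in> E x \<Longrightarrow> \<eta> * norm v \<le> norm (B x 1 v)"
    by (rule uniform_expansion[OF cE dimE]) (rule that)
  have E_forward: "B x t u \<in> E (\<phi> t x)" if "0 \<le> t" "u \<in> E x" for x t u using inv[OF that(1)] that(2) by blast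
  \<comment> \<open>A lower bound at time s follows from the one at time 1, since the rest of the
    unit step expands by at most M.\<close>
  have low: "\<eta> / M * norm u \<le> norm (B x s u)" if u: "u \<in> E x" and s: "0 \<le> s" "s \<le> 1" for x s u
  proof -
    have "\<eta> * norm u \<le> norm (B x 1 u)" by (rule \<eta>(2)[OF u])
    also have "B x 1 u = B (\<phi> s x) (1 - s) (B x s u)" using B_add_apply[of "1 - s" s x u] s by simp
    also have "norm \<dots> \<le> M * norm (B x s u)" using M(2) s by simp
    finally show ?thesis using M(1) by (simp add: field_simps)
  qed
  \<comment> \<open>The homogeneous form remains valid when F x is trivial and the supremum is over
    the empty set.\<close>
  have dom': "norm (B x t v) * norm u \<le> c * exp (- \<gamma> * t) * norm (B x t u) * norm v"
    if t: "0 \<le> t" and u: "u \<in> E x" and v: "v \<in> F x" for x t u v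
  proof (cases "u = 0 \<or> v = 0")
    case False
    let ?u = "u /\<^sub>R norm u" and ?v = "v /\<^sub>R norm v"
    have uv: "?u \<in> E x" "?v \<in> F x" "norm ?u = 1" "norm ?v = 1"
      using False u v has_dim_subspace[OF dimE] FG by (auto simp: subspace_scale)
    have "ereal (norm (B x t ?v) / norm (B x t ?u)) \<le> (SUP (u, v)\<in>{(u, v). u \<in> E x \<and> v \<in> F x \<and> norm u = 1 \<and> norm v = 1}.
          ereal (norm (B x t v) / norm (B x t u)))"
      by (rule SUP_upper2[of "(?u, ?v)"]) (use uv in auto)
    then have "ereal (norm (B x t ?v) / norm (B x t ?u)) \<le> ereal (c * exp (- \<gamma> * t))"
      using dom[OF t, of x] by (rule order_trans)
    then have *: "norm (B x t ?v) / norm (B x t ?u) \<le> c * exp (- \<gamma> * t)" by simp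
    have nu: "0 < norm u" "0 < norm v" using False by auto
    have Bu: "0 < norm (B x t u)" using False B_nonzero[OF t] by simp
    have "norm (B x t ?v) / norm (B x t ?u) = norm (B x t v) * norm u / (norm (B x t u) * norm v)"
      using nu by (simp add: blinfun.scaleR_right field_simps)
    then have "norm (B x t v) * norm u / (norm (B x t u) * norm v) \<le> c * exp (- \<gamma> * t)" using * by simp
    then have "norm (B x t v) * norm u \<le> c * exp (- \<gamma> * t) * (norm (B x t u) * norm v)"
      using nu(2) Bu by (simp only: pos_divide_le_eq[OF mult_pos_pos])
    then show ?thesis by simp
  qed auto
  let ?R = "c * (M / \<eta>) * (M / \<eta>)"
  have Me: "0 < M / \<eta>" using M(1) \<eta>(1) by simp
  have "gelfand_number (k + 1) (B (\<phi> \<epsilon> x) t) \<le> ?R * exp (- \<gamma> * t) * gelfand_number k (B x (t + 1))"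
    if t: "0 \<le> t" and \<epsilon>: "0 \<le> \<epsilon>" "\<epsilon> \<le> 1" for x t \<epsilon>
  proof -
    let ?y = "\<phi> \<epsilon> x"
    let ?r = "restr_norm (B ?y t) (F ?y)"
    let ?e = "c * exp (- \<gamma> * t)"
    have e: "0 < ?e" using c by simp
    have r0: "0 \<le> ?r" by (rule restr_norm_nonneg[OF FG(1)])
    have "closed_codim (k + 1 - 1) (F ?y)" using codim by simp
    then have "gelfand_number (k + 1) (B ?y t) \<le> ?r" by (rule gelfand_number_le)
    also have "?r \<le> ?R * exp (- \<gamma> * t) * gelfand_number k (B x (t + 1))"
    proof -
      have "?r / (?e * (M / \<eta>) * (M / \<eta>)) \<le> gelfand_number k (B x (t + 1))"
      proof (rule gelfand_number_ge_bounded_below[OF dimE k])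
        show "0 \<le> ?r / (?e * (M / \<eta>) * (M / \<eta>))" by (rule divide_nonneg_pos[OF r0 mult_pos_pos[OF mult_pos_pos[OF e Me] Me]])
        fix u assume u: "u \<in> E x"
        let ?w = "B x \<epsilon> u"
        have w: "?w \<in> E ?y" by (rule E_forward[OF \<epsilon>(1) u])
        have 1: "norm u * ?r \<le> (M / \<eta>) * (norm ?w * ?r)"
        proof -
          have "norm u \<le> M / \<eta> * norm ?w" using low[OF u \<epsilon>] \<eta>(1) M(1) by (simp add: field_simps)
          then show ?thesis using r0 mult_right_mono[of "norm u" "M / \<eta> * norm ?w" ?r] by simp
        qed
        have 2: "norm ?w * ?r \<le> ?e * norm (B ?y t ?w)"
        proof (cases "norm ?w = 0")
          case False
          then have nw: "0 < norm ?w" by simp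
          have "?r \<le> ?e * norm (B ?y t ?w) / norm ?w"
          proof (rule restr_norm_le[OF FG(1)])
            show "0 \<le> ?e * norm (B ?y t ?w) / norm ?w" using e by simp
            fix v assume v: "v \<in> F ?y"
            show "norm (B ?y t v) \<le> ?e * norm (B ?y t ?w) / norm ?w * norm v"
              using dom'[OF t w v] nw by (simp add: field_simps)
          qed
          then show ?thesis using nw by (simp add: field_simps)
        qed (use e in simp)
        have 3: "norm (B ?y t ?w) \<le> M / \<eta> * norm (B x (t + 1) u)"
        proof -
          have eq: "B ?y t ?w = B x (t + \<epsilon>) u" using B_add_apply[OF t \<epsilon>(1)] by simp
          have "B x (t + \<epsilon>) u \<in> E (\<phi> (t + \<epsilon>) x)" by (rule E_forward) (use t \<epsilon> u in auto)
          then have "\<eta> / M * norm (B x (t + \<epsilon>) u) \<le> norm (B (\<phi> (t + \<epsilon>) x) (1 - \<epsilon>) (B x (t + \<epsilon>) u))"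
            by (rule low) (use \<epsilon> in auto)
          also have "B (\<phi> (t + \<epsilon>) x) (1 - \<epsilon>) (B x (t + \<epsilon>) u) = B x (t + 1) u"
            using B_add_apply[of "1 - \<epsilon>" "t + \<epsilon>" x u] t \<epsilon> by (simp add: algebra_simps)
          finally show ?thesis unfolding eq using \<eta>(1) M(1) by (simp add: field_simps)
        qed
        have "norm u * ?r \<le> (M / \<eta>) * (?e * (M / \<eta> * norm (B x (t + 1) u)))"
          by (rule order_trans[OF 1 mult_left_mono[OF order_trans[OF 2 mult_left_mono[OF 3 less_imp_le[OF e]]]
                  less_imp_le[OF Me]]])
        then have "?r * norm u \<le> norm (B x (t + 1) u) * (?e * (M / \<eta>) * (M / \<eta>))" by (simp only: mult_ac)
        then have "?r * norm u / (?e * (M / \<eta>) * (M / \<eta>)) \<le> norm (B x (t + 1) u)"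
          by (simp only: pos_divide_le_eq[OF mult_pos_pos[OF mult_pos_pos[OF e Me] Me]])
        then show "?r / (?e * (M / \<eta>) * (M / \<eta>)) * norm u \<le> norm (B x (t + 1) u)"
          by (simp only: times_divide_eq_left)
      qed
      then have "?r \<le> gelfand_number k (B x (t + 1)) * (?e * (M / \<eta>) * (M / \<eta>))"
        by (simp only: pos_divide_le_eq[OF mult_pos_pos[OF mult_pos_pos[OF e Me] Me]])
      then show ?thesis by (simp only: mult_ac)
    qed
    finally show ?thesis .
  qed
  then have "\<forall>x. \<forall>t\<ge>0. (SUP \<epsilon>\<in>{0..1}. ereal (gelfand_number (k + 1) (B (\<phi> \<epsilon> x) t)))
        \<le> ereal (?R * exp (- \<gamma> * t) * gelfand_number k (B x (t + 1)))"
    by (intro allI impI SUP_least) auto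
  moreover have "0 < ?R" by (rule mult_pos_pos[OF mult_pos_pos[OF c(1) Me] Me])
  ultimately show ?thesis using c(2) by blast
qed

end

theorem theorem3:
  fixes \<phi> :: "real \<Rightarrow> 'x::topological_space \<Rightarrow> 'x"
    and B :: "'x \<Rightarrow> real \<Rightarrow> 'v::banach \<Rightarrow>\<^sub>L 'v"
    and k :: nat
  assumes "compact (UNIV :: 'x set)"
    and "continuous_flow \<phi>"
    and "k \<ge> 1"
    and "\<exists>S :: 'v set. finite S \<and> independent S \<and> card S = k"
    and "cocycle_over \<phi> B"
    and "\<And>x t. t \<ge> 0 \<Longrightarrow> inj (blinfun_apply (B x t))"
    and "\<And>t. t \<ge> 0 \<Longrightarrow> continuous_on UNIV (\<lambda>x. B x t)"
    and "continuous_map (top_of_set (UNIV \<times> {0..})) strong_operator_topology (\<lambda>(x, t). B x t)"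
  shows
    "(\<exists>C>0. \<exists>\<gamma>>0. \<forall>x. \<forall>t\<ge>0.
        (SUP \<epsilon>\<in>{0..1}. ereal (gelfand_number (k + 1) (B (\<phi> \<epsilon> x) t)))
          \<le> ereal (C * exp (- \<gamma> * t) * gelfand_number k (B x (t + 1))))
     \<longleftrightarrow>
     (\<exists>E F. continuous_equivariant_splitting \<phi> B E F \<and>
        (\<forall>x. (\<exists>b. finite b \<and> span b = E x) \<and> dim (E x) = k) \<and>
        (\<exists>C>0. \<exists>\<gamma>>0. \<forall>x. \<forall>t\<ge>0.
          (SUP (u, v)\<in>{(u, v). u \<in> E x \<and> v \<in> F x \<and> norm u = 1 \<and> norm v = 1}.
              ereal (norm (blinfun_apply (B x t) v) / norm (blinfun_apply (B x t) u)))
            \<le> ereal (C * exp (- \<gamma> * t))))"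
    (is "?a \<longleftrightarrow> ?b")
proof -
  interpret continuous_cocycle \<phi> B k by unfold_locales (use assms in auto)
  show ?thesis
  proof
    assume ?a
    then show ?b by (rule splitting_if_gap)
  next
    assume ?b
    then obtain E F c \<gamma> where "continuous_equivariant_splitting \<phi> B E F" "\<And>x. has_dim (E x) k" "0 < c" "0 < \<gamma>"
      "\<And>x t. 0 \<le> t \<Longrightarrow> (SUP (u, v)\<in>{(u, v). u \<in> E x \<and> v \<in> F x \<and> norm u = 1 \<and> norm v = 1}.
          ereal (norm (blinfun_apply (B x t) v) / norm (blinfun_apply (B x t) u)))
        \<le> ereal (c * exp (- \<gamma> * t))"
      unfolding has_dim_iff by blast
    then show ?a by (rule gap_if_splitting)
  qed
qed

end
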